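(* Let $d\ge 2$ be an integer and let $\mathcal F$ be a first-order structure with universe $F$ that expands either an ordered field or a field with more than two elements. Let $\mathcal G=\langle F^d;\mathsf K,P_1,\dots,P_k\rangle$ be a finite-relational, parameter-free $\mathcal F$-definable coordinate geometry, and assume that $\mathcal G$ is semilinearly faithful over $\mathcal F$. Let $n\ge 1$ and let $R\subseteq (F^d)^n$ be any parameter-free $\mathcal F$-definable relation. Then $$R\in \mathrm{Conc}(\mathcal G)\iff R \text{ is preserved by } \mathrm{AffAut}(\mathcal G).$$
   Context: All definability is parameter-free (without parameters). $\mathcal F$ is a first-order structure whose language contains that of ordered fields $\{+,\cdot,0,1,<\}$ (ordered-field case) or of fields $\{+,\cdot,0,1\}$ (field case), possibly with further predicate, function and constant symbols, and whose corresponding reduct is an ordered field, respectively a field with more than two elements. $(F^d)^n$ is identified with $F^{dn}$; a relation on $F^d$ is $\mathcal F$-definable if the corresponding relation on $F$ is. Key relation $\mathsf K$: in the ordered-field case, $\mathsf K=\mathsf{Bw}$ (betweenness): $\mathsf{Bw}(a,b,c)\iff\exists t\,(0\le t\le 1\wedge b=(1-t)a+tc)$; in the field case, $\mathsf K=\mathsf{Col}$ (collinearity): $\mathsf{Col}(a,b,c)\iff a=b\vee b=c\vee a=c\vee\exists t\,(b=(1-t)a+tc)$, with $a,b,c\in F^d$, $t\in F$. A finite-relational, parameter-free $\mathcal F$-definable coordinate geometry on $F^d$ is a structure $\mathcal G=\langle F^d;\mathsf K,P_1,\dots,P_k\rangle$ in the finite relational language $L_{\mathcal G}=\{\mathsf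 K,P_1,\dots,P_k\}$, where each $P_i\subseteq (F^d)^{n_i}$ is parameter-free $\mathcal F$-definable. $\mathrm{Conc}(\mathcal G)$ (the concepts of $\mathcal G$) is the set of all relations on $F^d$, of any finite arity $n\ge1$, definable in $\mathcal G$ by a parameter-free $L_{\mathcal G}$-formula. $\mathrm{Aff}(F^d)$ is the group of maps $x\mapsto Ax+b$ with $A\in \mathrm{GL}_d(F)$, $b\in F^d$; $\mathrm{AffAut}(\mathcal G)=\mathrm{Aut}(\mathcal G)\cap\mathrm{Aff}(F^d)$. A relation $R\subseteq(F^d)^n$ is preserved by a group $H$ of permutations of $F^d$ if $\alpha(R)=R$ for all $\alpha\in H$, where $\alpha(R)=\{(\alpha(a_1),\dots,\alpha(a_n)):(a_1,\dots,a_n)\in R\}$. For an ultrafilter $U$ on a set $I$, $\mathcal F^U$ is the ultrapower, with universe $F^U$, and $\mathcal G(\mathcal F^U)=\langle (F^U)^d;\mathsf K^U,P_1^U,\dots,P_k^U\rangle$, where $\mathsf K^U$ is $\mathsf{Bw}$ (resp. $\mathsf{Col}$) on $(F^U)^d$ and $P_i^U$ is defined in $\mathcal F^U$ by the same formula that defines $P_i$ in $\mathcal F$. $\mathrm{AffAut}(\mathcal G(\mathcal F^U))$ is the group of automorphisms of $\mathcal G(\mathcal F^U)$ that are affine over the field $F^U$. $\mathcal G$ is semilinearly faithful over $\mathcal F$ if for every ultrafilter $U$ (on any set) and every $\alpha\in\mathrm{Aut}(\mathcal G(\mathcal F^U))$ there exist $A\in\mathrm{AffAut}(\mathcal G(\mathcal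 F^U))$ and $\sigma\in\mathrm{Aut}(\mathcal F^U)$ (an automorphism of the full expanded structure) such that $\alpha=A\circ\widetilde\sigma$, where $\widetilde\sigma(x_1,\dots,x_d)=(\sigma(x_1),\dots,\sigma(x_d))$. *)

theory Defs
  imports "HOL-Algebra.Ring" "HOL-Algebra.Bij" "HOL-Library.NList"
begin

section \<open>First-order logic\<close>

text \<open>A language consists of sets of function and relation symbols with arities;
  constant symbols are function symbols of arity 0. Structures carry an explicit universe,
  because ultrapowers are formed inside the statement. Values of an interpretation outside the
  symbols of the language, or on lists of the wrong length, are irrelevant.\<close>

record ('f, 'p) language =
  fun_syms :: "'f set"
  rel_syms :: "'p set"
  fun_arity :: "'f \<Rightarrow> nat"
  rel_arity :: "'p \<Rightarrow> nat"

record ('f, 'p, 'a) struct =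
  universe :: "'a set"
  fun_interp :: "'f \<Rightarrow> 'a list \<Rightarrow> 'a"
  rel_interp :: "'p \<Rightarrow> 'a list set"

definition is_structure :: "('f, 'p) language \<Rightarrow> ('f, 'p, 'a) struct \<Rightarrow> bool" where
  "is_structure L M \<longleftrightarrow>
     universe M \<noteq> {} \<and>
     (\<forall>f\<in>fun_syms L. \<forall>xs\<in>nlists (fun_arity L f) (universe M). fun_interp M f xs \<in> universe M) \<and>
     (\<forall>p\<in>rel_syms L. rel_interp M p \<subseteq> nlists (rel_arity L p) (universe M))"

datatype 'f tm = Var nat | Fn 'f "'f tm list"

datatype ('f, 'p) fm =
    FEq "'f tm" "'f tm"
  | FRel 'p "'f tm list"
  | FNot "('f, 'p) fm"
  | FAnd "('f, 'p) fm" "('f, 'p) fm"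
  | FEx nat "('f, 'p) fm"

fun wf_tm :: "('f, 'p) language \<Rightarrow> 'f tm \<Rightarrow> bool" where
  "wf_tm L (Var x) \<longleftrightarrow> True"
| "wf_tm L (Fn f ts) \<longleftrightarrow> f \<in> fun_syms L \<and> length ts = fun_arity L f \<and> (\<forall>t\<in>set ts. wf_tm L t)"

fun wf_fm :: "('f, 'p) language \<Rightarrow> ('f, 'p) fm \<Rightarrow> bool" where
  "wf_fm L (FEq s t) \<longleftrightarrow> wf_tm L s \<and> wf_tm L t"
| "wf_fm L (FRel p ts) \<longleftrightarrow> p \<in> rel_syms L \<and> length ts = rel_arity L p \<and> (\<forall>t\<in>set ts. wf_tm L t)"
| "wf_fm L (FNot \<phi>) \<longleftrightarrow> wf_fm L \<phi>"
| "wf_fm L (FAnd \<phi> \<psi>) \<longleftrightarrow> wf_fm L \<phi> \<and> wf_fm L \<psi>"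
| "wf_fm L (FEx x \<phi>) \<longleftrightarrow> wf_fm L \<phi>"

fun fv_tm :: "'f tm \<Rightarrow> nat set" where
  "fv_tm (Var x) = {x}"
| "fv_tm (Fn f ts) = (\<Union>t\<in>set ts. fv_tm t)"

fun fv_fm :: "('f, 'p) fm \<Rightarrow> nat set" where
  "fv_fm (FEq s t) = fv_tm s \<union> fv_tm t"
| "fv_fm (FRel p ts) = (\<Union>t\<in>set ts. fv_tm t)"
| "fv_fm (FNot \<phi>) = fv_fm \<phi>"
| "fv_fm (FAnd \<phi> \<psi>) = fv_fm \<phi> \<union> fv_fm \<psi>"
| "fv_fm (FEx x \<phi>) = fv_fm \<phi> - {x}"

fun eval_tm :: "('f, 'p, 'a) struct \<Rightarrow> (nat \<Rightarrow> 'a) \<Rightarrow> 'f tm \<Rightarrow> 'a" where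
  "eval_tm M v (Var x) = v x"
| "eval_tm M v (Fn f ts) = fun_interp M f (map (eval_tm M v) ts)"

fun sat :: "('f, 'p, 'a) struct \<Rightarrow> (nat \<Rightarrow> 'a) \<Rightarrow> ('f, 'p) fm \<Rightarrow> bool" where
  "sat M v (FEq s t) \<longleftrightarrow> eval_tm M v s = eval_tm M v t"
| "sat M v (FRel p ts) \<longleftrightarrow> map (eval_tm M v) ts \<in> rel_interp M p"
| "sat M v (FNot \<phi>) \<longleftrightarrow> \<not> sat M v \<phi>"
| "sat M v (FAnd \<phi> \<psi>) \<longleftrightarrow> sat M v \<phi> \<and> sat M v \<psi>"
| "sat M v (FEx x \<phi>) \<longleftrightarrow> (\<exists>a\<in>universe M. sat M (v(x := a)) \<phi>)"

definition is_formula :: "('f, 'p) language \<Rightarrow> nat \<Rightarrow> ('f, 'p) fm \<Rightarrow> bool" where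
  "is_formula L n \<phi> \<longleftrightarrow> wf_fm L \<phi> \<and> fv_fm \<phi> \<subseteq> {..<n}"

text \<open>The \<open>n\<close>-ary relation defined by a formula with free variables among \<open>0, \<dots>, n - 1\<close>.\<close>

definition extension :: "('f, 'p, 'a) struct \<Rightarrow> nat \<Rightarrow> ('f, 'p) fm \<Rightarrow> 'a list set" where
  "extension M n \<phi> = {xs \<in> nlists n (universe M). sat M (\<lambda>i. xs ! i) \<phi>}"

definition definable ::
    "('f, 'p) language \<Rightarrow> ('f, 'p, 'a) struct \<Rightarrow> nat \<Rightarrow> 'a list set \<Rightarrow> bool" where
  "definable L M n S \<longleftrightarrow> (\<exists>\<phi>. is_formula L n \<phi> \<and> S = extension M n \<phi>)"

definition Aut :: "('f, 'p) language \<Rightarrow> ('f, 'p, 'a) struct \<Rightarrow> ('a \<Rightarrow> 'a) set" where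
  "Aut L M = {\<alpha> \<in> Bij (universe M).
     (\<forall>f\<in>fun_syms L. \<forall>xs\<in>nlists (fun_arity L f) (universe M).
        \<alpha> (fun_interp M f xs) = fun_interp M f (map \<alpha> xs)) \<and>
     (\<forall>p\<in>rel_syms L. \<forall>xs\<in>nlists (rel_arity L p) (universe M).
        xs \<in> rel_interp M p \<longleftrightarrow> map \<alpha> xs \<in> rel_interp M p)}"


section \<open>Ultrapowers\<close>

definition ultrafilter_on :: "'i set \<Rightarrow> 'i set set \<Rightarrow> bool" where
  "ultrafilter_on I U \<longleftrightarrow>
     U \<subseteq> Pow I \<and> I \<in> U \<and> {} \<notin> U \<and>
     (\<forall>X\<in>U. \<forall>Y\<in>U. X \<inter> Y \<in> U) \<and>
     (\<forall>X\<in>U. \<forall>Y. X \<subseteq> Y \<and> Y \<subseteq> I \<longrightarrow> Y \<in> U) \<and>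
     (\<forall>X. X \<subseteq> I \<longrightarrow> X \<in> U \<or> I - X \<in> U)"

text \<open>The elements are the classes of functions \<open>I \<rightarrow> universe M\<close> modulo equality on a set
  in \<open>U\<close>. The function \<open>f\<close> sends classes to the class of the functions that are almost
  everywhere equal to \<open>f\<close> applied pointwise to representatives \<open>hs\<close> of the arguments.\<close>

definition ultrapower ::
    "'i set \<Rightarrow> 'i set set \<Rightarrow> ('f, 'p, 'a) struct \<Rightarrow> ('f, 'p, ('i \<Rightarrow> 'a) set) struct" where
  "ultrapower I U M =
     (let B = I \<rightarrow>\<^sub>E universe M in
      \<lparr>universe = B // {(g, h). g \<in> B \<and> h \<in> B \<and> {i \<in> I. g i = h i} \<in> U},
       fun_interp = (\<lambda>f cs. {g \<in> B. \<exists>hs. list_all2 (\<in>) hs cs \<and>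
          {i \<in> I. g i = fun_interp M f (map (\<lambda>h. h i) hs)} \<in> U}),
       rel_interp = (\<lambda>p. {cs. set cs \<subseteq> B // {(g, h). g \<in> B \<and> h \<in> B \<and> {i \<in> I. g i = h i} \<in> U} \<and>
          (\<exists>hs. list_all2 (\<in>) hs cs \<and> {i \<in> I. map (\<lambda>h. h i) hs \<in> rel_interp M p} \<in> U)})\<rparr>)"


section \<open>Expansions of fields and ordered fields\<close>

datatype 'f field_fun = AddSym | MulSym | ZeroSym | OneSym | ExtFun 'f

datatype 'p field_rel = LessSym | ExtRel 'p

datatype field_case = Ordered_Field_Case | Field_Case

definition reduct_ring :: "('f field_fun, 'p, 'a) struct \<Rightarrow> 'a ring" where
  "reduct_ring M =
     \<lparr>carrier = universe M,
      monoid.mult = (\<lambda>x y. fun_interp M MulSym [x, y]),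
      one = fun_interp M OneSym [],
      zero = fun_interp M ZeroSym [],
      add = (\<lambda>x y. fun_interp M AddSym [x, y])\<rparr>"

definition struct_less :: "('f, 'p field_rel, 'a) struct \<Rightarrow> 'a \<Rightarrow> 'a \<Rightarrow> bool" where
  "struct_less M x y \<longleftrightarrow> [x, y] \<in> rel_interp M LessSym"

definition ordered_field :: "'a ring \<Rightarrow> ('a \<Rightarrow> 'a \<Rightarrow> bool) \<Rightarrow> bool" where
  "ordered_field R lt \<longleftrightarrow>
     field R \<and>
     irreflp_on (carrier R) lt \<and> transp_on (carrier R) lt \<and> totalp_on (carrier R) lt \<and>
     (\<forall>x\<in>carrier R. \<forall>y\<in>carrier R. \<forall>z\<in>carrier R. lt x y \<longrightarrow> lt (x \<oplus>\<^bsub>R\<^esub> z) (y \<oplus>\<^bsub>R\<^esub> z)) \<and>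
     (\<forall>x\<in>carrier R. \<forall>y\<in>carrier R. lt \<zero>\<^bsub>R\<^esub> x \<longrightarrow> lt \<zero>\<^bsub>R\<^esub> y \<longrightarrow> lt \<zero>\<^bsub>R\<^esub> (x \<otimes>\<^bsub>R\<^esub> y))"

definition expands ::
    "field_case \<Rightarrow> ('f field_fun, 'p field_rel) language \<Rightarrow>
     ('f field_fun, 'p field_rel, 'a) struct \<Rightarrow> bool" where
  "expands c L M \<longleftrightarrow>
     is_structure L M \<and>
     {AddSym, MulSym, ZeroSym, OneSym} \<subseteq> fun_syms L \<and>
     fun_arity L AddSym = 2 \<and> fun_arity L MulSym = 2 \<and>
     fun_arity L ZeroSym = 0 \<and> fun_arity L OneSym = 0 \<and>
     (case c of
        Ordered_Field_Case \<Rightarrow>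
          LessSym \<in> rel_syms L \<and> rel_arity L LessSym = 2 \<and>
          ordered_field (reduct_ring M) (struct_less M)
      | Field_Case \<Rightarrow>
          field (reduct_ring M) \<and>
          (\<exists>x\<in>universe M. x \<noteq> \<zero>\<^bsub>reduct_ring M\<^esub> \<and> x \<noteq> \<one>\<^bsub>reduct_ring M\<^esub>))"


section \<open>Coordinate geometries\<close>

text \<open>Points of \<open>F\<^sup>d\<close> are lists of length \<open>d\<close>, and \<open>n\<close>-tuples of points are lists of points.
  Concatenation is the identification of \<open>(F\<^sup>d)\<^sup>n\<close> with \<open>F\<^sup>d\<^sup>n\<close>.\<close>

definition points :: "('f, 'p, 'a) struct \<Rightarrow> nat \<Rightarrow> 'a list set" where
  "points M d = nlists d (universe M)"

definition point_extension ::
    "('f, 'p, 'a) struct \<Rightarrow> nat \<Rightarrow> nat \<Rightarrow> ('f, 'p) fm \<Rightarrow> 'a list list set" where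
  "point_extension M d n \<phi> = {as \<in> nlists n (points M d). concat as \<in> extension M (d * n) \<phi>}"

definition point_definable ::
    "('f, 'p) language \<Rightarrow> ('f, 'p, 'a) struct \<Rightarrow> nat \<Rightarrow> nat \<Rightarrow> 'a list list set \<Rightarrow> bool" where
  "point_definable L M d n R \<longleftrightarrow>
     R \<subseteq> nlists n (points M d) \<and> definable L M (d * n) (concat ` R)"

definition on_line :: "'a ring \<Rightarrow> nat \<Rightarrow> 'a \<Rightarrow> 'a list \<Rightarrow> 'a list \<Rightarrow> 'a list \<Rightarrow> bool" where
  "on_line R d t a b c \<longleftrightarrow>
     (\<forall>i<d. b ! i = ((\<one>\<^bsub>R\<^esub> \<ominus>\<^bsub>R\<^esub> t) \<otimes>\<^bsub>R\<^esub> (a ! i)) \<oplus>\<^bsub>R\<^esub> (t \<otimes>\<^bsub>R\<^esub> (c ! i)))"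

definition Bw :: "('f field_fun, 'p field_rel, 'a) struct \<Rightarrow> nat \<Rightarrow> 'a list list set" where
  "Bw M d = {[a, b, c] | a b c. a \<in> points M d \<and> b \<in> points M d \<and> c \<in> points M d \<and>
     (\<exists>t\<in>universe M.
        (struct_less M \<zero>\<^bsub>reduct_ring M\<^esub> t \<or> \<zero>\<^bsub>reduct_ring M\<^esub> = t) \<and>
        (struct_less M t \<one>\<^bsub>reduct_ring M\<^esub> \<or> t = \<one>\<^bsub>reduct_ring M\<^esub>) \<and>
        on_line (reduct_ring M) d t a b c)}"

definition Col :: "('f field_fun, 'p field_rel, 'a) struct \<Rightarrow> nat \<Rightarrow> 'a list list set" where
  "Col M d = {[a, b, c] | a b c. a \<in> points M d \<and> b \<in> points M d \<and> c \<in> points M d \<and>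
     (a = b \<or> b = c \<or> a = c \<or> (\<exists>t\<in>universe M. on_line (reduct_ring M) d t a b c))}"

fun key_rel :: "field_case \<Rightarrow> ('f field_fun, 'p field_rel, 'a) struct \<Rightarrow> nat \<Rightarrow> 'a list list set" where
  "key_rel Ordered_Field_Case M d = Bw M d"
| "key_rel Field_Case M d = Col M d"

datatype geo_rel = KeySym | RelSym nat

text \<open>The relational language \<open>{K, P\<^sub>1, \<dots>, P\<^sub>k}\<close>, where \<open>P\<^sub>i\<close> has arity \<open>ar i\<close>.\<close>

definition geo_language :: "nat \<Rightarrow> (nat \<Rightarrow> nat) \<Rightarrow> (unit, geo_rel) language" where
  "geo_language k ar =
     \<lparr>fun_syms = {}, rel_syms = insert KeySym (RelSym ` {1..k}), fun_arity = (\<lambda>_. 0),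
      rel_arity = (\<lambda>s. case s of KeySym \<Rightarrow> 3 | RelSym i \<Rightarrow> ar i)\<rparr>"

definition geometry ::
    "field_case \<Rightarrow> ('f field_fun, 'p field_rel, 'a) struct \<Rightarrow> nat \<Rightarrow> (nat \<Rightarrow> 'a list list set) \<Rightarrow>
     (unit, geo_rel, 'a list) struct" where
  "geometry c M d P =
     \<lparr>universe = points M d, fun_interp = (\<lambda>_ _. undefined),
      rel_interp = (\<lambda>s. case s of KeySym \<Rightarrow> key_rel c M d | RelSym i \<Rightarrow> P i)\<rparr>"

definition Conc :: "('f, 'p) language \<Rightarrow> ('f, 'p, 'a) struct \<Rightarrow> 'a list set set" where
  "Conc L M = {R. \<exists>n\<ge>1. definable L M n R}"


section \<open>Affine automorphisms and semilinear faithfulness\<close>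

text \<open>A \<open>d \<times> d\<close> matrix is a function of which only the entries with indices below \<open>d\<close> matter.\<close>

definition inverse_matrices ::
    "'a ring \<Rightarrow> nat \<Rightarrow> (nat \<Rightarrow> nat \<Rightarrow> 'a) \<Rightarrow> (nat \<Rightarrow> nat \<Rightarrow> 'a) \<Rightarrow> bool" where
  "inverse_matrices R d A B \<longleftrightarrow>
     (\<forall>i<d. \<forall>j<d. (\<Oplus>\<^bsub>R\<^esub>l\<in>{..<d}. A i l \<otimes>\<^bsub>R\<^esub> B l j) = (if i = j then \<one>\<^bsub>R\<^esub> else \<zero>\<^bsub>R\<^esub>) \<and>
                  (\<Oplus>\<^bsub>R\<^esub>l\<in>{..<d}. B i l \<otimes>\<^bsub>R\<^esub> A l j) = (if i = j then \<one>\<^bsub>R\<^esub> else \<zero>\<^bsub>R\<^esub>))"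

definition GL :: "'a ring \<Rightarrow> nat \<Rightarrow> (nat \<Rightarrow> nat \<Rightarrow> 'a) set" where
  "GL R d = {A. (\<forall>i<d. \<forall>j<d. A i j \<in> carrier R) \<and>
     (\<exists>B. (\<forall>i<d. \<forall>j<d. B i j \<in> carrier R) \<and> inverse_matrices R d A B)}"

definition affine_map :: "'a ring \<Rightarrow> nat \<Rightarrow> (nat \<Rightarrow> nat \<Rightarrow> 'a) \<Rightarrow> 'a list \<Rightarrow> 'a list \<Rightarrow> 'a list" where
  "affine_map R d A b =
     (\<lambda>x\<in>nlists d (carrier R).
        map (\<lambda>i. (\<Oplus>\<^bsub>R\<^esub>j\<in>{..<d}. A i j \<otimes>\<^bsub>R\<^esub> (x ! j)) \<oplus>\<^bsub>R\<^esub> (b ! i)) [0..<d])"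

definition Aff :: "'a ring \<Rightarrow> nat \<Rightarrow> ('a list \<Rightarrow> 'a list) set" where
  "Aff R d = {affine_map R d A b | A b. A \<in> GL R d \<and> b \<in> nlists d (carrier R)}"

definition AffAut ::
    "field_case \<Rightarrow> ('f field_fun, 'p field_rel, 'a) struct \<Rightarrow> nat \<Rightarrow> nat \<Rightarrow> (nat \<Rightarrow> nat) \<Rightarrow>
     (nat \<Rightarrow> 'a list list set) \<Rightarrow> ('a list \<Rightarrow> 'a list) set" where
  "AffAut c M d k ar P = Aut (geo_language k ar) (geometry c M d P) \<inter> Aff (reduct_ring M) d"

definition preserved_by :: "'b list set \<Rightarrow> ('b \<Rightarrow> 'b) set \<Rightarrow> bool" where
  "preserved_by R H \<longleftrightarrow> (\<forall>\<alpha>\<in>H. map \<alpha> ` R = R)"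

text \<open>\<open>\<phi> i\<close> is the formula that defines \<open>P\<^sub>i\<close>. The quantifier over index sets ranges over all
  sets of elements of the type \<open>'i\<close>, since HOL does not allow quantification over types inside a
  formula; hence the type argument. With \<open>'i = (nat \<Rightarrow> 'a) set\<close>, where \<open>'a\<close> is the type of the
  elements of the structure, all ultrafilters on sets of cardinality at most that of
  \<open>(nat \<Rightarrow> 'a) set\<close> are covered up to a bijection of the index set. Faithfulness over this type
  is thus implied by faithfulness over arbitrary index sets.\<close>

definition semilinearly_faithful ::
    "'i itself \<Rightarrow> field_case \<Rightarrow> ('f field_fun, 'p field_rel) language \<Rightarrow>
     ('f field_fun, 'p field_rel, 'a) struct \<Rightarrow> nat \<Rightarrow> nat \<Rightarrow> (nat \<Rightarrow> nat) \<Rightarrow>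
     (nat \<Rightarrow> ('f field_fun, 'p field_rel) fm) \<Rightarrow> bool" where
  "semilinearly_faithful _ c L M d k ar \<phi> \<longleftrightarrow>
     (\<forall>(I :: 'i set) U. ultrafilter_on I U \<longrightarrow>
        (let N = ultrapower I U M;
             P = (\<lambda>i. point_extension N d (ar i) (\<phi> i))
         in \<forall>\<alpha>\<in>Aut (geo_language k ar) (geometry c N d P).
              \<exists>A\<in>AffAut c N d k ar P. \<exists>\<sigma>\<in>Aut L N. \<alpha> = compose (points N d) A (map \<sigma>)))"

end

(*
If R is not definable in G, then two tuples with the same type over G, one inside R and one
outside, appear in a suitable ultrapower, and the point is to find an ultrapower of G with an
automorphism that moves the first tuple to the second. This is done as in Shelah's proof of the
Keisler-Shelah theorem, without GCH: with kappa = |nat => 'a| and index set I of size 2^kappa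
there are 2^|I| functions on I such that any kappa of them take prescribed values at a common
index. In |I -> G| steps one builds a filter and a total and surjective relation on I -> G that
preserves all formulas modulo the filter; each step uses up an independent function as the new
partner, and besides no more of them than there are earlier steps or indices. Any ultrafilter containing
the filter turns the relation into an automorphism.

By semilinear faithfulness this automorphism is A o sigma. The field automorphism sigma preserves
the F-definable relation R of the ultrapower. So does A, because an affine automorphism of the
ultrapower is almost everywhere given by affine automorphisms of G, and these preserve R. This is a
contradiction.
*)
theory Submission
  imports "HOL-Algebra.Free_Abelian_Groups" Defs
begin

text \<open>Saturation of an ultrapower over I is guaranteed only up to |I|^+, while its size can
  reach 2^|I|; back-and-forth between saturated structures would thus need GCH. Here each function
  on I gets a partner read off a coordinate that no earlier requirement mentions. The obstacle: the
  filter built so far might bar every fresh coordinate from the values that the formulas demand. But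
  a function g to be matched has at most kappa values, and values for kappa coordinates can be
  prescribed at once. If every value y could be given to a coordinate barred from agreeing with g,
  all these coordinates together would leave g no value. Hence a condition of size kappa removes the
  danger in advance.

  The cardinal kappa is infinite even for finite F and bounds |F^d|. Since |I| = 2^kappa, at most
  2^|I| functions have to be treated. The start is possible because finitely many formulas never
  separate R from its complement, or R would be a Boolean combination of them. All formulas, and not
  only the basic relations, have to be preserved since the existence of a partner is itself
  expressed by a formula.\<close>

unbundle cardinal_syntax

section \<open>Transfinite constructions and independent families\<close>

lemma card_of_Un_ordLeq:
  assumes "infinite B" "|A1| \<le>o |B|" "|A2| \<le>o |B|"
  shows "|A1 \<union> A2| \<le>o |B|"
  using assms by (simp add: card_of_Un_ordLeq_infinite_Field)

lemma finite_subset_Union_pairwise_chain: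
  assumes "finite A" "A \<subseteq> \<Union>\<C>" "\<C> \<noteq> {}" "\<And>X Y. X \<in> \<C> \<Longrightarrow> Y \<in> \<C> \<Longrightarrow> X \<subseteq> Y \<or> Y \<subseteq> X"
  shows "\<exists>X\<in>\<C>. A \<subseteq> X"
proof -
  have "subset.chain UNIV \<C>" unfolding subset_chain_def using assms(4) by simp
  then show ?thesis by (meson finite_subset_Union_chain[OF assms(1-3)])
qed

lemma card_of_insert_ordLeq:
  assumes "infinite B" "|A| \<le>o |B|"
  shows "|insert a A| \<le>o |B|"
proof -
  have "|{a}| \<le>o |B|" using assms(1) by (intro card_of_singl_ordLeq) auto
  then show ?thesis using card_of_Un_ordLeq[OF assms(1) _ assms(2), of "{a}"] by simp
qed

lemma card_of_vimage_inj:
  assumes "inj f"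
  shows "|f -` A| \<le>o |A|"
proof -
  have "inj_on f (f -` A) \<and> f ` (f -` A) \<subseteq> A" using assms inj_on_subset by auto
  then show ?thesis using card_of_ordLeq by blast
qed

text \<open>The tasks are done along a well-order of T of type |T|. Each proper initial segment is
  then smaller than T, and a stage enlarges its predecessor by at most |L|, so the set reached
  before a task has size at most |L| or less than |T|. This bound is what a step may rely
  on.\<close>

lemma transfinite_tasks:
  fixes Good :: "'x set \<Rightarrow> bool" and Done :: "'t \<Rightarrow> 'x set \<Rightarrow> bool"
    and T :: "'t set" and L :: "'l set"
  assumes L: "infinite L"
    and S0: "Good S0" "|S0| \<le>o |L|"
    and chain: "\<And>C. C \<noteq> {} \<Longrightarrow> (\<And>X Y. X \<in> C \<Longrightarrow> Y \<in> C \<Longrightarrow> X \<subseteq> Y \<or> Y \<subseteq> X) \<Longrightarrow>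
      (\<And>X. X \<in> C \<Longrightarrow> Good X) \<Longrightarrow> Good (\<Union>C)"
    and mono: "\<And>t S S'. Done t S \<Longrightarrow> S \<subseteq> S' \<Longrightarrow> Good S' \<Longrightarrow> Done t S'"
    and step: "\<And>t S. t \<in> T \<Longrightarrow> Good S \<Longrightarrow> S0 \<subseteq> S \<Longrightarrow> |S| \<le>o |L| \<or> |S| <o |T| \<Longrightarrow>
      \<exists>S'. S \<subseteq> S' \<and> Good S' \<and> Done t S' \<and> |S'| \<le>o |S <+> L|"
  shows "\<exists>S. S0 \<subseteq> S \<and> Good S \<and> (\<forall>t\<in>T. Done t S) \<and> |S| \<le>o |T <+> L|"
proof -
  define r where "r = |T|"
  have wo: "Well_order r" and co: "Card_order r" and Fr: "Field r = T"
    by (simp_all add: r_def card_of_Well_order card_of_Card_order)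
  have wor: "wo_rel r" using wo by (simp add: wo_rel_def)
  have wf: "wf (r - Id)" using wo by (simp add: well_order_on_def)
  have tr: "trans r" using wor by (simp add: wo_rel.TRANS)
  define nxt where "nxt t S = (SOME S'. S \<subseteq> S' \<and> Good S' \<and> Done t S' \<and> |S'| \<le>o |S <+> L| )" for t S
  \<comment> \<open>\<open>S0\<close> is included so that the first stage has a good set to start
    from.\<close>
  define F where "F = (\<lambda>st t. nxt t (S0 \<union> (\<Union>u\<in>underS r t. st u)))"
  define st where "st = wfrec (r - Id) F"
  have under: "u \<in> underS r t \<longleftrightarrow> (u, t) \<in> r - Id" for u t by (auto simp: underS_def)
  have "adm_wf (r - Id) F"
    unfolding adm_wf_def F_def using under by (metis (no_types, lifting) SUP_cong)
  then have st: "st t = nxt t (S0 \<union> (\<Union>u\<in>underS r t. st u))" for t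
    unfolding st_def by (subst wfrec_fixpoint[OF wf]) (simp_all add: F_def)
  define Pr where "Pr t = S0 \<union> (\<Union>u\<in>underS r t. st u)" for t
  have inf: "infinite (X <+> L)" for X :: "'z set" using L by (simp add: finite_Plus_iff)
  have fold_chain: "Good (S0 \<union> (\<Union>u\<in>A. st u))"
    if "A \<subseteq> T" and ok: "\<And>u. u \<in> A \<Longrightarrow> Good (st u) \<and> Pr u \<subseteq> st u" for A
  proof -
    have cmp: "st u \<subseteq> st u' \<or> st u' \<subseteq> st u" if "u \<in> A" "u' \<in> A" for u u'
    proof -
      have "u = u' \<or> u \<in> underS r u' \<or> u' \<in> underS r u"
        using wo_rel.TOTALS[OF wor] that \<open>A \<subseteq> T\<close> unfolding Fr under by blast
      then show ?thesis using ok[OF that(1)] ok[OF that(2)] unfolding Pr_def by blast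
    qed
    have "Good (\<Union>(insert S0 (st ` A)))"
    proof (rule chain)
      fix X Y assume "X \<in> insert S0 (st ` A)" "Y \<in> insert S0 (st ` A)"
      then show "X \<subseteq> Y \<or> Y \<subseteq> X" using cmp ok unfolding Pr_def by blast
    qed (use ok S0 in auto)
    then show ?thesis by simp
  qed
  have bound: "|S0 \<union> (\<Union>u\<in>A. st u)| \<le>o |A <+> L|"
    if ok: "\<And>u. u \<in> A \<Longrightarrow> |st u| \<le>o |A <+> L|" for A
  proof (rule card_of_Un_ordLeq[OF inf])
    show "|S0| \<le>o |A <+> L|" using S0(2) card_of_Plus2 ordLeq_transitive by blast
    show "|\<Union>u\<in>A. st u| \<le>o |A <+> L|"
      using ok by (intro card_of_UNION_ordLeq_infinite[OF inf card_of_Plus1]) simp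
  qed
  have main: "t \<in> T \<longrightarrow> Pr t \<subseteq> st t \<and> Good (st t) \<and> Done t (st t) \<and> |st t| \<le>o |underS r t <+> L|" for t
  proof (induction t rule: wf_induct_rule[OF wf])
    case (1 t)
    show ?case
    proof
      assume t: "t \<in> T"
      have sub: "underS r t \<subseteq> T" using Fr by (metis underS_Field subsetI)
      have ih: "Pr u \<subseteq> st u \<and> Good (st u) \<and> Done u (st u) \<and> |st u| \<le>o |underS r u <+> L|"
        if "u \<in> underS r t" for u
        using 1 that sub under by blast
      have G: "Good (Pr t)" unfolding Pr_def using fold_chain[OF sub] ih by blast
      have "|Pr t| \<le>o |underS r t <+> L|" unfolding Pr_def
      proof (rule bound)
        fix u assume u: "u \<in> underS r t"
        then have "underS r u \<subseteq> underS r t"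
          using tr wo_rel.ANTISYM[OF wor] unfolding underS_def trans_def antisym_def by blast
        then have "|underS r u <+> L| \<le>o |underS r t <+> L|"
          by (intro card_of_Plus_mono1 card_of_mono1)
        then show "|st u| \<le>o |underS r t <+> L|" using ih[OF u] ordLeq_transitive by blast
      qed
      note b = this
      have "|Pr t| \<le>o |L| \<or> |Pr t| <o |T|"
      \<comment> \<open>Either the summand L dominates, or the initial segment does, which is
        smaller than T because \<open>r\<close> is a cardinal order.\<close>
      proof (cases "|underS r t| \<le>o |L|")
        case True
        then have "|underS r t <+> L| =o |L|" using L by (simp add: card_of_Plus_infinite)
        then show ?thesis using b ordLeq_ordIso_trans by blast
      next
        case False
        then have "|L| \<le>o |underS r t|" using ordLeq_total[OF card_of_Well_order card_of_Well_order] by blast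
        moreover then have "infinite (underS r t)" using L card_of_ordLeq_finite by blast
        ultimately have "|underS r t <+> L| =o |underS r t|" by (simp add: card_of_Plus_infinite)
        moreover have "|underS r t| <o |T|" using card_of_underS[OF co] t Fr r_def by simp
        ultimately show ?thesis using b ordLeq_ordIso_trans ordLeq_ordLess_trans by blast
      qed
      then have "\<exists>S'. Pr t \<subseteq> S' \<and> Good S' \<and> Done t S' \<and> |S'| \<le>o |Pr t <+> L|"
        using step[OF t G] unfolding Pr_def by blast
      then have *: "Pr t \<subseteq> st t \<and> Good (st t) \<and> Done t (st t) \<and> |st t| \<le>o |Pr t <+> L|"
        unfolding st[of t] Pr_def[symmetric] nxt_def by (rule someI_ex)
      have "|Pr t <+> L| \<le>o |underS r t <+> L|"
        using card_of_Plus_ordLeq_infinite[OF inf b card_of_Plus2] .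
      then show "Pr t \<subseteq> st t \<and> Good (st t) \<and> Done t (st t) \<and> |st t| \<le>o |underS r t <+> L|"
        using * ordLeq_transitive by blast
    qed
  qed
  define S where "S = S0 \<union> (\<Union>u\<in>T. st u)"
  have "Good S" unfolding S_def using fold_chain[of T] main by blast
  moreover have "\<forall>t\<in>T. Done t S" 
    using mono \<open>Good S\<close> main unfolding S_def by (meson UN_upper le_supI2)
  moreover have "|S| \<le>o |T <+> L|" unfolding S_def
  proof (rule bound)
    fix u assume "u \<in> T"
    have "|underS r u <+> L| \<le>o |T <+> L|"
      using Fr by (intro card_of_Plus_mono1 card_of_mono1) (metis underS_Field subsetI)
    then show "|st u| \<le>o |T <+> L|" using main \<open>u \<in> T\<close> ordLeq_transitive by blast
  qed
  moreover have "S0 \<subseteq> S" by (simp add: S_def)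
  ultimately show ?thesis by (intro exI[of _ S] conjI)
qed

text \<open>An index codes three functions \<open>s\<close>, \<open>tr\<close> and \<open>q\<close> on \<open>'b\<close>, and \<open>h t\<close> looks up the trace of \<open>t\<close>
  on the sequence \<open>s\<close> in the table with keys \<open>tr\<close> and values \<open>q\<close>. If \<open>s\<close> separates the members of
  a small family, their traces are distinct and can be given arbitrary values.\<close>

lemma independent_family:
  assumes "infinite (UNIV :: 'b set)"
  shows "\<exists>h :: 'b set set \<Rightarrow> 'b set \<Rightarrow> 'b.
    \<forall>J c. |J| \<le>o |UNIV :: 'b set| \<longrightarrow> (\<exists>\<xi>. \<forall>t\<in>J. h t \<xi> = c t)"
proof -
  have "|UNIV :: ('b \<times> 'b) set| =o |UNIV :: 'b set|"
    using card_of_Times_same_infinite[OF assms] by simp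
  then obtain p :: "'b \<times> 'b \<Rightarrow> 'b" where p: "bij p"
    using card_of_ordIso by blast
  have injp: "p x = p y \<longleftrightarrow> x = y" for x y using p by (simp add: bij_is_inj inj_eq)
  \<comment> \<open>Three tags, since one subset of \<open>'b\<close> has to store three binary
    relations.\<close>
  obtain b0 b1 b2 :: 'b where b: "b0 \<noteq> b1" "b0 \<noteq> b2" "b1 \<noteq> b2"
  proof -
    obtain B :: "'b set" where "finite B" "card B = 3"
      using infinite_arbitrarily_large[OF assms] by blast
    then show ?thesis using that by (auto simp: card_3_iff)
  qed
  define dec :: "'b set \<Rightarrow> 'b \<Rightarrow> 'b \<Rightarrow> 'b set" where "dec \<xi> k x = {y. p (k, p (x, y)) \<in> \<xi>}" for \<xi> k x
  define s where "s \<xi> = dec \<xi> b0" for \<xi>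
  define tr where "tr \<xi> = dec \<xi> b1" for \<xi>
  define q where "q \<xi> x = (THE y. y \<in> dec \<xi> b2 x)" for \<xi> x
  define h where "h t \<xi> = q \<xi> (SOME y. tr \<xi> y = {x. s \<xi> x \<in> t})" for t \<xi>
  have code: "\<exists>\<xi>. s \<xi> = f \<and> tr \<xi> = g \<and> q \<xi> = v" for f g v
  proof -
    let ?\<xi> = "{p (b0, p (x, y)) | x y. y \<in> f x} \<union> {p (b1, p (x, y)) | x y. y \<in> g x} \<union> {p (b2, p (x, v x)) | x. True}"
    have "dec ?\<xi> b0 x = f x" "dec ?\<xi> b1 x = g x" "dec ?\<xi> b2 x = {v x}" for x
      using b by (simp_all add: dec_def injp)
    then have "s ?\<xi> = f" "tr ?\<xi> = g" "q ?\<xi> = v"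
      by (simp_all add: s_def tr_def q_def fun_eq_iff)
    then show ?thesis by (intro exI[of _ ?\<xi>] conjI)
  qed
  have "\<exists>\<xi>. \<forall>t\<in>J. h t \<xi> = c t" if J: "|J| \<le>o |UNIV :: 'b set|" for J c
  proof (cases "J = {}")
    case False
    then obtain e :: "'b \<Rightarrow> 'b set set" where e: "range e = J"
      using iffD2[OF card_of_ordLeq2[OF False] J] by blast
    \<comment> \<open>The entry at the code of a pair (x, y) lies in exactly one of
      \<open>e x\<close> and \<open>e y\<close> if these differ. Indexing by pairs lets one sequence
      of length kappa separate all members of J.\<close>
    define f where "f = (\<lambda>z. case inv_into UNIV p z of (x, y) \<Rightarrow> (SOME w. w \<in> e x \<longleftrightarrow> w \<notin> e y))"
    obtain \<xi> where \<xi>: "s \<xi> = f" "tr \<xi> = (\<lambda>y. {x. f x \<in> e y})" "q \<xi> = (\<lambda>y. c (e y))"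
      using code by blast
    have sep: "e y = e y'" if "{x. f x \<in> e y} = {x. f x \<in> e y'}" for y y'
    proof (rule ccontr)
      assume "e y \<noteq> e y'"
      then have "\<exists>w. w \<in> e y \<longleftrightarrow> w \<notin> e y'" by blast
      then have "f (p (y, y')) \<in> e y \<longleftrightarrow> f (p (y, y')) \<notin> e y'"
        using someI_ex[of "\<lambda>w. w \<in> e y \<longleftrightarrow> w \<notin> e y'"] p by (simp add: f_def bij_is_inj)
      then show False using that by blast
    qed
    have "h (e y) \<xi> = c (e y)" for y
    proof -
      \<comment> \<open>The lookup may return another key z than y, but z then has the same trace,
        and \<open>sep\<close> gives \<open>e z = e y\<close>.\<close>
      have "(SOME z. tr \<xi> z = {x. s \<xi> x \<in> e y}) = (SOME z. {x. f x \<in> e z} = {x. f x \<in> e y})"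
        by (simp add: \<xi>)
      moreover have "{x. f x \<in> e (SOME z. {x. f x \<in> e z} = {x. f x \<in> e y})} = {x. f x \<in> e y}"
        by (rule someI) (rule refl)
      ultimately show ?thesis unfolding h_def using sep \<xi>(3) by metis
    qed
    then show ?thesis using e by blast
  qed simp
  then show ?thesis by blast
qed

section \<open>Independent coordinates over a filter base\<close>

text \<open>The elements of \<open>'j\<close> serve as coordinates: an index \<xi> gives the
  coordinate t the value \<open>h t \<xi>\<close>. The number of values is also the number of
  coordinates that can be controlled at once.\<close>

locale independent =
  fixes h :: "'j \<Rightarrow> 'i \<Rightarrow> 'b"
  assumes infinite_values: "infinite (UNIV :: 'b set)"
    and independent: "|J| \<le>o |UNIV :: 'b set| \<Longrightarrow> \<exists>\<xi>. \<forall>t\<in>J. h t \<xi> = c t"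
begin

text \<open>A partial assignment of values to coordinates, given by its graph so that unions combine
  assignments. The size bound is the one under which independence applies.\<close>

definition cond :: "('j \<times> 'b) set \<Rightarrow> bool" where
  "cond C \<longleftrightarrow> single_valued C \<and> |C| \<le>o |UNIV :: 'b set|"

definition cube :: "('j \<times> 'b) set \<Rightarrow> 'i set" where
  "cube C = {\<xi>. \<forall>t y. (t, y) \<in> C \<longrightarrow> h t \<xi> = y}"

text \<open>The set \<open>E\<close> generates a filter, and \<open>N\<close> contains the coordinates that are used up.\<close>

definition consistent :: "'i set set \<Rightarrow> 'j set \<Rightarrow> bool" where
  "consistent E N \<longleftrightarrow> (\<forall>E0 C. finite E0 \<and> E0 \<subseteq> E \<and> cond C \<and> Domain C \<inter> N = {} \<longrightarrow> \<Inter>E0 \<inter> cube C \<noteq> {})"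

lemma cube_antimono: "C \<subseteq> C' \<Longrightarrow> cube C' \<subseteq> cube C"
  unfolding cube_def by blast

lemma cube_Un: "cube (C \<union> C') = cube C \<inter> cube C'"
  unfolding cube_def by blast

lemma cube_Union: "cube (\<Union>S) = \<Inter>(cube ` S)"
  unfolding cube_def by blast

lemma cube_nonempty:
  assumes "cond C"
  shows "cube C \<noteq> {}"
proof -
  have "|Domain C| \<le>o |C|" unfolding Domain_fst by (rule card_of_image)
  then have "|Domain C| \<le>o |UNIV :: 'b set|"
    using assms ordLeq_transitive unfolding cond_def by blast
  from independent[OF this, of "\<lambda>t. THE y. (t, y) \<in> C"] obtain \<xi> where \<xi>: "\<forall>t\<in>Domain C. h t \<xi> = (THE y. (t, y) \<in> C)"
    by blast
  have "h t \<xi> = y" if "(t, y) \<in> C" for t y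
  proof -
    have "(THE y. (t, y) \<in> C) = y"
      using assms that unfolding cond_def single_valued_def by blast
    then show ?thesis using \<xi> that by (metis DomainI)
  qed
  then show ?thesis unfolding cube_def by blast
qed

lemma cond_Un:
  assumes "cond C" "cond C'" "single_valued (C \<union> C')"
  shows "cond (C \<union> C')"
  using assms card_of_Un_ordLeq[OF infinite_values] unfolding cond_def by blast

lemma single_valued_Union_chain:
  assumes "\<And>X Y. X \<in> \<C> \<Longrightarrow> Y \<in> \<C> \<Longrightarrow> X \<subseteq> Y \<or> Y \<subseteq> X"
    and "\<And>X. X \<in> \<C> \<Longrightarrow> single_valued (X \<union> P)" and "\<C> \<noteq> {}"
  shows "single_valued (\<Union>\<C> \<union> P)"
proof (rule single_valuedI)
  fix t y z assume "(t, y) \<in> \<Union>\<C> \<union> P" "(t, z) \<in> \<Union>\<C> \<union> P"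
  then obtain X Y where "X \<in> \<C>" "Y \<in> \<C>" "(t, y) \<in> X \<union> P" "(t, z) \<in> Y \<union> P"
    using assms(3) by blast
  then have "(t, y) \<in> X \<union> P \<and> (t, z) \<in> X \<union> P \<or> (t, y) \<in> Y \<union> P \<and> (t, z) \<in> Y \<union> P"
    using assms(1)[of X Y] by blast
  then show "y = z"
    using assms(2) \<open>X \<in> \<C>\<close> \<open>Y \<in> \<C>\<close> unfolding single_valued_def by blast
qed

text \<open>With C imposed, no further condition C' can bar a fresh coordinate f from agreeing with
  g on X. The relation P collects the conditions imposed elsewhere; it may have more than kappa
  entries, so C' is only required to be compatible with P and not to contain it.\<close>

definition forces_agreement ::
  "'j set \<Rightarrow> ('j \<times> 'b) set \<Rightarrow> 'i set \<Rightarrow> ('i \<Rightarrow> 'b) \<Rightarrow> ('j \<times> 'b) set \<Rightarrow> bool" where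
  "forces_agreement N P X g C \<longleftrightarrow> (\<forall>C' f. C \<subseteq> C' \<and> cond C' \<and> single_valued (C' \<union> P) \<and>
     Domain C' \<inter> N = {} \<and> f \<notin> Domain C' \<union> Domain P \<union> N \<longrightarrow> X \<inter> cube C' \<inter> {\<xi>. h f \<xi> = g \<xi>} \<noteq> {})"

lemma forces_agreementD:
  assumes "forces_agreement N P X g C" "C \<subseteq> C'" "cond C'" "single_valued (C' \<union> P)"
    "Domain C' \<inter> N = {}" "f \<notin> Domain C' \<union> Domain P \<union> N"
  shows "X \<inter> cube C' \<inter> {\<xi>. h f \<xi> = g \<xi>} \<noteq> {}"
  using assms unfolding forces_agreement_def by simp

text \<open>A larger P leaves fewer C' and fewer fresh f to test.\<close>

lemma forces_agreement_mono:
  assumes "forces_agreement N P X g C" "P \<subseteq> P'"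
  shows "forces_agreement N P' X g C"
  unfolding forces_agreement_def
proof (intro allI impI, elim conjE)
  fix C' f
  assume C': "C \<subseteq> C'" "cond C'" "single_valued (C' \<union> P')" "Domain C' \<inter> N = {}"
    "f \<notin> Domain C' \<union> Domain P' \<union> N"
  have "single_valued (C' \<union> P)"
    by (rule single_valued_subset[OF _ C'(3)]) (use assms(2) in blast)
  moreover have "f \<notin> Domain C' \<union> Domain P \<union> N"
    using C'(5) Domain_mono[OF assms(2)] by blast
  ultimately show "X \<inter> cube C' \<inter> {\<xi>. h f \<xi> = g \<xi>} \<noteq> {}"
    using forces_agreementD[OF assms(1) C'(1,2) _ C'(4)] by simp
qed

text \<open>If no such \<open>C\<close> existed, one could successively choose, for every value \<open>y\<close>, a
  coordinate \<open>f\<close> with value \<open>y\<close> that is barred from agreeing with \<open>g\<close>. At a point in the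
  resulting cube, \<open>g\<close> would have no value.\<close>

lemma decide_agreement:
  assumes X: "\<And>C. cond C \<Longrightarrow> Domain C \<inter> N = {} \<Longrightarrow> X \<inter> cube C \<noteq> {}"
    and P: "single_valued P"
  shows "\<exists>C. cond C \<and> single_valued (C \<union> P) \<and> Domain C \<inter> N = {} \<and> forces_agreement N P X g C"
proof (rule ccontr)
  let ?L = "UNIV :: 'b set"
  assume contra: "\<not> ?thesis"
  have non: "\<exists>C' f. C \<subseteq> C' \<and> cond C' \<and> single_valued (C' \<union> P) \<and> Domain C' \<inter> N = {} \<and>
       f \<notin> Domain C' \<union> Domain P \<union> N \<and> X \<inter> cube C' \<inter> {\<xi>. h f \<xi> = g \<xi>} = {}"
    if "cond C" "single_valued (C \<union> P)" "Domain C \<inter> N = {}" for C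
  proof -
    have "\<not> forces_agreement N P X g C" using contra that by blast
    then show ?thesis unfolding forces_agreement_def not_all not_imp conj_assoc not_not .
  qed
  \<comment> \<open>The tasks are the values y. There are as many of them as a condition may have
    entries, so the set that serves all of them is still a condition.\<close>
  have "\<exists>S. {} \<subseteq> S \<and> (single_valued (S \<union> P) \<and> Domain S \<inter> N = {}) \<and>
    (\<forall>y\<in>?L. \<exists>f. (f, y) \<in> S \<and> X \<inter> cube S \<inter> {\<xi>. h f \<xi> = g \<xi>} = {}) \<and> |S| \<le>o |?L <+> ?L|"
  proof (rule transfinite_tasks[OF infinite_values])
    show "single_valued ({} \<union> P) \<and> Domain {} \<inter> N = {}" using P by simp
    show "|{} :: ('j \<times> 'b) set| \<le>o |?L|" by (rule card_of_empty)
  next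
    fix \<C> :: "('j \<times> 'b) set set"
    assume "\<C> \<noteq> {}" "\<And>X Y. X \<in> \<C> \<Longrightarrow> Y \<in> \<C> \<Longrightarrow> X \<subseteq> Y \<or> Y \<subseteq> X"
      "\<And>X. X \<in> \<C> \<Longrightarrow> single_valued (X \<union> P) \<and> Domain X \<inter> N = {}"
    then show "single_valued (\<Union>\<C> \<union> P) \<and> Domain (\<Union>\<C>) \<inter> N = {}"
      using single_valued_Union_chain[of \<C> P] by blast
  next
    fix y S S'
    assume "\<exists>f. (f, y) \<in> S \<and> X \<inter> cube S \<inter> {\<xi>. h f \<xi> = g \<xi>} = {}" "S \<subseteq> S'"
    then show "\<exists>f. (f, y) \<in> S' \<and> X \<inter> cube S' \<inter> {\<xi>. h f \<xi> = g \<xi>} = {}"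
      using cube_antimono[of S S'] by blast
  next
    fix y S
    assume S: "single_valued (S \<union> P) \<and> Domain S \<inter> N = {}" "|S| \<le>o |?L| \<or> |S| <o |?L|"
    then have card: "|S| \<le>o |?L|" using ordLess_imp_ordLeq by blast
    have cS: "cond S" unfolding cond_def using card S(1) single_valued_subset[of S "S \<union> P"] by simp
    then obtain C' f where C': "S \<subseteq> C'" "cond C'" "single_valued (C' \<union> P)" "Domain C' \<inter> N = {}"
      "f \<notin> Domain C' \<union> Domain P \<union> N" "X \<inter> cube C' \<inter> {\<xi>. h f \<xi> = g \<xi>} = {}"
      using non[OF cS conjunct1[OF S(1)] conjunct2[OF S(1)]] by (elim exE conjE)
    let ?S = "insert (f, y) C'"
    have "single_valued (?S \<union> P)"
      using C'(3,5) unfolding single_valued_def by blast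
    moreover have "Domain ?S \<inter> N = {}" using C'(4,5) by auto
    moreover have "X \<inter> cube ?S \<inter> {\<xi>. h f \<xi> = g \<xi>} = {}"
      using C'(6) cube_antimono[of C' ?S] by blast
    moreover have "|?S| \<le>o |S <+> ?L|"
    proof -
      have "|{(f, y)} \<union> C'| \<le>o |?L|"
        using C'(2) infinite_values card_of_singl_ordLeq[of ?L]
        by (intro card_of_Un_ordLeq) (auto simp: cond_def)
      then show ?thesis using card_of_Plus2 ordLeq_transitive by (metis insert_is_Un)
    qed
    ultimately show "\<exists>S'. S \<subseteq> S' \<and> (single_valued (S' \<union> P) \<and> Domain S' \<inter> N = {}) \<and>
      (\<exists>f. (f, y) \<in> S' \<and> X \<inter> cube S' \<inter> {\<xi>. h f \<xi> = g \<xi>} = {}) \<and> |S'| \<le>o |S <+> ?L|"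
      using C'(1) by (intro exI[of _ ?S]) blast
  qed
  then obtain S where S: "single_valued (S \<union> P)" "Domain S \<inter> N = {}"
    "\<And>y. \<exists>f. (f, y) \<in> S \<and> X \<inter> cube S \<inter> {\<xi>. h f \<xi> = g \<xi>} = {}" "|S| \<le>o |?L <+> ?L|"
    by blast
  have "|?L <+> ?L| =o |?L|"
    by (rule card_of_Plus_infinite1[OF infinite_values card_of_mono1[OF subset_refl]])
  then have "cond S"
    unfolding cond_def using S(1,4) single_valued_subset[of S "S \<union> P"] ordLeq_ordIso_trans by blast
  then obtain \<xi> where \<xi>: "\<xi> \<in> X" "\<xi> \<in> cube S" using X S(2) by blast
  obtain f where f: "(f, g \<xi>) \<in> S" "X \<inter> cube S \<inter> {\<xi>. h f \<xi> = g \<xi>} = {}" using S(3) by blast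
  then have "h f \<xi> = g \<xi>" using \<xi>(2) unfolding cube_def by blast
  then show False using f(2) \<xi> by blast
qed

text \<open>For each g in G and each finite intersection X from E, a condition as in
  \<open>decide_agreement\<close> is chosen, and its cube is added to the filter base. Afterwards a
  coordinate outside N' can be made to agree with any one g in G, whatever finite part of the filter
  base and whatever condition avoiding N' and this coordinate are given. There are at most |V| pairs
  of X and g, and each uses up at most kappa coordinates.\<close>

lemma consistent_agreement:
  assumes con: "consistent E N" and V: "infinite V" "|UNIV :: 'b set| \<le>o |V|"
    and E: "|E| \<le>o |V|" and N: "|N| \<le>o |V|" and G: "|G| \<le>o |V|"
  shows "\<exists>E' N'. E \<subseteq> E' \<and> N \<subseteq> N' \<and> |E'| \<le>o |V| \<and> |N'| \<le>o |V| \<and>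
    (\<forall>g\<in>G. \<forall>E0 C f. finite E0 \<longrightarrow> E0 \<subseteq> E' \<longrightarrow> cond C \<longrightarrow> Domain C \<inter> N' = {} \<longrightarrow> f \<notin> N' \<union> Domain C \<longrightarrow>
       \<Inter>E0 \<inter> cube C \<inter> {\<xi>. h f \<xi> = g \<xi>} \<noteq> {})"
proof -
  define T where "T = Inter ` Fpow E \<times> G"
  have "|Fpow E| \<le>o |V|"
    using card_of_Fpow_mono[OF E] card_of_Fpow_infinite[OF V(1)] ordLeq_ordIso_trans by blast
  then have T: "|T| \<le>o |V|"
    unfolding T_def using card_of_image ordLeq_transitive V(1) G
    by (intro card_of_Times_ordLeq_infinite) blast+
  \<comment> \<open>The chosen conditions have to be jointly single-valued, as their cubes are going
    to be intersected.\<close>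
  define good where "good S \<longleftrightarrow> (\<forall>C\<in>S. cond C) \<and> single_valued (\<Union>S) \<and> Domain (\<Union>S) \<inter> N = {}" for S
  define done' where "done' = (\<lambda>(X, g) S. \<exists>C\<in>S. forces_agreement N (\<Union>S) X g C)"
  have "\<exists>S. {} \<subseteq> S \<and> good S \<and> (\<forall>t\<in>T. done' t S) \<and> |S| \<le>o |T <+> V|"
  proof (rule transfinite_tasks[OF V(1)])
    show "good {}" by (simp add: good_def)
    show "|{} :: ('j \<times> 'b) set set| \<le>o |V|" by (rule card_of_empty)
  next
    fix \<C> :: "('j \<times> 'b) set set set"
    assume *: "\<C> \<noteq> {}" "\<And>X Y. X \<in> \<C> \<Longrightarrow> Y \<in> \<C> \<Longrightarrow> X \<subseteq> Y \<or> Y \<subseteq> X" "\<And>X. X \<in> \<C> \<Longrightarrow> good X"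
    have "single_valued (\<Union>(Union ` \<C>) \<union> {})"
    proof (rule single_valued_Union_chain)
      fix X Y assume "X \<in> Union ` \<C>" "Y \<in> Union ` \<C>"
      then show "X \<subseteq> Y \<or> Y \<subseteq> X" using *(2) by (metis (no_types, lifting) Union_mono imageE)
    qed (use * in \<open>auto simp: good_def\<close>)
    moreover have "\<Union>(Union ` \<C>) = \<Union>(\<Union>\<C>)" by blast
    ultimately show "good (\<Union>\<C>)"
      using *(3) unfolding good_def by (simp add: disjoint_iff) blast
  next
    fix t S S'
    assume *: "done' t S" "S \<subseteq> S'" "good S'"
    obtain X g where t: "t = (X, g)" by fastforce
    have "\<Union>S \<subseteq> \<Union>S'" using *(2) by blast
    then show "done' t S'"
      using *(1,2) forces_agreement_mono unfolding done'_def t prod.case by blast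
  next
    fix t S assume t: "t \<in> T" and S: "good S"
    obtain E0 g where E0: "t = (\<Inter>E0, g)" "finite E0" "E0 \<subseteq> E" "g \<in> G"
      using t unfolding T_def Fpow_def by blast
    have "\<exists>C. cond C \<and> single_valued (C \<union> \<Union>S) \<and> Domain C \<inter> N = {} \<and> forces_agreement N (\<Union>S) (\<Inter>E0) g C"
      using con E0 S unfolding consistent_def good_def by (intro decide_agreement) blast+
    then obtain C where C: "cond C" "single_valued (C \<union> \<Union>S)" "Domain C \<inter> N = {}"
      and stop: "forces_agreement N (\<Union>S) (\<Inter>E0) g C"
      by blast
    have "good (insert C S)" using S C unfolding good_def by (simp add: Domain_Un_eq Int_Un_distrib2)
    moreover have "done' t (insert C S)"
      using forces_agreement_mono[OF stop, of "\<Union>(insert C S)"] unfolding done'_def E0(1) by auto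
    moreover have "|insert C S| \<le>o |S <+> V|"
    proof -
      have "|{C} \<union> S| \<le>o |S <+> V|"
        using V(1) by (intro card_of_Un_ordLeq card_of_Plus1 card_of_singl_ordLeq) auto
      then show ?thesis by simp
    qed
    ultimately show "\<exists>S'. S \<subseteq> S' \<and> good S' \<and> done' t S' \<and> |S'| \<le>o |S <+> V|"
      by (intro exI[of _ "insert C S"]) blast
  qed
  then obtain S where S: "good S" "\<And>t. t \<in> T \<Longrightarrow> done' t S" "|S| \<le>o |T <+> V|" by blast
  have "|T <+> V| \<le>o |V|"
    by (rule card_of_Plus_ordLeq_infinite[OF V(1) T card_of_mono1[OF subset_refl]])
  then have cS: "|S| \<le>o |V|" using S(3) ordLeq_transitive by blast
  define E' where "E' = E \<union> cube ` S"
  define N' where "N' = N \<union> Domain (\<Union>S)"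
  have "|E'| \<le>o |V|"
    unfolding E'_def using V(1) E cS card_of_image ordLeq_transitive by (intro card_of_Un_ordLeq) blast+
  moreover have "|N'| \<le>o |V|"
  proof -
    have "|\<Union>C\<in>S. C| \<le>o |V|"
      using S(1) V(2) ordLeq_transitive unfolding good_def cond_def
      by (intro card_of_UNION_ordLeq_infinite[OF V(1) cS]) blast
    moreover have "|Domain (\<Union>S)| \<le>o |\<Union>S|" unfolding Domain_fst by (rule card_of_image)
    ultimately have "|Domain (\<Union>S)| \<le>o |V|" using ordLeq_transitive by auto
    then show ?thesis unfolding N'_def using V(1) N by (intro card_of_Un_ordLeq)
  qed
  moreover have "\<Inter>E0 \<inter> cube C \<inter> {\<xi>. h f \<xi> = g \<xi>} \<noteq> {}"
    if as: "g \<in> G" "finite E0" "E0 \<subseteq> E'" "cond C" "Domain C \<inter> N' = {}" "f \<notin> N' \<union> Domain C" for g E0 C f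
  proof -
    \<comment> \<open>A finite part of E' consists of members of E and of finitely many cubes. The
      former give the set X of a task, the latter turn into the condition
      \<open>\<Union>S1\<close>.\<close>
    let ?E1 = "E0 \<inter> E"
    obtain S1 where S1: "finite S1" "S1 \<subseteq> S" "E0 - E = cube ` S1"
      using as(2,3) finite_subset_image[of "E0 - E" cube S] unfolding E'_def by blast
    have "done' (\<Inter>?E1, g) S" using as(1,2) by (intro S(2)) (auto simp: T_def Fpow_def)
    then obtain C0 where C0: "C0 \<in> S" and stop: "forces_agreement N (\<Union>S) (\<Inter>?E1) g C0"
      unfolding done'_def by blast
    \<comment> \<open>Only finitely many conditions are joined, so the size bound of
      \<open>cond\<close> survives. C fits because its domain avoids N', which contains the domains
      of all conditions in S.\<close>
    let ?C = "\<Union>(insert C0 S1) \<union> C"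
    have sub: "\<Union>(insert C0 S1) \<subseteq> \<Union>S" using C0 S1(2) by blast
    have sv: "single_valued (\<Union>S \<union> C)"
      using S(1) as(4,5) unfolding good_def cond_def N'_def single_valued_def by blast
    have "cond (\<Union>(insert C0 S1))"
    proof -
      have "|\<Union>X\<in>insert C0 S1. X| \<le>o |UNIV :: 'b set|"
      proof (rule card_of_UNION_ordLeq_infinite[OF infinite_values])
        show "|insert C0 S1| \<le>o |UNIV :: 'b set|"
          using S1(1) infinite_values by (simp add: ordLess_imp_ordLeq finite_ordLess_infinite2)
      qed (use C0 S1(2) S(1) in \<open>auto simp: good_def cond_def\<close>)
      then show ?thesis unfolding cond_def
        using single_valued_subset[OF sub] S(1) by (simp add: good_def)
    qed
    then have "cond ?C"
      by (rule cond_Un[OF _ as(4)]) (rule single_valued_subset[OF _ sv], use sub in blast)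
    have "\<Inter>?E1 \<inter> cube ?C \<inter> {\<xi>. h f \<xi> = g \<xi>} \<noteq> {}"
    proof (rule forces_agreementD[OF stop])
      show "cond ?C" by fact
      show "single_valued (?C \<union> \<Union>S)"
        by (rule single_valued_subset[OF _ sv]) (use sub in blast)
      show "Domain ?C \<inter> N = {}" using Domain_mono[OF sub] S(1) as(5)
        unfolding good_def N'_def by blast
      show "f \<notin> Domain ?C \<union> Domain (\<Union>S) \<union> N" using Domain_mono[OF sub] as(6)
        unfolding N'_def by blast
    qed blast
    moreover have "\<Inter>?E1 \<inter> cube ?C \<subseteq> \<Inter>E0 \<inter> cube C"
    proof -
      have "cube ?C \<subseteq> \<Inter>(E0 - E)" unfolding cube_Un cube_Union S1(3) by blast
      then show ?thesis unfolding cube_Un by blast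
    qed
    ultimately show ?thesis by blast
  qed
  ultimately show ?thesis
    by (intro exI[of _ E'] exI[of _ N']) (auto simp: E'_def N'_def)
qed

end

section \<open>Back-and-forth inside a power\<close>

lemma ultrafilter_extension:
  assumes fip: "\<And>E0. finite E0 \<Longrightarrow> E0 \<subseteq> E \<Longrightarrow> \<Inter>E0 \<noteq> {}"
  shows "\<exists>U :: 'i set set. ultrafilter_on UNIV U \<and> E \<subseteq> U"
proof -
  define \<F> where "\<F> = {S. E \<subseteq> S \<and> (\<forall>E0. finite E0 \<and> E0 \<subseteq> S \<longrightarrow> \<Inter>E0 \<noteq> {})}"
  have "\<exists>U\<in>\<F>. \<forall>X\<in>\<F>. U \<subseteq> X \<longrightarrow> X = U"
  proof (rule subset_Zorn_nonempty)
    show "\<F> \<noteq> {}" using fip unfolding \<F>_def by blast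
  next
    fix \<C> assume C: "\<C> \<noteq> {}" "subset.chain \<F> \<C>"
    have "\<Inter>E0 \<noteq> {}" if E0: "finite E0" "E0 \<subseteq> \<Union>\<C>" for E0
    proof -
      obtain X where "X \<in> \<C>" "E0 \<subseteq> X" using finite_subset_Union_chain[OF E0 C] by blast
      then show ?thesis using C(2) E0(1) unfolding subset.chain_def \<F>_def by blast
    qed
    moreover have "E \<subseteq> \<Union>\<C>" using C unfolding subset.chain_def \<F>_def by blast
    ultimately show "\<Union>\<C> \<in> \<F>" unfolding \<F>_def by blast
  qed
  then obtain U where UF: "U \<in> \<F>" and max: "\<And>X. X \<in> \<F> \<Longrightarrow> U \<subseteq> X \<Longrightarrow> X = U" by blast
  have U: "E \<subseteq> U" "\<And>E0. finite E0 \<Longrightarrow> E0 \<subseteq> U \<Longrightarrow> \<Inter>E0 \<noteq> {}" using UF unfolding \<F>_def by blast+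
  \<comment> \<open>Maximality in the form used below: whatever meets all finite intersections of U
    belongs to U.\<close>
  have mem: "A \<in> U" if A: "\<And>E0. finite E0 \<Longrightarrow> E0 \<subseteq> U \<Longrightarrow> \<Inter>E0 \<inter> A \<noteq> {}" for A
  proof -
    have "\<Inter>E0 \<noteq> {}" if E0: "finite E0" "E0 \<subseteq> insert A U" for E0
    proof -
      have "\<Inter>(E0 - {A}) \<inter> A \<noteq> {}" using E0 by (intro A) auto
      moreover have "\<Inter>(E0 - {A}) \<inter> A \<subseteq> \<Inter>E0" by blast
      ultimately show ?thesis by blast
    qed
    then have "insert A U \<in> \<F>" using U(1) unfolding \<F>_def by blast
    then have "insert A U = U" by (rule max) blast
    then show ?thesis by blast
  qed
  have up: "B \<in> U" if "finite S" "S \<subseteq> U" "\<Inter>S \<subseteq> B" for S B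
  proof (rule mem)
    fix E0 assume "finite E0" "E0 \<subseteq> U"
    then have "\<Inter>(E0 \<union> S) \<noteq> {}" using that by (intro U(2)) auto
    then show "\<Inter>E0 \<inter> B \<noteq> {}" using that(3) by blast
  qed
  have "A \<in> U \<or> - A \<in> U" for A
  proof (rule ccontr)
    assume "\<not> ?thesis"
    then obtain E0 E1 where "finite E0" "E0 \<subseteq> U" "\<Inter>E0 \<inter> A = {}"
      "finite E1" "E1 \<subseteq> U" "\<Inter>E1 \<inter> - A = {}"
      using mem[of A] mem[of "- A"] by blast
    then have "\<Inter>(E0 \<union> E1) = {}" "finite (E0 \<union> E1)" "E0 \<union> E1 \<subseteq> U" by blast+
    then show False using U(2) by blast
  qed
  moreover have "UNIV \<in> U" using up[of "{}"] by simp
  moreover have "{} \<notin> U" using U(2)[of "{{}}"] by auto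
  moreover have "A \<inter> B \<in> U" if "A \<in> U" "B \<in> U" for A B using up[of "{A, B}"] that by simp
  moreover have "B \<in> U" if "A \<in> U" "A \<subseteq> B" for A B using up[of "{A}"] that by simp
  ultimately have "ultrafilter_on UNIV U"
    unfolding ultrafilter_on_def Compl_eq_Diff_UNIV[symmetric] by (intro conjI ballI allI impI) auto
  then show ?thesis using U(1) by blast
qed

text \<open>Formulas enter only as the predicates on assignments that they define:
  \<open>\<Q>\<close> is a countable set of finitely supported predicates closed under the
  first-order operations. The map \<open>val\<close> turns the values of coordinates into elements
  of M.\<close>

locale back_and_forth = independent h
  for h :: "'j \<Rightarrow> 'i \<Rightarrow> 'b" +
  fixes M :: "'m set" and val :: "'b \<Rightarrow> 'm" and \<Q> :: "((nat \<Rightarrow> 'm) \<Rightarrow> bool) set"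
  assumes card_b: "|UNIV :: 'b set| \<le>o |UNIV :: 'i set|"
    and card_i: "|UNIV :: 'i set| <o |UNIV :: 'j set|"
    and card_funs: "|{f :: 'i \<Rightarrow> 'm. range f \<subseteq> M}| \<le>o |UNIV :: 'j set|"
    and range_val: "range val = M"
    and countable_preds: "countable \<Q>"
    and preds_support: "Q \<in> \<Q> \<Longrightarrow> \<exists>n. \<forall>v w. (\<forall>k<n. v k = w k) \<longrightarrow> Q v = Q w"
    and preds_eq: "(\<lambda>v. v 0 = v 1) \<in> \<Q>"
    and preds_neg: "Q \<in> \<Q> \<Longrightarrow> (\<lambda>v. \<not> Q v) \<in> \<Q>"
    and preds_conj: "Q \<in> \<Q> \<Longrightarrow> Q' \<in> \<Q> \<Longrightarrow> (\<lambda>v. Q v \<and> Q' v) \<in> \<Q>"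
    and preds_ex: "Q \<in> \<Q> \<Longrightarrow> (\<lambda>v. \<exists>a\<in>M. Q (v(k := a))) \<in> \<Q>"
    and preds_rename: "Q \<in> \<Q> \<Longrightarrow> (\<lambda>v. Q (v \<circ> \<rho>)) \<in> \<Q>"
begin

abbreviation funs :: "('i \<Rightarrow> 'm) set" where
  "funs \<equiv> {f. range f \<subseteq> M}"

definition supported :: "nat \<Rightarrow> ((nat \<Rightarrow> 'm) \<Rightarrow> bool) \<Rightarrow> bool" where
  "supported n Q \<longleftrightarrow> (\<forall>v w. (\<forall>k<n. v k = w k) \<longrightarrow> Q v = Q w)"

lemma supportedD: "supported n Q \<Longrightarrow> (\<And>k. k < n \<Longrightarrow> v k = w k) \<Longrightarrow> Q v = Q w"
  unfolding supported_def by blast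

definition agreement :: "((nat \<Rightarrow> 'm) \<Rightarrow> bool) \<Rightarrow> (nat \<Rightarrow> ('i \<Rightarrow> 'm) \<times> ('i \<Rightarrow> 'm)) \<Rightarrow> 'i set" where
  "agreement Q v = {\<xi>. Q (\<lambda>k. fst (v k) \<xi>) \<longleftrightarrow> Q (\<lambda>k. snd (v k) \<xi>)}"

text \<open>The sets that the filter must contain for H to preserve all of \<open>\<Q>\<close>.
  Assignments are total, so there are none for empty H, not even for closed formulas; hence H is
  kept nonempty below.\<close>

definition agreements :: "(('i \<Rightarrow> 'm) \<times> ('i \<Rightarrow> 'm)) set \<Rightarrow> 'i set set" where
  "agreements H = {agreement Q v | Q v. Q \<in> \<Q> \<and> range v \<subseteq> H}"

lemma agreement_cong:
  assumes "supported n Q" "\<And>k. k < n \<Longrightarrow> v k = w k"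
  shows "agreement Q v = agreement Q w"
proof -
  have "Q (\<lambda>k. fst (v k) \<xi>) = Q (\<lambda>k. fst (w k) \<xi>)" "Q (\<lambda>k. snd (v k) \<xi>) = Q (\<lambda>k. snd (w k) \<xi>)" for \<xi>
    by (rule supportedD[OF assms(1)], simp add: assms(2))+
  then show ?thesis unfolding agreement_def by simp
qed

lemma agreements_converse_subset: "agreements (H\<inverse>) \<subseteq> agreements H"
proof
  fix X assume "X \<in> agreements (H\<inverse>)"
  then obtain Q v where Q: "Q \<in> \<Q>" and "range v \<subseteq> H\<inverse>" and X: "X = agreement Q v"
    unfolding agreements_def by blast
  from this(2) have v: "v k \<in> H\<inverse>" for k by (rule range_subsetD)
  have "X = agreement Q (prod.swap \<circ> v)" unfolding X agreement_def by auto
  moreover have "prod.swap (v k) \<in> H" for k using v[of k] by (cases "v k") simp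
  then have "range (prod.swap \<circ> v) \<subseteq> H" by auto
  ultimately show "X \<in> agreements H" unfolding agreements_def using Q by blast
qed

text \<open>Agreement is a biconditional and thus symmetric in the two components. This reduces the
  back step to the forth step.\<close>

lemma agreements_converse: "agreements (H\<inverse>) = agreements H"
  using agreements_converse_subset[of H] agreements_converse_subset[of "H\<inverse>"] by simp

text \<open>A condition on the truth pattern of finitely many predicates is a Boolean combination of
  them; the induction splits on the truth value of one predicate.\<close>

lemma preds_bool:
  assumes "finite W" "\<And>w. w \<in> W \<Longrightarrow> q w \<in> \<Q>"
  shows "(\<lambda>v. {w \<in> W. q w v} \<in> \<T>) \<in> \<Q>"
  using assms
proof (induction W arbitrary: \<T> rule: finite_induct)
  case empty
  \<comment> \<open>The constants True and False, expressed through the equality predicate.\<close>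
  have "(\<lambda>v. \<not> ((v 0 = v 1) \<and> \<not> (v 0 = v 1))) \<in> \<Q>" "(\<lambda>v. ((v 0 = v 1) \<and> \<not> (v 0 = v 1))) \<in> \<Q>"
    by (intro preds_neg preds_conj preds_eq)+
  then have "(\<lambda>v. True) \<in> \<Q>" "(\<lambda>v. False) \<in> \<Q>" by simp_all
  then show ?case by (cases "{} \<in> \<T>") simp_all
next
  case (insert w W)
  let ?T1 = "{T. insert w T \<in> \<T>}"
  have qw: "q w \<in> \<Q>" by (rule insert.prems) simp
  have i1: "(\<lambda>v. {x \<in> W. q x v} \<in> ?T1) \<in> \<Q>" by (rule insert.IH) (simp add: insert.prems)
  have i0: "(\<lambda>v. {x \<in> W. q x v} \<in> \<T>) \<in> \<Q>" by (rule insert.IH) (simp add: insert.prems)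
  have "(\<lambda>v. \<not> (\<not> (q w v \<and> {x \<in> W. q x v} \<in> ?T1) \<and> \<not> (\<not> q w v \<and> {x \<in> W. q x v} \<in> \<T>))) \<in> \<Q>"
    by (intro preds_neg preds_conj qw i0 i1)
  moreover have "(\<not> (\<not> (q w v \<and> {x \<in> W. q x v} \<in> ?T1) \<and> \<not> (\<not> q w v \<and> {x \<in> W. q x v} \<in> \<T>))) \<longleftrightarrow>
      {x \<in> insert w W. q x v} \<in> \<T>" for v
  proof -
    have "{x \<in> insert w W. q x v} = (if q w v then insert w {x \<in> W. q x v} else {x \<in> W. q x v})"
      by auto
    then show ?thesis by simp
  qed
  ultimately show ?case by simp
qed

text \<open>By finite support, an agreement set is determined by a predicate and a finite list of
  pairs.\<close>

lemma card_agreements: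
  assumes V: "infinite V" and H: "|H| \<le>o |V|"
  shows "|agreements H| \<le>o |V|"
proof -
  have "agreements H \<subseteq> (\<lambda>(Q, xs). agreement Q (nth xs)) ` (\<Q> \<times> lists H)"
  proof
    fix X assume "X \<in> agreements H"
    then obtain Q v where Q: "Q \<in> \<Q>" "range v \<subseteq> H" "X = agreement Q v"
      unfolding agreements_def by blast
    obtain n where n: "supported n Q" using preds_support[OF Q(1)] unfolding supported_def by blast
    have "X = agreement Q (nth (map v [0..<n]))"
      unfolding Q(3) by (rule agreement_cong[OF n]) simp
    moreover have "map v [0..<n] \<in> lists H" using range_subsetD[OF Q(2)] by (simp add: in_lists_conv_set image_subset_iff)
    ultimately show "X \<in> (\<lambda>(Q, xs). agreement Q (nth xs)) ` (\<Q> \<times> lists H)" using Q(1) by force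
  qed
  moreover have "|\<Q> \<times> lists H| \<le>o |V|"
  proof (rule card_of_Times_ordLeq_infinite[OF V])
    have "|\<Q>| \<le>o |UNIV :: nat set|" using countable_preds
      unfolding countable_def card_of_ordLeq[symmetric] by blast
    then show "|\<Q>| \<le>o |V|" using V infinite_iff_card_of_nat ordLeq_transitive by blast
    show "|lists H| \<le>o |V|"
      using card_of_lists_mono[OF H] card_of_lists_infinite[OF V] ordLeq_ordIso_trans by blast
  qed
  ultimately show ?thesis by (meson card_of_image card_of_mono1 ordLeq_transitive)
qed

text \<open>Assignments of elements of \<open>H\<close> to variables, where \<open>None\<close> stands for one new pair.\<close>

definition assign ::
  "(('i \<Rightarrow> 'm) \<times> ('i \<Rightarrow> 'm) \<Rightarrow> 'i \<Rightarrow> 'm) \<Rightarrow> 'm \<Rightarrow> (('i \<Rightarrow> 'm) \<times> ('i \<Rightarrow> 'm)) option list \<Rightarrow> 'i \<Rightarrow> nat \<Rightarrow> 'm" where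
  "assign pr a us \<xi> k = (case us ! k of None \<Rightarrow> a | Some p \<Rightarrow> pr p \<xi>)"

text \<open>These describe the agreement sets that can arise from a new pair. Finite lists in place
  of total assignments keep their number small, and the support condition makes the unspecified
  entries beyond the end of a list harmless.\<close>

definition constraints ::
  "(('i \<Rightarrow> 'm) \<times> ('i \<Rightarrow> 'm)) set \<Rightarrow> (((nat \<Rightarrow> 'm) \<Rightarrow> bool) \<times> (('i \<Rightarrow> 'm) \<times> ('i \<Rightarrow> 'm)) option list) set" where
  "constraints H = {(Q, us). Q \<in> \<Q> \<and> us \<in> lists (insert None (Some ` H)) \<and> supported (length us) Q}"

definition solves where
  "solves f \<xi> m = (\<lambda>(Q, us). Q (assign fst (f \<xi>) us \<xi>) \<longleftrightarrow> Q (assign snd m us \<xi>))"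

text \<open>The result is a code in \<open>'b\<close> and not an element of M, because the value of
  a coordinate is going to be compared with it.\<close>

definition solution where
  "solution f W \<xi> = (SOME y. \<forall>x\<in>W. solves f \<xi> (val y) x)"

text \<open>The truth pattern \<open>T\<close> of the finitely many constraints at an index is witnessed by the first
  components. The predicate \<open>\<Psi> T\<close>, which says that some element realizes \<open>T\<close>, belongs to
  \<open>\<Q>\<close>, hence it carries over to the second components on a set of the filter.\<close>

lemma solution_works:
  assumes W: "finite W" "W \<subseteq> constraints H" and H: "H \<noteq> {}" "agreements H \<subseteq> E" and f: "range f \<subseteq> M"
  shows "\<exists>E0. finite E0 \<and> E0 \<subseteq> E \<and> (\<forall>\<xi>\<in>\<Inter>E0. \<forall>x\<in>W. solves f \<xi> (val (solution f W \<xi>)) x)"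
proof -
  obtain p0 where p0: "p0 \<in> H" using H(1) by blast
  define Hs where "Hs = {p. \<exists>(Q, us)\<in>W. Some p \<in> set us}"
  have "Hs \<subseteq> (\<Union>(Q, us)\<in>W. the ` set us)" unfolding Hs_def by force
  moreover have "finite (\<Union>(Q, us)\<in>W. the ` set us)" using W(1) by auto
  ultimately have fin: "finite Hs" by (rule finite_subset)
  have HsH: "Hs \<subseteq> H"
  proof
    fix p assume "p \<in> Hs"
    then obtain Q us where "(Q, us) \<in> W" "Some p \<in> set us" unfolding Hs_def by blast
    then have "Some p \<in> insert None (Some ` H)" using W(2) unfolding constraints_def by blast
    then show "p \<in> H" by blast
  qed
  obtain e :: "nat \<Rightarrow> _" where e: "range e = insert p0 Hs"
    using range_from_nat_into[of "insert p0 Hs"] fin by (meson countable_finite finite_insert insert_not_empty)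
  define idx where "idx p = (SOME j. e j = p)" for p
  have idx: "e (idx p) = p" if "p \<in> Hs" for p
  proof -
    have "p \<in> range e" using that e by blast
    then have "\<exists>j. e j = p" by blast
    then show ?thesis unfolding idx_def by (rule someI_ex)
  qed
  \<comment> \<open>Variable 0 is reserved for the new element, and \<open>p0\<close> is a mere
    placeholder there; the old pairs occupy the variables from 1 on.\<close>
  define v where "v = case_nat p0 e"
  have v: "range v \<subseteq> H"
  proof -
    have "range e \<subseteq> H" using e p0 HsH by simp
    then have "e j \<in> H" for j by (rule range_subsetD)
    then show ?thesis using p0 unfolding v_def by (auto split: nat.splits)
  qed
  \<comment> \<open>Each constraint has its own numbering of variables; \<open>\<rho>\<close>
    translates it into the common one, so that a single element can be asked to meet all constraints
    together.\<close>
  define \<rho> where "\<rho> us k = (case us ! k of None \<Rightarrow> 0 | Some p \<Rightarrow> Suc (idx p))"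
    for us :: "(('i \<Rightarrow> 'm) \<times> ('i \<Rightarrow> 'm)) option list" and k
  define q where "q = (\<lambda>(Q, us) (w :: nat \<Rightarrow> 'm). Q (w \<circ> \<rho> us) :: bool)"
  have q: "q x \<in> \<Q>" if "x \<in> W" for x
    using that W(2) preds_rename unfolding q_def constraints_def by auto
  have q_eval: "q (Q, us) ((\<lambda>k. pr (v k) \<xi>)(0 := a)) \<longleftrightarrow> Q (assign pr a us \<xi>)" if "(Q, us) \<in> W" for pr Q us \<xi> a
  proof -
    have sup: "supported (length us) Q" using that W(2) unfolding constraints_def by blast
    have eq: "((\<lambda>k. pr (v k) \<xi>)(0 := a)) (\<rho> us k) = assign pr a us \<xi> k" if k: "k < length us" for k
    proof (cases "us ! k")
      case (Some p)
      then have "p \<in> Hs" unfolding Hs_def using k \<open>(Q, us) \<in> W\<close> nth_mem by force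
      then show ?thesis using Some idx by (simp add: \<rho>_def assign_def v_def)
    qed (simp add: \<rho>_def assign_def)
    show ?thesis unfolding q_def prod.case comp_def by (rule supportedD[OF sup eq])
  qed
  define \<Psi> where "\<Psi> T = (\<lambda>w. \<exists>a\<in>M. {x \<in> W. q x (w(0 := a))} \<in> {T})" for T
  have \<Psi>: "\<Psi> T \<in> \<Q>" for T
    unfolding \<Psi>_def
    by (rule preds_ex[of "\<lambda>w. {x \<in> W. q x w} \<in> {T}" 0]) (rule preds_bool[OF W(1) q])
  \<comment> \<open>The pattern to be realized varies with the index, so the agreement sets of all
    patterns on W are taken; these are finitely many.\<close>
  define E0 where "E0 = (\<lambda>T. agreement (\<Psi> T) v) ` Pow W"
  have "finite E0" using W(1) by (simp add: E0_def)
  moreover have "E0 \<subseteq> E"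
  proof -
    have "agreement (\<Psi> T) v \<in> agreements H" for T
      using \<Psi>[of T] v unfolding agreements_def by blast
    then show ?thesis using H(2) unfolding E0_def by blast
  qed
  moreover have "\<forall>x\<in>W. solves f \<xi> (val (solution f W \<xi>)) x" if \<xi>: "\<xi> \<in> \<Inter>E0" for \<xi>
  proof -
    define T where "T = {x \<in> W. q x ((\<lambda>k. fst (v k) \<xi>)(0 := f \<xi>))}"
    have "\<Psi> T (\<lambda>k. fst (v k) \<xi>)" unfolding \<Psi>_def T_def using f by blast
    moreover have "\<xi> \<in> agreement (\<Psi> T) v" using \<xi> unfolding E0_def T_def by blast
    ultimately have "\<Psi> T (\<lambda>k. snd (v k) \<xi>)" unfolding agreement_def by blast
    then obtain a where a: "a \<in> M" "{x \<in> W. q x ((\<lambda>k. snd (v k) \<xi>)(0 := a))} = T" unfolding \<Psi>_def by blast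
    obtain y where y: "a = val y" using a(1) range_val by blast
    have "solves f \<xi> (val y) x" if "x \<in> W" for x
    proof -
      obtain Q us where x: "x = (Q, us)" by fastforce
      have "q x ((\<lambda>k. snd (v k) \<xi>)(0 := a)) \<longleftrightarrow> q x ((\<lambda>k. fst (v k) \<xi>)(0 := f \<xi>))"
        using a(2) that unfolding T_def by blast
      then show ?thesis using q_eval[of Q us] that unfolding x solves_def y by simp
    qed
    then have "\<exists>y. \<forall>x\<in>W. solves f \<xi> (val y) x" by (intro exI[of _ y] ballI)
    then show ?thesis unfolding solution_def by (rule someI_ex)
  qed
  ultimately show ?thesis by (intro exI[of _ E0] conjI ballI) simp_all
qed

text \<open>Entries equal to the new pair become \<open>None\<close>, so each agreement set of the
  larger correspondence says that \<open>g\<close> solves one constraint.\<close>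

lemma agreements_insert:
  assumes "X \<in> agreements (insert (f, g) H)"
  shows "\<exists>x\<in>constraints H. X = {\<xi>. solves f \<xi> (g \<xi>) x}"
proof -
  obtain Q v where Q: "Q \<in> \<Q>" "range v \<subseteq> insert (f, g) H" "X = agreement Q v"
    using assms unfolding agreements_def by blast
  obtain n where n: "supported n Q" using preds_support[OF Q(1)] unfolding supported_def by blast
  define us where "us = map (\<lambda>k. if v k = (f, g) then None else Some (v k)) [0..<n]"
  have "Q (\<lambda>k. fst (v k) \<xi>) = Q (assign fst (f \<xi>) us \<xi>)" "Q (\<lambda>k. snd (v k) \<xi>) = Q (assign snd (g \<xi>) us \<xi>)" for \<xi>
    by (rule supportedD[OF n], simp add: assign_def us_def)+
  then have "X = {\<xi>. solves f \<xi> (g \<xi>) (Q, us)}"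
    unfolding Q(3) agreement_def solves_def by simp
  moreover have "(Q, us) \<in> constraints H"
    using Q(1) range_subsetD[OF Q(2)] n unfolding constraints_def us_def by fastforce
  ultimately show ?thesis by blast
qed

text \<open>The partner of f is read off a coordinate t beyond those used up. Finitely many new
  agreement sets amount to a finite set W of constraints, which \<open>solution f W\<close> solves
  on some finite intersection from E. It remains to let \<open>h t\<close> agree with
  \<open>solution f W\<close>, and \<open>consistent_agreement\<close> has been applied to all
  functions of this form.\<close>

lemma extend_forth:
  assumes con: "consistent E N" and H: "agreements H \<subseteq> E" "H \<noteq> {}" "H \<subseteq> funs \<times> funs" and f: "f \<in> funs"
    and V: "infinite V" "|UNIV :: 'b set| \<le>o |V|" "|V| <o |UNIV :: 'j set|"
    and card: "|E| \<le>o |V|" "|N| \<le>o |V|" "|H| \<le>o |V|"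
  shows "\<exists>E' N' g. E \<subseteq> E' \<and> N \<subseteq> N' \<and> |E'| \<le>o |V| \<and> |N'| \<le>o |V| \<and> consistent E' N' \<and>
    agreements (insert (f, g) H) \<subseteq> E' \<and> g \<in> funs"
proof -
  define G where "G = solution f ` Fpow (constraints H)"

  have "|G| \<le>o |V|"
  proof -
    have "|insert None (Some ` H)| \<le>o |V|"
      by (rule card_of_insert_ordLeq[OF V(1) ordLeq_transitive[OF card_of_image card(3)]])
    then have 1: "|lists (insert None (Some ` H))| \<le>o |V|"
      using card_of_lists_mono card_of_lists_infinite[OF V(1)] ordLeq_ordIso_trans by blast
    have "|\<Q>| \<le>o |UNIV :: nat set|" using countable_preds
      unfolding countable_def card_of_ordLeq[symmetric] by blast
    then have "|\<Q>| \<le>o |V|" using V(1) infinite_iff_card_of_nat ordLeq_transitive by blast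
    then have 2: "|\<Q> \<times> lists (insert None (Some ` H))| \<le>o |V|"
      using 1 by (intro card_of_Times_ordLeq_infinite[OF V(1)])
    have "constraints H \<subseteq> \<Q> \<times> lists (insert None (Some ` H))"
      unfolding constraints_def by blast
    then have "|constraints H| \<le>o |V|" using 2 card_of_mono1 ordLeq_transitive by blast
    then have "|Fpow (constraints H)| \<le>o |V|"
      using card_of_Fpow_mono card_of_Fpow_infinite[OF V(1)] ordLeq_ordIso_trans by blast
    then show ?thesis unfolding G_def using card_of_image ordLeq_transitive by blast
  qed
  from consistent_agreement[OF con V(1,2) card(1,2) this]
  obtain E1 N1 where 1: "E \<subseteq> E1" "N \<subseteq> N1" "|E1| \<le>o |V|" "|N1| \<le>o |V|"
    and agr: "\<forall>g\<in>G. \<forall>E0 C f. finite E0 \<longrightarrow> E0 \<subseteq> E1 \<longrightarrow> cond C \<longrightarrow> Domain C \<inter> N1 = {} \<longrightarrow> f \<notin> N1 \<union> Domain C \<longrightarrow>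
       \<Inter>E0 \<inter> cube C \<inter> {\<xi>. h f \<xi> = g \<xi>} \<noteq> {}"
    by (elim exE conjE)
  \<comment> \<open>A fresh coordinate exists because at most |V| coordinates, fewer than there are
    in all, have been used up.\<close>
  have "N1 \<noteq> UNIV" using 1(4) V(3) not_ordLess_ordLeq by blast
  then obtain t where t: "t \<notin> N1" by blast
  define g where "g = val \<circ> h t"
  define E' where "E' = E1 \<union> agreements (insert (f, g) H)"
  have "|insert (f, g) H| \<le>o |V|" by (rule card_of_insert_ordLeq[OF V(1) card(3)])
  then have "|E'| \<le>o |V|"
    unfolding E'_def using 1(3) card_agreements[OF V(1)] by (intro card_of_Un_ordLeq[OF V(1)])
  moreover have "|insert t N1| \<le>o |V|" by (rule card_of_insert_ordLeq[OF V(1) 1(4)])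
  \<comment> \<open>With t counted as used, conditions cannot fix its value any more, so it is free
    to agree with \<open>solution f W\<close> for whatever W arises.\<close>
  moreover have "consistent E' (insert t N1)"
    unfolding consistent_def
  proof (intro allI impI, elim conjE)
    fix E0 C assume *: "finite E0" "E0 \<subseteq> E'" "cond C" "Domain C \<inter> insert t N1 = {}"
    let ?s = "\<lambda>x. {\<xi>. solves f \<xi> (g \<xi>) x}"
    have sub: "E0 - E1 \<subseteq> ?s ` constraints H"
    proof
      fix X assume "X \<in> E0 - E1"
      then have "X \<in> agreements (insert (f, g) H)" using *(2) unfolding E'_def by blast
      then show "X \<in> ?s ` constraints H" using agreements_insert by blast
    qed
    obtain W where W: "W \<subseteq> constraints H" "finite W" "E0 - E1 = ?s ` W"
      using finite_subset_image[OF finite_Diff[OF *(1)] sub] by (elim exE conjE)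
    have "range f \<subseteq> M" using f by simp
    from solution_works[OF W(2,1) H(2,1) this] obtain E2 where E2: "finite E2" "E2 \<subseteq> E" "\<forall>\<xi>\<in>\<Inter>E2. \<forall>x\<in>W. solves f \<xi> (val (solution f W \<xi>)) x"
      by (elim exE conjE)
    have G: "solution f W \<in> G" using W(1,2) unfolding G_def Fpow_def by blast
    have fin: "finite (E0 \<inter> E1 \<union> E2)" "E0 \<inter> E1 \<union> E2 \<subseteq> E1" using *(1) E2(1,2) 1(1) by auto
    have dis: "Domain C \<inter> N1 = {}" "t \<notin> N1 \<union> Domain C" using t *(4) by blast+
    have "\<Inter>(E0 \<inter> E1 \<union> E2) \<inter> cube C \<inter> {\<xi>. h t \<xi> = solution f W \<xi>} \<noteq> {}"
      using agr[rule_format, OF G fin *(3) dis] .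
    then obtain \<xi> where \<xi>: "\<xi> \<in> \<Inter>(E0 \<inter> E1)" "\<xi> \<in> \<Inter>E2" "\<xi> \<in> cube C" "h t \<xi> = solution f W \<xi>" by blast
    have "\<xi> \<in> \<Inter>(E0 - E1)" using E2(3) \<xi>(2,4) unfolding W(3) g_def by auto
    then show "\<Inter>E0 \<inter> cube C \<noteq> {}" using \<xi> by blast
  qed
  moreover have "g \<in> funs" using range_val unfolding g_def by auto
  moreover have "E \<subseteq> E'" "N \<subseteq> insert t N1" "agreements (insert (f, g) H) \<subseteq> E'" using 1 unfolding E'_def by blast+
  ultimately show ?thesis by (intro exI[of _ E'] exI[of _ "insert t N1"] exI[of _ g] conjI)
qed

lemma extend_back:
  assumes con: "consistent E N" and H: "agreements H \<subseteq> E" "H \<noteq> {}" "H \<subseteq> funs \<times> funs" and f: "f \<in> funs"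
    and V: "infinite V" "|UNIV :: 'b set| \<le>o |V|" "|V| <o |UNIV :: 'j set|"
    and card: "|E| \<le>o |V|" "|N| \<le>o |V|" "|H| \<le>o |V|"
  shows "\<exists>E' N' g. E \<subseteq> E' \<and> N \<subseteq> N' \<and> |E'| \<le>o |V| \<and> |N'| \<le>o |V| \<and> consistent E' N' \<and>
    agreements (insert (g, f) H) \<subseteq> E' \<and> g \<in> funs"
proof -
  have "H\<inverse> = prod.swap ` H" by force
  then have cH: "|H\<inverse>| \<le>o |V|" using ordLeq_transitive[OF card_of_image card(3), of prod.swap] by simp
  have "\<exists>E' N' g. E \<subseteq> E' \<and> N \<subseteq> N' \<and> |E'| \<le>o |V| \<and> |N'| \<le>o |V| \<and> consistent E' N' \<and>
    agreements (insert (f, g) (H\<inverse>)) \<subseteq> E' \<and> g \<in> funs"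
  proof (rule extend_forth[OF con _ _ _ f])
    show "H\<inverse> \<subseteq> funs \<times> funs" using H(3) by blast
    show "H\<inverse> \<noteq> {}" using H(2) converse_converse[of H] by (metis converse_empty)
    show "agreements (H\<inverse>) \<subseteq> E" using H(1) agreements_converse by simp
  qed (fact V card(1,2) cH)+
  moreover have "agreements (insert (f, g) (H\<inverse>)) = agreements (insert (g, f) H)" for g
  proof -
    have "(insert (g, f) H)\<inverse> = insert (f, g) (H\<inverse>)" by auto
    then show ?thesis using agreements_converse[of "insert (g, f) H"] by simp
  qed
  ultimately show ?thesis by simp
qed

section \<open>The transfinite back-and-forth and its starting pairs\<close>

lemma infinite_i: "infinite (UNIV :: 'i set)"
  using card_b infinite_values card_of_ordLeq_infinite by blast

text \<open>Every function from I to M is a task, treated by one forth step and one back step. The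
  filter base, the used coordinates and the correspondence are coded as a single set of a sum type,
  to which \<open>transfinite_tasks\<close> applies.\<close>

lemma total_correspondence:
  assumes con: "consistent E0 N0" and agr: "agreements H0 \<subseteq> E0" and H0: "H0 \<noteq> {}" "H0 \<subseteq> funs \<times> funs"
    and card: "|E0| \<le>o |UNIV :: 'i set|" "|N0| \<le>o |UNIV :: 'i set|" "|H0| \<le>o |UNIV :: 'i set|"
  shows "\<exists>E N H. E0 \<subseteq> E \<and> H0 \<subseteq> H \<and> consistent E N \<and> agreements H \<subseteq> E \<and> H \<subseteq> funs \<times> funs \<and>
    (\<forall>f\<in>funs. (\<exists>g. (f, g) \<in> H) \<and> (\<exists>g. (g, f) \<in> H))"
proof -
  let ?L = "UNIV :: 'i set"
  define eE where "eE S = Inl -` S" for S :: "('i set + 'j + ('i \<Rightarrow> 'm) \<times> ('i \<Rightarrow> 'm)) set"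
  define eN where "eN S = (Inr \<circ> Inl) -` S" for S :: "('i set + 'j + ('i \<Rightarrow> 'm) \<times> ('i \<Rightarrow> 'm)) set"
  define eH where "eH S = (Inr \<circ> Inr) -` S" for S :: "('i set + 'j + ('i \<Rightarrow> 'm) \<times> ('i \<Rightarrow> 'm)) set"
  define join where "join E N H = E <+> (N <+> H)"
    for E :: "'i set set" and N :: "'j set" and H :: "(('i \<Rightarrow> 'm) \<times> ('i \<Rightarrow> 'm)) set"
  have e_join [simp]: "eE (join E N H) = E" "eN (join E N H) = N" "eH (join E N H) = H" for E N H
    by (auto simp: join_def eE_def eN_def eH_def)
  have sub_join: "S \<subseteq> join E N H" if "eE S \<subseteq> E" "eN S \<subseteq> N" "eH S \<subseteq> H" for S E N H
  proof
    fix x assume x: "x \<in> S"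
    show "x \<in> join E N H"
    proof (cases x)
      case (Inl a)
      then show ?thesis using x that(1) by (auto simp: join_def eE_def)
    next
      case (Inr b)
      then show ?thesis using x that(2,3) by (cases b) (auto simp: join_def eN_def eH_def)
    qed
  qed
  have e_card: "|eE S| \<le>o |S|" "|eN S| \<le>o |S|" "|eH S| \<le>o |S|" for S
    unfolding eE_def eN_def eH_def by (intro card_of_vimage_inj inj_compose inj_Inl inj_Inr)+
  have e_mono: "eE S \<subseteq> eE S'" "eN S \<subseteq> eN S'" "eH S \<subseteq> eH S'" if "S \<subseteq> S'" for S S'
    using that by (auto simp: eE_def eN_def eH_def)
  define good where "good S \<longleftrightarrow> consistent (eE S) (eN S) \<and> agreements (eH S) \<subseteq> eE S \<and> eH S \<subseteq> funs \<times> funs" for S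
  define treated where "treated f S \<longleftrightarrow> (\<exists>g. (f, g) \<in> eH S) \<and> (\<exists>g. (g, f) \<in> eH S)" for f S
  have "\<exists>S. join E0 N0 H0 \<subseteq> S \<and> good S \<and> (\<forall>f\<in>funs. treated f S) \<and> |S| \<le>o |funs <+> ?L|"
  proof (rule transfinite_tasks[OF infinite_i])
    show "good (join E0 N0 H0)" using con agr H0 by (simp add: good_def)
    show "|join E0 N0 H0| \<le>o |?L|"
      unfolding join_def using card by (intro card_of_Plus_ordLeq_infinite[OF infinite_i])
  next
    fix \<C> assume C: "\<C> \<noteq> {}" "\<And>X Y. X \<in> \<C> \<Longrightarrow> Y \<in> \<C> \<Longrightarrow> X \<subseteq> Y \<or> Y \<subseteq> X" "\<And>X. X \<in> \<C> \<Longrightarrow> good X"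
    have "consistent (eE (\<Union>\<C>)) (eN (\<Union>\<C>))"
      unfolding consistent_def
    proof (intro allI impI, elim conjE)
      fix E1 C assume *: "finite E1" "E1 \<subseteq> eE (\<Union>\<C>)" "cond C" "Domain C \<inter> eN (\<Union>\<C>) = {}"
      \<comment> \<open>Consistency concerns finite parts of the filter base, and such a part lies
        in one member X of the chain. A condition that avoids all used coordinates also avoids those
        of X.\<close>
      have "Inl ` E1 \<subseteq> \<Union>\<C>" using *(2) unfolding eE_def by blast
      then obtain X where X: "X \<in> \<C>" "Inl ` E1 \<subseteq> X"
        using finite_subset_Union_pairwise_chain[OF finite_imageI[OF *(1)] _ C(1,2)] by blast
      have "E1 \<subseteq> eE X" "Domain C \<inter> eN X = {}"
        using X *(4) unfolding eE_def eN_def by blast+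
      then show "\<Inter>E1 \<inter> cube C \<noteq> {}"
        using C(3)[OF X(1)] *(1,3) unfolding good_def consistent_def by blast
    qed
    moreover have "agreements (eH (\<Union>\<C>)) \<subseteq> eE (\<Union>\<C>)"
    proof
      fix Y assume "Y \<in> agreements (eH (\<Union>\<C>))"
      then obtain Q v where Q: "Q \<in> \<Q>" "range v \<subseteq> eH (\<Union>\<C>)" "Y = agreement Q v"
        unfolding agreements_def by blast
      obtain n where n: "supported n Q" using preds_support[OF Q(1)] unfolding supported_def by blast
      \<comment> \<open>Freezing the assignment beyond the support of \<open>Q\<close> leaves
        finitely many pairs in its range, and these lie in one member of the chain.\<close>
      define v' where "v' k = v (min k n)" for k
      have Y: "Y = agreement Q v'"
        unfolding Q(3) by (rule agreement_cong[OF n]) (simp add: v'_def)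
      have "(Inr \<circ> Inr) ` v ` {..n} \<subseteq> \<Union>\<C>"
        using range_subsetD[OF Q(2)] unfolding eH_def by auto
      then obtain X where X: "X \<in> \<C>" "(Inr \<circ> Inr) ` v ` {..n} \<subseteq> X"
        using finite_subset_Union_pairwise_chain[OF _ _ C(1,2)] by (metis finite_atMost finite_imageI)
      have "v' k \<in> eH X" for k
        using X(2) unfolding eH_def v'_def by (auto simp: image_subset_iff)
      then have "Y \<in> agreements (eH X)"
        unfolding agreements_def Y using Q(1) by blast
      then show "Y \<in> eE (\<Union>\<C>)"
        using C(3)[OF X(1)] e_mono(1)[of X "\<Union>\<C>"] X(1) unfolding good_def by blast
    qed
    moreover have "eH (\<Union>\<C>) \<subseteq> funs \<times> funs"
    proof
      fix p assume "p \<in> eH (\<Union>\<C>)"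
      then obtain X where "X \<in> \<C>" "p \<in> eH X" unfolding eH_def by blast
      then show "p \<in> funs \<times> funs" using C(3)[of X] unfolding good_def by blast
    qed
    ultimately show "good (\<Union>\<C>)" unfolding good_def by simp
  next
    fix f S S' assume "treated f S" "S \<subseteq> S'"
    then show "treated f S'" unfolding treated_def using e_mono(3)[of S S'] by blast
  next
    fix f S assume f: "f \<in> funs" and S: "good S" "join E0 N0 H0 \<subseteq> S" "|S| \<le>o |?L| \<or> |S| <o |funs|"
    \<comment> \<open>This bounds all data present before the step. It stays below the number of
      coordinates, as S is at most as large as I or smaller than the set of all tasks.\<close>
    let ?V = "S <+> ?L"
    have V: "infinite ?V" using infinite_i by simp
    have bV: "|UNIV :: 'b set| \<le>o |?V|" using card_b card_of_Plus2 ordLeq_transitive by blast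
    have infj: "infinite (UNIV :: 'j set)"
      using infinite_i card_i card_of_ordLeq_infinite ordLess_imp_ordLeq by blast
    have "|S| <o |UNIV :: 'j set|"
      using S(3) card_i card_funs ordLeq_ordLess_trans ordLess_ordLeq_trans by blast
    then have Vj: "|?V| <o |UNIV :: 'j set|"
      using card_i by (intro card_of_Plus_ordLess_infinite[OF infj])
    have cS: "|eE S| \<le>o |?V|" "|eN S| \<le>o |?V|" "|eH S| \<le>o |?V|"
      using e_card card_of_Plus1 ordLeq_transitive by blast+

    have H: "eH S \<noteq> {}" "agreements (eH S) \<subseteq> eE S" "eH S \<subseteq> funs \<times> funs" "consistent (eE S) (eN S)"
      using e_mono(3)[OF S(2)] H0(1) S(1) unfolding good_def by auto
    obtain E1 N1 g where 1: "eE S \<subseteq> E1" "eN S \<subseteq> N1" "|E1| \<le>o |?V|" "|N1| \<le>o |?V|" "consistent E1 N1"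
      "agreements (insert (f, g) (eH S)) \<subseteq> E1" "g \<in> funs"
      using extend_forth[OF H(4) H(2,1,3) f V bV Vj cS] by (elim exE conjE)
    have H1: "insert (f, g) (eH S) \<noteq> {}" "insert (f, g) (eH S) \<subseteq> funs \<times> funs"
      using H(3) f 1(7) by auto
    have cH1: "|insert (f, g) (eH S)| \<le>o |?V|"
      by (rule card_of_insert_ordLeq[OF V cS(3)])
    obtain E2 N2 g' where 2: "E1 \<subseteq> E2" "N1 \<subseteq> N2" "|E2| \<le>o |?V|" "|N2| \<le>o |?V|" "consistent E2 N2"
      "agreements (insert (g', f) (insert (f, g) (eH S))) \<subseteq> E2" "g' \<in> funs"
      using extend_back[OF 1(5,6) H1 f V bV Vj 1(3,4) cH1] by (elim exE conjE)
    let ?H = "insert (g', f) (insert (f, g) (eH S))"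
    have "|?H| \<le>o |?V|"
      by (rule card_of_insert_ordLeq[OF V cH1])
    then have "|join E2 N2 ?H| \<le>o |?V|"
      unfolding join_def using 2(3,4) by (intro card_of_Plus_ordLeq_infinite[OF V])
    moreover have "good (join E2 N2 ?H)"
      using 2 H1(2) f by (simp add: good_def)
    moreover have "treated f (join E2 N2 ?H)" unfolding treated_def by auto
    moreover have "S \<subseteq> join E2 N2 ?H"
      using 1(1,2) 2(1,2) by (intro sub_join) auto
    ultimately show "\<exists>S'. S \<subseteq> S' \<and> good S' \<and> treated f S' \<and> |S'| \<le>o |?V|"
      by (intro exI[of _ "join E2 N2 ?H"] conjI)
  qed
  then obtain S where S: "join E0 N0 H0 \<subseteq> S" "good S" "\<forall>f\<in>funs. treated f S" by (elim exE conjE)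
  have "E0 \<subseteq> eE S" "H0 \<subseteq> eH S" using e_mono[OF S(1)] by simp_all
  then show ?thesis using S(2,3) unfolding good_def treated_def
    by (intro exI[of _ "eE S"] exI[of _ "eN S"] exI[of _ "eH S"]) simp
qed

text \<open>If the predicates in W separated R from its complement, R would consist of all tuples
  with one of the truth patterns realized in R, and \<open>preds_bool\<close> would define it.
  Variables from n on are redirected to 0 so that every predicate describes an n-ary
  relation.\<close>

lemma indistinguishable_pair:
  assumes nondef: "\<And>Q. Q \<in> \<Q> \<Longrightarrow> R \<noteq> {xs \<in> nlists n M. Q (\<lambda>i. xs ! (if i < n then i else 0))}"
    and R: "R \<subseteq> nlists n M" and W: "finite W" "W \<subseteq> \<Q>" "\<And>q. q \<in> W \<Longrightarrow> supported n q"
  shows "\<exists>x\<in>R. \<exists>y\<in>nlists n M - R. \<forall>q\<in>W. q (nth x) \<longleftrightarrow> q (nth y)"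
proof (rule ccontr)
  assume contra: "\<not> ?thesis"
  define \<T> where "\<T> = {{q \<in> W. q (nth x)} | x. x \<in> R}"
  have "(\<lambda>v. {q \<in> W. q v} \<in> \<T>) \<in> \<Q>" using preds_bool[OF W(1), of "\<lambda>q. q"] W(2) by blast
  moreover have "R = {xs \<in> nlists n M. {q \<in> W. q (\<lambda>i. xs ! (if i < n then i else 0))} \<in> \<T>}"
  proof -
    have eq: "{q \<in> W. q (\<lambda>i. xs ! (if i < n then i else 0))} = {q \<in> W. q (nth xs)}" for xs
    proof -
      have "q (\<lambda>i. xs ! (if i < n then i else 0)) = q (nth xs)" if "q \<in> W" for q
        by (rule supportedD[OF W(3)[OF that]]) simp
      then show ?thesis by blast
    qed
    have "y \<in> R" if y: "y \<in> nlists n M" "{q \<in> W. q (nth y)} \<in> \<T>" for y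
    proof (rule ccontr)
      assume "y \<notin> R"
      obtain x where x: "x \<in> R" "{q \<in> W. q (nth y)} = {q \<in> W. q (nth x)}"
        using y(2) unfolding \<T>_def by blast
      then have "\<forall>q\<in>W. q (nth x) \<longleftrightarrow> q (nth y)" by blast
      then show False using contra x(1) y(1) \<open>y \<notin> R\<close> by blast
    qed
    then show ?thesis unfolding eq using R unfolding \<T>_def by blast
  qed
  ultimately show False using nondef by blast
qed

text \<open>The two tuples start as 2n independent coordinates, so any pair of n-tuples from M can
  be prescribed for them at some index. Finitely many of the initial requirements are met by a pair
  from \<open>indistinguishable_pair\<close>, which makes the start consistent.\<close>

lemma separating_correspondence:
  assumes nondef: "\<And>Q. Q \<in> \<Q> \<Longrightarrow> R \<noteq> {xs \<in> nlists n M. Q (\<lambda>i. xs ! (if i < n then i else 0))}"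
    and R: "R \<subseteq> nlists n M" and n: "n \<ge> 1"
  shows "\<exists>U H a b. ultrafilter_on UNIV U \<and> H \<subseteq> funs \<times> funs \<and>
    (\<forall>f\<in>funs. (\<exists>g. (f, g) \<in> H) \<and> (\<exists>g. (g, f) \<in> H)) \<and>
    (\<forall>Q\<in>\<Q>. \<forall>v. range v \<subseteq> H \<longrightarrow>
      ({\<xi>. Q (\<lambda>k. fst (v k) \<xi>)} \<in> U \<longleftrightarrow> {\<xi>. Q (\<lambda>k. snd (v k) \<xi>)} \<in> U)) \<and>
    (\<forall>i<n. (a i, b i) \<in> H) \<and>
    {\<xi>. map (\<lambda>i. a i \<xi>) [0..<n] \<in> R} \<in> U \<and> {\<xi>. map (\<lambda>i. b i \<xi>) [0..<n] \<notin> R} \<in> U"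
proof -
  let ?L = "UNIV :: 'i set"
  have "infinite (UNIV :: 'j set)"
    using infinite_i card_i card_of_ordLeq_infinite ordLess_imp_ordLeq by blast
  then obtain \<tau> :: "nat \<Rightarrow> 'j" where \<tau>: "inj \<tau>" using infinite_countable_subset by blast
  define a where "a i = val \<circ> h (\<tau> (2 * i))" for i
  define b where "b i = val \<circ> h (\<tau> (2 * i + 1))" for i
  have ab: "a i \<in> funs" "b i \<in> funs" for i using range_val unfolding a_def b_def by auto
  define H0 where "H0 = (\<lambda>i. (a i, b i)) ` {..<n}"
  define RA where "RA = {\<xi>. map (\<lambda>i. a i \<xi>) [0..<n] \<in> R}"
  define RB where "RB = {\<xi>. map (\<lambda>i. b i \<xi>) [0..<n] \<notin> R}"
  define E0 where "E0 = insert RA (insert RB (agreements H0))"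
  have finite_card: "|X| \<le>o |?L|" if "finite X" for X :: "'z set"
    using that infinite_i by (simp add: ordLess_imp_ordLeq finite_ordLess_infinite2)
  have cH: "|H0| \<le>o |?L|" by (rule finite_card) (simp add: H0_def)
  have cE: "|E0| \<le>o |?L|"
    unfolding E0_def by (intro card_of_insert_ordLeq infinite_i card_agreements cH)
  have "|range \<tau>| \<le>o |UNIV :: nat set|" by (rule card_of_image)
  then have cN: "|range \<tau>| \<le>o |?L|" using infinite_i infinite_iff_card_of_nat ordLeq_transitive by blast
  have con: "consistent E0 (range \<tau>)"
    unfolding consistent_def
  proof (intro allI impI, elim conjE)
    fix E1 C assume *: "finite E1" "E1 \<subseteq> E0" "cond C" "Domain C \<inter> range \<tau> = {}"
    let ?s = "\<lambda>q. {\<xi>. q (\<lambda>i. a i \<xi>) \<longleftrightarrow> q (\<lambda>i. b i \<xi>)}"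
    let ?A = "{q \<in> \<Q>. supported n q}"
    have sub: "E1 - {RA, RB} \<subseteq> ?s ` ?A"
    proof
      fix X assume "X \<in> E1 - {RA, RB}"
      then have "X \<in> agreements H0" using *(2) unfolding E0_def by blast
      then obtain Q v where Q: "Q \<in> \<Q>" "range v \<subseteq> H0" "X = agreement Q v" unfolding agreements_def by blast
      have "\<exists>i<n. v k = (a i, b i)" for k using range_subsetD[OF Q(2)] unfolding H0_def by auto
      \<comment> \<open>H0 contains only the n starting pairs, so each of its agreement sets comes
        from a predicate in the variables below n.\<close>
      then obtain \<rho> where \<rho>: "\<And>k. \<rho> k < n" "\<And>k. v k = (a (\<rho> k), b (\<rho> k))" by metis
      let ?q = "\<lambda>w. Q (w \<circ> \<rho>)"
      have "supported n ?q" unfolding supported_def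
      proof (intro allI impI)
        fix w w' :: "nat \<Rightarrow> 'm" assume "\<forall>k<n. w k = w' k"
        then have "w \<circ> \<rho> = w' \<circ> \<rho>" using \<rho>(1) by auto
        then show "Q (w \<circ> \<rho>) = Q (w' \<circ> \<rho>)" by simp
      qed
      moreover have "X = ?s ?q" unfolding Q(3) agreement_def by (simp add: \<rho>(2) comp_def)
      moreover have "?q \<in> \<Q>" by (rule preds_rename[OF Q(1)])
      ultimately show "X \<in> ?s ` ?A" by (intro image_eqI[where x = ?q]) simp_all
    qed
    obtain W where W: "W \<subseteq> ?A" "finite W" "E1 - {RA, RB} = ?s ` W"
      using finite_subset_image[OF finite_Diff[OF *(1)] sub] by (elim exE conjE)
    have W': "W \<subseteq> \<Q>" "\<And>q. q \<in> W \<Longrightarrow> supported n q" using W(1) by blast+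
    obtain x y where xy: "x \<in> R" "y \<in> nlists n M" "y \<notin> R" "\<And>q. q \<in> W \<Longrightarrow> q (nth x) \<longleftrightarrow> q (nth y)"
      using indistinguishable_pair[OF nondef R W(2) W'] by blast
    have x: "x \<in> nlists n M" using xy(1) R by blast
    define code where "code m = (SOME z. val z = m)" for m
    have code: "val (code m) = m" if "m \<in> M" for m
      unfolding code_def by (rule someI_ex) (use that range_val in blast)
    \<comment> \<open>The condition that spells x on the even coordinates and y on the odd ones. It
      is compatible with C, whose domain avoids \<open>range \<tau>\<close>.\<close>
    define D where "D = (\<lambda>i. (\<tau> (2 * i), code (x ! i))) ` {..<n} \<union> (\<lambda>i. (\<tau> (2 * i + 1), code (y ! i))) ` {..<n}"
    have ne: "\<tau> (2 * i) \<noteq> \<tau> (Suc (2 * j))" "\<tau> (Suc (2 * j)) \<noteq> \<tau> (2 * i)" for i j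
      using \<tau> by (auto simp: inj_eq) presburger+
    have "single_valued D"
      using ne by (intro single_valuedI) (auto simp: D_def inj_eq[OF \<tau>])
    moreover have "Domain D \<subseteq> range \<tau>" unfolding D_def by auto
    ultimately have "single_valued (C \<union> D)"
      using *(3,4) unfolding cond_def single_valued_def by blast
    moreover have "cond D" unfolding cond_def
      using \<open>single_valued D\<close> infinite_values by (simp add: D_def ordLess_imp_ordLeq finite_ordLess_infinite2)
    ultimately have "cond (C \<union> D)" using cond_Un[OF *(3)] by blast
    then obtain \<xi> where \<xi>: "\<xi> \<in> cube (C \<union> D)" using cube_nonempty by blast
    have "h (\<tau> (2 * i)) \<xi> = code (x ! i)" "h (\<tau> (2 * i + 1)) \<xi> = code (y ! i)" if "i < n" for i
      using \<xi> that unfolding cube_def D_def by auto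
    then have a_at: "a i \<xi> = x ! i" and b_at: "b i \<xi> = y ! i" if "i < n" for i
      using that nlistsE_nth_in[OF x] nlistsE_nth_in[OF xy(2)] code unfolding a_def b_def by auto
    have "map (\<lambda>i. a i \<xi>) [0..<n] = x" "map (\<lambda>i. b i \<xi>) [0..<n] = y"
      using x xy(2) by (auto intro!: nth_equalityI simp: a_at b_at)
    then have "\<xi> \<in> RA" "\<xi> \<in> RB" using xy unfolding RA_def RB_def by simp_all
    moreover have "\<xi> \<in> ?s q" if q: "q \<in> W" for q
    proof -
      have "q (\<lambda>i. a i \<xi>) = q (nth x)" "q (\<lambda>i. b i \<xi>) = q (nth y)"
        by (rule supportedD[OF W'(2)[OF q]], simp add: a_at b_at)+
      then show ?thesis using xy(4)[OF q] by simp
    qed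
    then have "\<xi> \<in> \<Inter>(E1 - {RA, RB})" unfolding W(3) by blast
    ultimately show "\<Inter>E1 \<inter> cube C \<noteq> {}" using \<xi> unfolding cube_Un by blast
  qed
  have H0: "H0 \<noteq> {}" "H0 \<subseteq> funs \<times> funs"
    using n ab by (auto simp: H0_def image_subset_iff lessThan_empty_iff)
  have "agreements H0 \<subseteq> E0" unfolding E0_def by blast
  from total_correspondence[OF con this H0 cE cN cH]
  obtain E N H where E: "E0 \<subseteq> E" "H0 \<subseteq> H" "consistent E N" "agreements H \<subseteq> E" "H \<subseteq> funs \<times> funs"
    "\<forall>f\<in>funs. (\<exists>g. (f, g) \<in> H) \<and> (\<exists>g. (g, f) \<in> H)"
    by (elim exE conjE)
  have "\<Inter>E1 \<noteq> {}" if "finite E1" "E1 \<subseteq> E" for E1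
  proof -
    \<comment> \<open>The empty condition turns consistency into the finite intersection
      property.\<close>
    have "cond {}" by (simp add: cond_def card_of_empty)
    then show ?thesis using E(3) that unfolding consistent_def by blast
  qed
  then obtain U where U: "ultrafilter_on UNIV U" "E \<subseteq> U" using ultrafilter_extension by blast
  have up: "Y \<in> U" if "X1 \<in> U" "X2 \<in> U" "X1 \<inter> X2 \<subseteq> Y" for X1 X2 Y
    using U(1) that unfolding ultrafilter_on_def by blast
  have "{\<xi>. Q (\<lambda>k. fst (v k) \<xi>)} \<in> U \<longleftrightarrow> {\<xi>. Q (\<lambda>k. snd (v k) \<xi>)} \<in> U"
    if "Q \<in> \<Q>" "range v \<subseteq> H" for Q v
  proof -
    have "agreement Q v \<in> agreements H" using that unfolding agreements_def by blast
    then have "agreement Q v \<in> U" using E(4) U(2) by blast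
    note agr = this
    show ?thesis by (intro iffI; rule up[OF agr], assumption) (auto simp: agreement_def)
  qed
  moreover have "(a i, b i) \<in> H" if "i < n" for i using that E(2) unfolding H0_def by blast
  moreover have "RA \<in> U" "RB \<in> U" using E(1) U(2) unfolding E0_def by blast+
  ultimately show ?thesis unfolding RA_def RB_def using U(1) E(5,6)
    by (intro exI[of _ U] exI[of _ H] exI[of _ a] exI[of _ b] conjI) simp_all
qed

end

text \<open>Here I is the type \<open>'b set\<close>, and the coordinates are the elements of the
  type \<open>'b set set\<close>. The functions from I to M number at most kappa^(2^kappa) =
  2^(2^kappa), hence no more than the coordinates.\<close>

lemma separating_ultrafilter:
  fixes M :: "'m set" and \<Q> :: "((nat \<Rightarrow> 'm) \<Rightarrow> bool) set"
  assumes inf: "infinite (UNIV :: 'b set)" and M: "M \<noteq> {}" "|M| \<le>o |UNIV :: 'b set|"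
    and preds: "countable \<Q>" "\<And>Q. Q \<in> \<Q> \<Longrightarrow> \<exists>n. \<forall>v w. (\<forall>k<n. v k = w k) \<longrightarrow> Q v = Q w"
      "(\<lambda>v. v 0 = v 1) \<in> \<Q>" "\<And>Q. Q \<in> \<Q> \<Longrightarrow> (\<lambda>v. \<not> Q v) \<in> \<Q>"
      "\<And>Q Q'. Q \<in> \<Q> \<Longrightarrow> Q' \<in> \<Q> \<Longrightarrow> (\<lambda>v. Q v \<and> Q' v) \<in> \<Q>"
      "\<And>Q k. Q \<in> \<Q> \<Longrightarrow> (\<lambda>v. \<exists>a\<in>M. Q (v(k := a))) \<in> \<Q>"
      "\<And>Q \<rho>. Q \<in> \<Q> \<Longrightarrow> (\<lambda>v. Q (v \<circ> \<rho>)) \<in> \<Q>"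
    and nondef: "\<And>Q. Q \<in> \<Q> \<Longrightarrow> R \<noteq> {xs \<in> nlists n M. Q (\<lambda>i. xs ! (if i < n then i else 0))}"
    and R: "R \<subseteq> nlists n M" "n \<ge> 1"
  shows "\<exists>(U :: 'b set set set) H a b. ultrafilter_on UNIV U \<and> H \<subseteq> {f. range f \<subseteq> M} \<times> {f. range f \<subseteq> M} \<and>
    (\<forall>f. range f \<subseteq> M \<longrightarrow> (\<exists>g. (f, g) \<in> H) \<and> (\<exists>g. (g, f) \<in> H)) \<and>
    (\<forall>Q\<in>\<Q>. \<forall>v. range v \<subseteq> H \<longrightarrow>
      ({\<xi>. Q (\<lambda>k. fst (v k) \<xi>)} \<in> U \<longleftrightarrow> {\<xi>. Q (\<lambda>k. snd (v k) \<xi>)} \<in> U)) \<and>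
    (\<forall>i<n. (a i, b i) \<in> H) \<and>
    {\<xi>. map (\<lambda>i. a i \<xi>) [0..<n] \<in> R} \<in> U \<and> {\<xi>. map (\<lambda>i. b i \<xi>) [0..<n] \<notin> R} \<in> U"
proof -
  obtain h :: "'b set set \<Rightarrow> 'b set \<Rightarrow> 'b"
    where h: "\<And>J c. |J| \<le>o |UNIV :: 'b set| \<Longrightarrow> \<exists>\<xi>. \<forall>t\<in>J. h t \<xi> = c t"
    using independent_family[OF inf] by blast
  obtain val :: "'b \<Rightarrow> 'm" where val: "range val = M"
    using iffD2[OF card_of_ordLeq2[OF M(1)] M(2)] by blast
  have "inj (\<lambda>x :: 'b. {x})" by simp
  then have b_i: "|UNIV :: 'b set| \<le>o |UNIV :: 'b set set|" using card_of_ordLeq by blast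
  have i_j: "|UNIV :: 'b set set| <o |UNIV :: 'b set set set|"
    using card_of_Pow[of "UNIV :: 'b set set"] by simp
  have infi: "infinite (UNIV :: 'b set set)" using b_i inf card_of_ordLeq_infinite by blast
  have "|UNIV \<times> UNIV :: ('b set \<times> 'b) set| \<le>o |UNIV :: 'b set set|"
    using b_i by (intro card_of_Times_ordLeq_infinite infi card_of_mono1) auto
  then obtain p :: "'b set \<times> 'b \<Rightarrow> 'b set" where p: "inj p"
    using card_of_ordLeq[of "UNIV :: ('b set \<times> 'b) set" "UNIV :: 'b set set"] by auto
  \<comment> \<open>A function is coded by its graph, with pairs from
    \<open>'b set \<times> 'b\<close> compressed into \<open>'b set\<close>.\<close>
  define code where "code f = range (\<lambda>\<xi>. p (\<xi>, inv_into UNIV val (f \<xi>)))" for f :: "'b set \<Rightarrow> 'm"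
  have "inj_on code {f. range f \<subseteq> M}"
  proof (rule inj_onI)
    fix f g assume f: "f \<in> {f. range f \<subseteq> M}" and g: "g \<in> {f. range f \<subseteq> M}" and eq: "code f = code g"
    show "f = g"
    proof
      fix \<xi>
      have "p (\<xi>, inv_into UNIV val (f \<xi>)) \<in> code g" using eq unfolding code_def by blast
      then have "inv_into UNIV val (f \<xi>) = inv_into UNIV val (g \<xi>)"
        using p unfolding code_def by (auto simp: inj_eq)
      moreover have "f \<xi> \<in> range val" "g \<xi> \<in> range val" using f g val by auto
      ultimately show "f \<xi> = g \<xi>" by (metis f_inv_into_f)
    qed
  qed
  then have "|{f :: 'b set \<Rightarrow> 'm. range f \<subseteq> M}| \<le>o |UNIV :: 'b set set set|"
    using card_of_ordLeq[of "{f :: 'b set \<Rightarrow> 'm. range f \<subseteq> M}" "UNIV :: 'b set set set"] by blast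
  then interpret back_and_forth h M val \<Q>
    using inf h b_i i_j val preds by unfold_locales
  show ?thesis using separating_correspondence[OF nondef R] by simp
qed

section \<open>Formulas, renaming and automorphisms\<close>

lemma eval_tm_cong:
  "(\<And>k. k \<in> fv_tm t \<Longrightarrow> v k = w k) \<Longrightarrow> eval_tm M v t = eval_tm M w t"
proof (induction t)
  case (Fn f ts)
  have "map (eval_tm M v) ts = map (eval_tm M w) ts"
    using Fn by (intro map_cong refl) auto
  then show ?case by (simp del: map_eq_conv)
qed simp

lemma sat_cong:
  "(\<And>k. k \<in> fv_fm \<phi> \<Longrightarrow> v k = w k) \<Longrightarrow> sat M v \<phi> = sat M w \<phi>"
proof (induction \<phi> arbitrary: v w)
  case (FEq s t)
  then show ?case using eval_tm_cong[of s v w M] eval_tm_cong[of t v w M] by simp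
next
  case (FRel p ts)
  then have "map (eval_tm M v) ts = map (eval_tm M w) ts"
    by (intro map_cong refl eval_tm_cong) auto
  then show ?case by (simp del: map_eq_conv)
next
  case (FNot \<phi>)
  then show ?case by (metis fv_fm.simps(3) sat.simps(3))
next
  case (FAnd \<phi> \<psi>)
  then show ?case by (metis UnCI fv_fm.simps(4) sat.simps(4))
next
  case (FEx x \<phi>)
  have "sat M (v(x := a)) \<phi> = sat M (w(x := a)) \<phi>" for a
    by (rule FEx.IH) (use FEx.prems in auto)
  then show ?case by simp
qed

lemma finite_fv_tm: "finite (fv_tm t)"
  by (induction t) auto

lemma finite_fv_fm: "finite (fv_fm \<phi>)"
  by (induction \<phi>) (auto simp: finite_fv_tm)

fun rename_tm :: "(nat \<Rightarrow> nat) \<Rightarrow> 'f tm \<Rightarrow> 'f tm" where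
  "rename_tm \<rho> (Var x) = Var (\<rho> x)"
| "rename_tm \<rho> (Fn f ts) = Fn f (map (rename_tm \<rho>) ts)"

text \<open>The renaming need not be injective, so the bound variable becomes a number above the
  images of all variables free in the body, which avoids capture. Inserting 0 keeps the maximum
  defined when there are none.\<close>

fun rename_fm :: "(nat \<Rightarrow> nat) \<Rightarrow> ('f, 'p) fm \<Rightarrow> ('f, 'p) fm" where
  "rename_fm \<rho> (FEq s t) = FEq (rename_tm \<rho> s) (rename_tm \<rho> t)"
| "rename_fm \<rho> (FRel p ts) = FRel p (map (rename_tm \<rho>) ts)"
| "rename_fm \<rho> (FNot \<phi>) = FNot (rename_fm \<rho> \<phi>)"
| "rename_fm \<rho> (FAnd \<phi> \<psi>) = FAnd (rename_fm \<rho> \<phi>) (rename_fm \<rho> \<psi>)"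
| "rename_fm \<rho> (FEx x \<phi>) =
    (let y = Suc (Max (insert 0 (\<rho> ` fv_fm \<phi>))) in FEx y (rename_fm (\<rho>(x := y)) \<phi>))"

lemma eval_rename_tm: "eval_tm M v (rename_tm \<rho> t) = eval_tm M (v \<circ> \<rho>) t"
  by (induction t) (simp_all add: comp_def cong: map_cong)

lemma sat_rename_fm: "sat M v (rename_fm \<rho> \<phi>) = sat M (v \<circ> \<rho>) \<phi>"
proof (induction \<phi> arbitrary: \<rho> v)
  case (FRel p ts)
  then show ?case by (simp add: eval_rename_tm comp_def)
next
  case (FEx x \<phi>)
  let ?y = "Suc (Max (insert 0 (\<rho> ` fv_fm \<phi>)))"
  have "\<rho> z \<noteq> ?y" if "z \<in> fv_fm \<phi>" for z
  proof -
    have "\<rho> z \<le> Max (insert 0 (\<rho> ` fv_fm \<phi>))"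
      by (rule Max_ge) (use that finite_fv_fm[of \<phi>] in auto)
    then show ?thesis by simp
  qed
  then have "sat M (v(?y := a) \<circ> \<rho>(x := ?y)) \<phi> = sat M ((v \<circ> \<rho>)(x := a)) \<phi>" for a
    by (intro sat_cong) auto
  then show ?case by (simp only: rename_fm.simps Let_def sat.simps FEx.IH)
qed (simp_all add: eval_rename_tm)

lemma wf_rename_tm: "wf_tm L (rename_tm \<rho> t) = wf_tm L t"
  by (induction t) auto

lemma wf_rename_fm: "wf_fm L (rename_fm \<rho> \<phi>) = wf_fm L \<phi>"
  by (induction \<phi> arbitrary: \<rho>) (auto simp: wf_rename_tm Let_def)

lemma fv_rename_tm: "fv_tm (rename_tm \<rho> t) = \<rho> ` fv_tm t"
  by (induction t) auto

lemma fv_rename_fm: "fv_fm (rename_fm \<rho> \<phi>) \<subseteq> \<rho> ` fv_fm \<phi>"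
proof (induction \<phi> arbitrary: \<rho>)
  case (FEx x \<phi>)
  let ?y = "Suc (Max (insert 0 (\<rho> ` fv_fm \<phi>)))"
  have "fv_fm (rename_fm (\<rho>(x := ?y)) \<phi>) - {?y} \<subseteq> (\<rho>(x := ?y)) ` fv_fm \<phi> - {?y}"
    using FEx.IH by blast
  also have "\<dots> \<subseteq> \<rho> ` (fv_fm \<phi> - {x})" by auto
  finally show ?case by (simp add: Let_def)
next
  case (FAnd \<phi> \<psi>)
  then show ?case by (simp add: image_Un) blast
qed (auto simp: fv_rename_tm)

lemma Aut_eval_tm:
  assumes \<alpha>: "\<alpha> \<in> Aut L M"
    and closed: "\<And>f xs. f \<in> fun_syms L \<Longrightarrow> xs \<in> nlists (fun_arity L f) (universe M) \<Longrightarrow> fun_interp M f xs \<in> universe M"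
    and "wf_tm L t" "\<And>k. k \<in> fv_tm t \<Longrightarrow> v k \<in> universe M"
  shows "eval_tm M v t \<in> universe M \<and> eval_tm M (\<lambda>k. \<alpha> (v k)) t = \<alpha> (eval_tm M v t)"
  using assms(3,4)
proof (induction t)
  case (Fn f ts)
  have ih: "eval_tm M v t \<in> universe M" "eval_tm M (\<lambda>k. \<alpha> (v k)) t = \<alpha> (eval_tm M v t)" if "t \<in> set ts" for t
  proof -
    have "wf_tm L t" using Fn.prems(1) that by simp
    moreover have "v k \<in> universe M" if "k \<in> fv_tm t" for k
      using Fn.prems(2)[of k] that \<open>t \<in> set ts\<close> by auto
    ultimately show "eval_tm M v t \<in> universe M" "eval_tm M (\<lambda>k. \<alpha> (v k)) t = \<alpha> (eval_tm M v t)"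
      using Fn.IH[OF that] by simp_all
  qed
  have f: "f \<in> fun_syms L" and "length ts = fun_arity L f" using Fn.prems(1) by simp_all
  then have args: "map (eval_tm M v) ts \<in> nlists (fun_arity L f) (universe M)"
    using ih(1) by (intro nlistsI) auto
  have "map (eval_tm M (\<lambda>k. \<alpha> (v k))) ts = map \<alpha> (map (eval_tm M v) ts)" using ih(2) by simp
  then have "eval_tm M (\<lambda>k. \<alpha> (v k)) (Fn f ts) = \<alpha> (eval_tm M v (Fn f ts))"
    using \<alpha> f args unfolding Aut_def by (simp del: map_map map_eq_conv)
  then show ?case using closed[OF f args] by simp
qed simp

text \<open>Closure under the function symbols is a separate hypothesis so that geometries, whose
  language has no function symbols, and ultrapowers are covered alike. The quantifier case rests on
  \<alpha> being onto.\<close>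

lemma Aut_sat:
  assumes \<alpha>: "\<alpha> \<in> Aut L M"
    and closed: "\<And>f xs. f \<in> fun_syms L \<Longrightarrow> xs \<in> nlists (fun_arity L f) (universe M) \<Longrightarrow> fun_interp M f xs \<in> universe M"
    and "wf_fm L \<phi>" "\<And>k. k \<in> fv_fm \<phi> \<Longrightarrow> v k \<in> universe M"
  shows "sat M (\<lambda>k. \<alpha> (v k)) \<phi> = sat M v \<phi>"
  using assms(3,4)
proof (induction \<phi> arbitrary: v)
  case (FEq s t)
  have bij: "inj_on \<alpha> (universe M)" using \<alpha> unfolding Aut_def Bij_def bij_betw_def by blast
  show ?case
    using Aut_eval_tm[OF \<alpha> closed, of s v] Aut_eval_tm[OF \<alpha> closed, of t v] FEq
    by (simp add: inj_on_eq_iff[OF bij])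
next
  case (FRel p ts)
  have e: "eval_tm M v t \<in> universe M" "eval_tm M (\<lambda>k. \<alpha> (v k)) t = \<alpha> (eval_tm M v t)" if "t \<in> set ts" for t
  proof -
    have "wf_tm L t" using FRel.prems(1) that by simp
    moreover have "v k \<in> universe M" if "k \<in> fv_tm t" for k
      using FRel.prems(2)[of k] that \<open>t \<in> set ts\<close> by auto
    ultimately show "eval_tm M v t \<in> universe M" "eval_tm M (\<lambda>k. \<alpha> (v k)) t = \<alpha> (eval_tm M v t)"
      using Aut_eval_tm[OF \<alpha> closed, of t v] by simp_all
  qed
  have args: "map (eval_tm M v) ts \<in> nlists (rel_arity L p) (universe M)"
    using FRel.prems(1) e(1) by (intro nlistsI) auto
  have "map (eval_tm M (\<lambda>k. \<alpha> (v k))) ts = map \<alpha> (map (eval_tm M v) ts)" using e(2) by simp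
  then show ?case using \<alpha> args FRel.prems(1) unfolding Aut_def by (simp del: map_map map_eq_conv)
next
  case (FEx x \<phi>)
  have im: "\<alpha> ` universe M = universe M" using \<alpha> unfolding Aut_def Bij_def bij_betw_def by blast
  have "sat M ((\<lambda>k. \<alpha> (v k))(x := \<alpha> a)) \<phi> = sat M (v(x := a)) \<phi>" if "a \<in> universe M" for a
  proof -
    have "(\<lambda>k. \<alpha> (v k))(x := \<alpha> a) = (\<lambda>k. \<alpha> ((v(x := a)) k))" by auto
    moreover have "sat M (\<lambda>k. \<alpha> ((v(x := a)) k)) \<phi> = sat M (v(x := a)) \<phi>"
      by (rule FEx.IH) (use FEx.prems that in auto)
    ultimately show ?thesis by simp
  qed
  then have "(\<exists>b\<in>\<alpha> ` universe M. sat M ((\<lambda>k. \<alpha> (v k))(x := b)) \<phi>) \<longleftrightarrow> (\<exists>a\<in>universe M. sat M (v(x := a)) \<phi>)"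
    by blast
  then show ?case using im by simp
qed auto

section \<open>Definable predicates and definable relations\<close>

instance tm :: (countable) countable by countable_datatype
instance fm :: (countable, countable) countable by countable_datatype
instance geo_rel :: countable by countable_datatype

definition definable_preds :: "('f, 'p) language \<Rightarrow> ('f, 'p, 'a) struct \<Rightarrow> ((nat \<Rightarrow> 'a) \<Rightarrow> bool) set" where
  "definable_preds L M = (\<lambda>\<phi> v. sat M v \<phi>) ` {\<phi>. wf_fm L \<phi>}"

lemma definable_predsI: "wf_fm L \<phi> \<Longrightarrow> (\<And>v. Q v = sat M v \<phi>) \<Longrightarrow> Q \<in> definable_preds L M"
  unfolding definable_preds_def by blast

lemma definable_preds_support:
  assumes "Q \<in> definable_preds L M"
  shows "\<exists>n. \<forall>v w. (\<forall>k<n. v k = w k) \<longrightarrow> Q v = Q w"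
proof -
  obtain \<phi> where \<phi>: "Q = (\<lambda>v. sat M v \<phi>)" using assms unfolding definable_preds_def by blast
  obtain n where "\<And>k. k \<in> fv_fm \<phi> \<Longrightarrow> k < n" using finite_nat_set_iff_bounded finite_fv_fm by metis
  then show ?thesis unfolding \<phi> using sat_cong by (metis (no_types, lifting))
qed

lemma definable_preds_closed:
  shows "(\<lambda>v. v 0 = v 1) \<in> definable_preds L M"
    and "Q \<in> definable_preds L M \<Longrightarrow> (\<lambda>v. \<not> Q v) \<in> definable_preds L M"
    and "Q \<in> definable_preds L M \<Longrightarrow> Q' \<in> definable_preds L M \<Longrightarrow> (\<lambda>v. Q v \<and> Q' v) \<in> definable_preds L M"
    and "Q \<in> definable_preds L M \<Longrightarrow> (\<lambda>v. \<exists>a\<in>universe M. Q (v(k := a))) \<in> definable_preds L M"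
    and "Q \<in> definable_preds L M \<Longrightarrow> (\<lambda>v. Q (v \<circ> \<rho>)) \<in> definable_preds L M"
proof -
  show "(\<lambda>v. v 0 = v 1) \<in> definable_preds L M"
    by (rule definable_predsI[of _ "FEq (Var 0) (Var 1)"]) simp_all
next
  assume "Q \<in> definable_preds L M"
  then obtain \<phi> where \<phi>: "wf_fm L \<phi>" "Q = (\<lambda>v. sat M v \<phi>)" unfolding definable_preds_def by blast
  show "(\<lambda>v. \<not> Q v) \<in> definable_preds L M"
    by (rule definable_predsI[of _ "FNot \<phi>"]) (simp_all add: \<phi>)
  show "(\<lambda>v. \<exists>a\<in>universe M. Q (v(k := a))) \<in> definable_preds L M"
    by (rule definable_predsI[of _ "FEx k \<phi>"]) (simp_all add: \<phi>)
  show "(\<lambda>v. Q (v \<circ> \<rho>)) \<in> definable_preds L M"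
    by (rule definable_predsI[of _ "rename_fm \<rho> \<phi>"]) (simp_all add: \<phi> wf_rename_fm sat_rename_fm)
  assume "Q' \<in> definable_preds L M"
  then obtain \<psi> where \<psi>: "wf_fm L \<psi>" "Q' = (\<lambda>v. sat M v \<psi>)" unfolding definable_preds_def by blast
  show "(\<lambda>v. Q v \<and> Q' v) \<in> definable_preds L M"
    by (rule definable_predsI[of _ "FAnd \<phi> \<psi>"]) (simp_all add: \<phi> \<psi>)
qed

lemma Conc_preserved:
  assumes "S \<in> Conc (geo_language k ar) G"
  shows "preserved_by S (Aut (geo_language k ar) G)"
  unfolding preserved_by_def
proof
  let ?L = "geo_language k ar"
  fix \<alpha> assume \<alpha>: "\<alpha> \<in> Aut ?L G"
  obtain m \<phi> where \<phi>: "is_formula ?L m \<phi>" "S = extension G m \<phi>"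
    using assms unfolding Conc_def definable_def by blast
  have bij: "bij_betw \<alpha> (universe G) (universe G)" using \<alpha> unfolding Aut_def Bij_def by blast
  have iff: "map \<alpha> xs \<in> S \<longleftrightarrow> xs \<in> S" if xs: "xs \<in> nlists m (universe G)" for xs
  proof -
    have bound: "k < m" if "k \<in> fv_fm \<phi>" for k using \<phi>(1) that unfolding is_formula_def by blast
    have "sat G (nth (map \<alpha> xs)) \<phi> = sat G (\<lambda>k. \<alpha> (xs ! k)) \<phi>"
      by (rule sat_cong) (use bound xs in simp)
    also have "\<dots> = sat G (nth xs) \<phi>"
      by (rule Aut_sat[OF \<alpha>])
        (use \<phi>(1) bound nlistsE_nth_in[OF xs] in \<open>auto simp: is_formula_def geo_language_def\<close>)
    finally have "sat G (nth (map \<alpha> xs)) \<phi> = sat G (nth xs) \<phi>" .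
    moreover have "map \<alpha> xs \<in> nlists m (universe G)"
      using bij_betw_imp_surj_on[OF bij] nlistsE_set[OF xs] nlistsE_length[OF xs] by (intro nlistsI) auto
    ultimately show ?thesis using xs unfolding \<phi>(2) extension_def by simp
  qed
  show "map \<alpha> ` S = S"
  proof
    show "map \<alpha> ` S \<subseteq> S" using iff unfolding \<phi>(2) extension_def by blast
    show "S \<subseteq> map \<alpha> ` S"
    proof
      fix ys assume ys: "ys \<in> S"
      then have ys': "ys \<in> nlists m (universe G)" unfolding \<phi>(2) extension_def by blast
      define xs where "xs = map (inv_into (universe G) \<alpha>) ys"
      have "\<alpha> (inv_into (universe G) \<alpha> y) = y" if "y \<in> set ys" for y
        using bij that nlistsE_set[OF ys'] by (intro f_inv_into_f) (auto simp: bij_betw_def)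
      then have eq: "map \<alpha> xs = ys" unfolding xs_def by (simp add: map_idI)
      have "inv_into (universe G) \<alpha> y \<in> universe G" if "y \<in> set ys" for y
        using bij that nlistsE_set[OF ys'] by (intro inv_into_into) (auto simp: bij_betw_def)
      then have "xs \<in> nlists m (universe G)"
        using nlistsE_length[OF ys'] unfolding xs_def by (intro nlistsI) auto
      then have "xs \<in> S" using iff[of xs] ys unfolding eq by simp
      then show "ys \<in> map \<alpha> ` S" using eq by blast
    qed
  qed
qed

text \<open>A predicate in more than n variables still gives an n-ary formula once the surplus
  variables are renamed to 0, and 0 is an admissible variable because n is positive.\<close>

lemma not_Conc_not_definable:
  assumes "S \<notin> Conc L G" "n \<ge> 1" "Q \<in> definable_preds L G"
  shows "S \<noteq> {xs \<in> nlists n (universe G). Q (\<lambda>i. xs ! (if i < n then i else 0))}"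
proof
  assume S: "S = {xs \<in> nlists n (universe G). Q (\<lambda>i. xs ! (if i < n then i else 0))}"
  let ?\<rho> = "\<lambda>i. if i < n then i else 0 :: nat"
  obtain \<phi> where \<phi>: "wf_fm L \<phi>" "Q = (\<lambda>v. sat G v \<phi>)"
    using assms(3) unfolding definable_preds_def by blast
  have "fv_fm (rename_fm ?\<rho> \<phi>) \<subseteq> ?\<rho> ` fv_fm \<phi>" by (rule fv_rename_fm)
  also have "\<dots> \<subseteq> {..<n}" using assms(2) by auto
  finally have "is_formula L n (rename_fm ?\<rho> \<phi>)" using \<phi>(1) unfolding is_formula_def by (simp add: wf_rename_fm)
  moreover have "S = extension G n (rename_fm ?\<rho> \<phi>)"
    unfolding S extension_def sat_rename_fm \<phi>(2) comp_def ..
  ultimately show False using assms(1,2) unfolding Conc_def definable_def by blast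
qed

text \<open>Concatenation is injective on n-tuples of points, as all points have length d, so the
  relation is recovered from its flattened form.\<close>

lemma point_definable_extension:
  assumes "point_definable L M d n S"
  shows "\<exists>\<psi>. is_formula L (d * n) \<psi> \<and> S = point_extension M d n \<psi>"
proof -
  obtain \<psi> where \<psi>: "is_formula L (d * n) \<psi>" "concat ` S = extension M (d * n) \<psi>" "S \<subseteq> nlists n (points M d)"
    using assms unfolding point_definable_def definable_def by blast
  have "as \<in> S" if as: "as \<in> nlists n (points M d)" "concat as \<in> concat ` S" for as
  proof -
    obtain bs where bs: "bs \<in> S" "concat as = concat bs" using as(2) by blast
    have bs': "bs \<in> nlists n (points M d)" using bs(1) \<psi>(3) by blast
    have "length x = d" if "x \<in> set as \<union> set bs" for x
      using that nlistsE_set[OF as(1)] nlistsE_set[OF bs'] nlistsE_length unfolding points_def by blast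
    then have "\<forall>(x, y)\<in>set (zip as bs). length x = length y"
      by (auto dest: set_zip_leftD set_zip_rightD)
    then have "as = bs"
      using bs(2) nlistsE_length[OF as(1)] nlistsE_length[OF bs'] concat_injective by metis
    then show ?thesis using bs(1) by simp
  qed
  then have "S = point_extension M d n \<psi>"
    unfolding point_extension_def \<psi>(2)[symmetric] using \<psi>(3) by blast
  then show ?thesis using \<psi>(1) by blast
qed

section \<open>Ultrapowers\<close>

locale ultrapower_of =
  fixes U :: "'i set set" and L :: "('f, 'p) language" and M :: "('f, 'p, 'a) struct"
  assumes ultrafilter: "ultrafilter_on UNIV U" and struct: "is_structure L M"
begin

definition ae :: "('i \<Rightarrow> bool) \<Rightarrow> bool" where
  "ae P \<longleftrightarrow> {\<xi>. P \<xi>} \<in> U"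

lemma ae_mono: "ae P \<Longrightarrow> (\<And>\<xi>. P \<xi> \<Longrightarrow> Q \<xi>) \<Longrightarrow> ae Q"
  using ultrafilter unfolding ae_def ultrafilter_on_def by (metis (no_types, lifting) Collect_mono subset_UNIV)

lemma ae_const [simp]: "ae (\<lambda>\<xi>. P) \<longleftrightarrow> P"
  using ultrafilter unfolding ae_def ultrafilter_on_def by (cases P) simp_all

lemma ae_conj: "ae (\<lambda>\<xi>. P \<xi> \<and> Q \<xi>) \<longleftrightarrow> ae P \<and> ae Q"
proof
  assume "ae P \<and> ae Q"
  then have "{\<xi>. P \<xi>} \<inter> {\<xi>. Q \<xi>} \<in> U" using ultrafilter unfolding ae_def ultrafilter_on_def by blast
  then show "ae (\<lambda>\<xi>. P \<xi> \<and> Q \<xi>)" unfolding ae_def by (simp add: Collect_conj_eq)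
qed (auto elim: ae_mono)

lemma ae_not: "ae (\<lambda>\<xi>. \<not> P \<xi>) \<longleftrightarrow> \<not> ae P"
proof -
  have "UNIV - {\<xi>. P \<xi>} = {\<xi>. \<not> P \<xi>}" by blast
  then have "ae P \<or> ae (\<lambda>\<xi>. \<not> P \<xi>)"
    using ultrafilter subset_UNIV[of "{\<xi>. P \<xi>}"] unfolding ae_def ultrafilter_on_def by metis
  moreover have "\<not> (ae P \<and> ae (\<lambda>\<xi>. \<not> P \<xi>))" by (simp flip: ae_conj)
  ultimately show ?thesis by blast
qed

lemma ae_imp: "ae (\<lambda>\<xi>. P \<xi> \<longrightarrow> Q \<xi>) \<longleftrightarrow> (ae P \<longrightarrow> ae Q)"
proof -
  have "ae (\<lambda>\<xi>. \<not> (P \<xi> \<and> \<not> Q \<xi>)) \<longleftrightarrow> (ae P \<longrightarrow> ae Q)" unfolding ae_not ae_conj by blast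
  then show ?thesis by simp
qed

lemma ae_disj: "ae (\<lambda>\<xi>. P \<xi> \<or> Q \<xi>) \<longleftrightarrow> ae P \<or> ae Q"
proof -
  have "ae (\<lambda>\<xi>. \<not> (\<not> P \<xi> \<and> \<not> Q \<xi>)) \<longleftrightarrow> ae P \<or> ae Q" unfolding ae_not ae_conj by blast
  then show ?thesis by simp
qed

lemma ae_iff: "ae (\<lambda>\<xi>. P \<xi> \<longleftrightarrow> Q \<xi>) \<longleftrightarrow> (ae P \<longleftrightarrow> ae Q)"
proof -
  have "ae (\<lambda>\<xi>. (P \<xi> \<longrightarrow> Q \<xi>) \<and> (Q \<xi> \<longrightarrow> P \<xi>)) \<longleftrightarrow> (ae P \<longleftrightarrow> ae Q)" unfolding ae_imp ae_conj by blast
  moreover have "(\<lambda>\<xi>. (P \<xi> \<longrightarrow> Q \<xi>) \<and> (Q \<xi> \<longrightarrow> P \<xi>)) = (\<lambda>\<xi>. P \<xi> \<longleftrightarrow> Q \<xi>)" by blast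
  ultimately show ?thesis by simp
qed

lemma ae_ball_finite: "finite A \<Longrightarrow> ae (\<lambda>\<xi>. \<forall>x\<in>A. P x \<xi>) \<longleftrightarrow> (\<forall>x\<in>A. ae (P x))"
  by (induction A rule: finite_induct) (simp_all add: ae_conj)

lemma ae_all_less: "ae (\<lambda>\<xi>. \<forall>i<n. P i \<xi>) \<longleftrightarrow> (\<forall>i<n. ae (P i))" for n :: nat
  using ae_ball_finite[of "{..<n}" P] by (simp add: Ball_def)

text \<open>Witnesses are chosen index by index. At indices without one, the chosen function still
  has to take a value in S, which is why S is nonempty.\<close>

lemma ae_bex: "ae (\<lambda>\<xi>. \<exists>a\<in>S. P a \<xi>) \<longleftrightarrow> (\<exists>f. range f \<subseteq> S \<and> ae (\<lambda>\<xi>. P (f \<xi>) \<xi>))" if "S \<noteq> {}"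
proof
  assume ae: "ae (\<lambda>\<xi>. \<exists>a\<in>S. P a \<xi>)"
  define f where "f \<xi> = (if \<exists>a\<in>S. P a \<xi> then SOME a. a \<in> S \<and> P a \<xi> else SOME a. a \<in> S)" for \<xi>
  have 1: "f \<xi> \<in> S \<and> P (f \<xi>) \<xi>" if "\<exists>a\<in>S. P a \<xi>" for \<xi>
  proof -
    have "\<exists>a. a \<in> S \<and> P a \<xi>" using that by blast
    from someI_ex[OF this] show ?thesis using that by (simp add: f_def)
  qed
  have "f \<xi> \<in> S" for \<xi>
  proof (cases "\<exists>a\<in>S. P a \<xi>")
    case False
    have "\<exists>a. a \<in> S" using \<open>S \<noteq> {}\<close> by blast
    from someI_ex[OF this] show ?thesis using False by (simp add: f_def)
  qed (use 1 in blast)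
  moreover have "ae (\<lambda>\<xi>. P (f \<xi>) \<xi>)" by (rule ae_mono[OF ae]) (use 1 in blast)
  ultimately show "\<exists>f. range f \<subseteq> S \<and> ae (\<lambda>\<xi>. P (f \<xi>) \<xi>)" by blast
next
  assume "\<exists>f. range f \<subseteq> S \<and> ae (\<lambda>\<xi>. P (f \<xi>) \<xi>)"
  then obtain f where f: "range f \<subseteq> S" "ae (\<lambda>\<xi>. P (f \<xi>) \<xi>)" by blast
  show "ae (\<lambda>\<xi>. \<exists>a\<in>S. P a \<xi>)"
    by (rule ae_mono[OF f(2)]) (use f(1) in blast)
qed

lemma ae_ball:
  assumes "S \<noteq> {}"
  shows "ae (\<lambda>\<xi>. \<forall>a\<in>S. P a \<xi>) \<longleftrightarrow> (\<forall>f. range f \<subseteq> S \<longrightarrow> ae (\<lambda>\<xi>. P (f \<xi>) \<xi>))"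
proof -
  have "ae (\<lambda>\<xi>. \<not> (\<exists>a\<in>S. \<not> P a \<xi>)) \<longleftrightarrow> (\<forall>f. range f \<subseteq> S \<longrightarrow> ae (\<lambda>\<xi>. P (f \<xi>) \<xi>))"
    unfolding ae_not ae_bex[OF assms] by blast
  then show ?thesis by simp
qed

section \<open>Representatives of the ultrapower and the theorem of Los\<close>

definition seqs :: "('i \<Rightarrow> 'a) set" where
  "seqs = {f. range f \<subseteq> universe M}"

abbreviation N :: "('f, 'p, ('i \<Rightarrow> 'a) set) struct" where
  "N \<equiv> ultrapower UNIV U M"

definition cls :: "('i \<Rightarrow> 'a) \<Rightarrow> ('i \<Rightarrow> 'a) set" where
  "cls f = {g \<in> seqs. ae (\<lambda>\<xi>. f \<xi> = g \<xi>)}"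

lemma seqs_iff: "f \<in> seqs \<longleftrightarrow> (\<forall>\<xi>. f \<xi> \<in> universe M)"
  unfolding seqs_def by auto

lemma PiE_UNIV_seqs: "UNIV \<rightarrow>\<^sub>E universe M = seqs"
  by (auto simp: seqs_iff PiE_def extensional_def Pi_iff)

lemma quotient_seqs:
  "seqs // {(g, h). g \<in> seqs \<and> h \<in> seqs \<and> {i \<in> UNIV. g i = h i} \<in> U} = cls ` seqs"
  unfolding quotient_def cls_def ae_def by auto

lemma universe_N: "universe N = cls ` seqs"
  unfolding ultrapower_def Let_def PiE_UNIV_seqs quotient_seqs by simp

lemma cls_eq_iff:
  assumes "f \<in> seqs" "g \<in> seqs"
  shows "cls f = cls g \<longleftrightarrow> ae (\<lambda>\<xi>. f \<xi> = g \<xi>)"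
proof
  assume "cls f = cls g"
  moreover have "g \<in> cls g" using assms(2) by (simp add: cls_def)
  ultimately show "ae (\<lambda>\<xi>. f \<xi> = g \<xi>)" unfolding cls_def by blast
next
  assume eq: "ae (\<lambda>\<xi>. f \<xi> = g \<xi>)"
  have "ae (\<lambda>\<xi>. f \<xi> = x \<xi>) \<longleftrightarrow> ae (\<lambda>\<xi>. g \<xi> = x \<xi>)" for x
  proof -
    have "ae (\<lambda>\<xi>. f \<xi> = x \<xi> \<longleftrightarrow> g \<xi> = x \<xi>)" using eq by (rule ae_mono) simp
    then show ?thesis unfolding ae_iff .
  qed
  then show "cls f = cls g" unfolding cls_def by simp
qed

lemma representatives_eq:
  "list_all2 (\<in>) hs (map cls fs) \<Longrightarrow> ae (\<lambda>\<xi>. map (\<lambda>f. f \<xi>) fs = map (\<lambda>h. h \<xi>) hs)"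
proof (induction fs arbitrary: hs)
  case (Cons f fs)
  then obtain h hs' where hs: "hs = h # hs'" "h \<in> cls f" "list_all2 (\<in>) hs' (map cls fs)"
    by (auto simp: list_all2_Cons2)
  then have "ae (\<lambda>\<xi>. f \<xi> = h \<xi>)" unfolding cls_def by blast
  then show ?case using Cons.IH[OF hs(3)] by (simp add: hs(1) ae_conj)
qed simp

lemma list_all2_cls: "set fs \<subseteq> seqs \<Longrightarrow> list_all2 (\<in>) fs (map cls fs)"
  by (induction fs) (auto simp: cls_def)

lemma fun_interp_N:
  assumes "set fs \<subseteq> seqs"
  shows "fun_interp N F (map cls fs) = cls (\<lambda>\<xi>. fun_interp M F (map (\<lambda>f. f \<xi>) fs))"
proof -
  have "(\<exists>hs. list_all2 (\<in>) hs (map cls fs) \<and> ae (\<lambda>\<xi>. g \<xi> = fun_interp M F (map (\<lambda>h. h \<xi>) hs))) \<longleftrightarrow>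
    ae (\<lambda>\<xi>. fun_interp M F (map (\<lambda>f. f \<xi>) fs) = g \<xi>)" for g
  proof
    assume "\<exists>hs. list_all2 (\<in>) hs (map cls fs) \<and> ae (\<lambda>\<xi>. g \<xi> = fun_interp M F (map (\<lambda>h. h \<xi>) hs))"
    then obtain hs where "list_all2 (\<in>) hs (map cls fs)" "ae (\<lambda>\<xi>. g \<xi> = fun_interp M F (map (\<lambda>h. h \<xi>) hs))"
      by blast
    then have "ae (\<lambda>\<xi>. g \<xi> = fun_interp M F (map (\<lambda>h. h \<xi>) hs) \<and> map (\<lambda>f. f \<xi>) fs = map (\<lambda>h. h \<xi>) hs)"
      using representatives_eq unfolding ae_conj by blast
    then show "ae (\<lambda>\<xi>. fun_interp M F (map (\<lambda>f. f \<xi>) fs) = g \<xi>)" by (rule ae_mono) metis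
  next
    assume "ae (\<lambda>\<xi>. fun_interp M F (map (\<lambda>f. f \<xi>) fs) = g \<xi>)"
    then show "\<exists>hs. list_all2 (\<in>) hs (map cls fs) \<and> ae (\<lambda>\<xi>. g \<xi> = fun_interp M F (map (\<lambda>h. h \<xi>) hs))"
      using list_all2_cls[OF assms] by (intro exI[of _ fs]) (simp add: eq_commute)
  qed
  then show ?thesis
    unfolding ultrapower_def Let_def PiE_UNIV_seqs cls_def[of "\<lambda>\<xi>. fun_interp M F (map (\<lambda>f. f \<xi>) fs)"]
    by (simp add: ae_def)
qed

lemma rel_interp_N:
  assumes "set fs \<subseteq> seqs"
  shows "map cls fs \<in> rel_interp N p \<longleftrightarrow> ae (\<lambda>\<xi>. map (\<lambda>f. f \<xi>) fs \<in> rel_interp M p)"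
proof -
  have "(\<exists>hs. list_all2 (\<in>) hs (map cls fs) \<and> ae (\<lambda>\<xi>. map (\<lambda>h. h \<xi>) hs \<in> rel_interp M p)) \<longleftrightarrow>
    ae (\<lambda>\<xi>. map (\<lambda>f. f \<xi>) fs \<in> rel_interp M p)"
  proof
    assume "\<exists>hs. list_all2 (\<in>) hs (map cls fs) \<and> ae (\<lambda>\<xi>. map (\<lambda>h. h \<xi>) hs \<in> rel_interp M p)"
    then obtain hs where "list_all2 (\<in>) hs (map cls fs)" "ae (\<lambda>\<xi>. map (\<lambda>h. h \<xi>) hs \<in> rel_interp M p)"
      by blast
    then have "ae (\<lambda>\<xi>. map (\<lambda>h. h \<xi>) hs \<in> rel_interp M p \<and> map (\<lambda>f. f \<xi>) fs = map (\<lambda>h. h \<xi>) hs)"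
      using representatives_eq unfolding ae_conj by blast
    then show "ae (\<lambda>\<xi>. map (\<lambda>f. f \<xi>) fs \<in> rel_interp M p)" by (rule ae_mono) metis
  qed (use list_all2_cls[OF assms] in blast)
  moreover have "set (map cls fs) \<subseteq> cls ` seqs" using assms by auto
  ultimately show ?thesis
    unfolding ultrapower_def Let_def PiE_UNIV_seqs quotient_seqs by (simp add: ae_def)
qed

lemma fun_interp_closed:
  "f \<in> fun_syms L \<Longrightarrow> xs \<in> nlists (fun_arity L f) (universe M) \<Longrightarrow> fun_interp M f xs \<in> universe M"
  using struct unfolding is_structure_def by blast

lemma map_seqs_nlists: "set fs \<subseteq> seqs \<Longrightarrow> map (\<lambda>f. f \<xi>) fs \<in> nlists (length fs) (universe M)"
  by (intro nlistsI) (auto simp: seqs_iff)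

lemma fun_interp_seqs:
  assumes "f \<in> fun_syms L" "set fs \<subseteq> seqs" "length fs = fun_arity L f"
  shows "(\<lambda>\<xi>. fun_interp M f (map (\<lambda>f. f \<xi>) fs)) \<in> seqs"
  unfolding seqs_iff
  by (intro allI fun_interp_closed[OF assms(1)]) (use map_seqs_nlists[OF assms(2)] assms(3) in simp)

lemma nlists_cls:
  assumes "xs \<in> nlists m (universe N)"
  shows "\<exists>fs. set fs \<subseteq> seqs \<and> length fs = m \<and> xs = map cls fs"
proof -
  have "xs \<in> lists (cls ` seqs)" using nlistsE_set[OF assms] unfolding universe_N lists_eq_set by simp
  then obtain fs where "fs \<in> lists seqs" "xs = map cls fs" unfolding lists_image by blast
  then show ?thesis using nlistsE_length[OF assms] unfolding lists_eq_set by (intro exI[of _ fs]) simp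
qed

lemma fun_interp_N_closed:
  assumes "f \<in> fun_syms L" "xs \<in> nlists (fun_arity L f) (universe N)"
  shows "fun_interp N f xs \<in> universe N"
proof -
  obtain fs where "set fs \<subseteq> seqs" "length fs = fun_arity L f" "xs = map cls fs"
    using nlists_cls[OF assms(2)] by blast
  then show ?thesis
    using fun_interp_seqs[OF assms(1)] unfolding universe_N by (simp add: fun_interp_N)
qed

lemma eval_tm_N:
  assumes v: "\<And>k. v k \<in> seqs" and "wf_tm L t"
  shows "(\<lambda>\<xi>. eval_tm M (\<lambda>k. v k \<xi>) t) \<in> seqs \<and>
    eval_tm N (\<lambda>k. cls (v k)) t = cls (\<lambda>\<xi>. eval_tm M (\<lambda>k. v k \<xi>) t)"
  using assms(2)
proof (induction t)
  case (Fn f ts)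
  let ?fs = "map (\<lambda>t \<xi>. eval_tm M (\<lambda>k. v k \<xi>) t) ts"
  have wf: "f \<in> fun_syms L" "length ?fs = fun_arity L f" "\<And>t. t \<in> set ts \<Longrightarrow> wf_tm L t" using Fn.prems by simp_all
  have fs: "set ?fs \<subseteq> seqs" using Fn.IH wf(3) by auto
  have "map (eval_tm N (\<lambda>k. cls (v k))) ts = map cls ?fs" using Fn.IH wf(3) by simp
  then have "eval_tm N (\<lambda>k. cls (v k)) (Fn f ts) = cls (\<lambda>\<xi>. fun_interp M f (map (\<lambda>f. f \<xi>) ?fs))"
    using fun_interp_N[OF fs] by (simp only: eval_tm.simps)
  moreover have "(\<lambda>\<xi>. fun_interp M f (map (\<lambda>f. f \<xi>) ?fs)) \<in> seqs"
    by (rule fun_interp_seqs[OF wf(1) fs wf(2)])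
  moreover have "map (\<lambda>f. f \<xi>) ?fs = map (eval_tm M (\<lambda>k. v k \<xi>)) ts" for \<xi> by simp
  ultimately show ?case by (simp only: eval_tm.simps simp_thms)
qed (use v in simp)

theorem Los:
  assumes v: "\<And>k. v k \<in> seqs" and "wf_fm L \<phi>"
  shows "sat N (\<lambda>k. cls (v k)) \<phi> \<longleftrightarrow> ae (\<lambda>\<xi>. sat M (\<lambda>k. v k \<xi>) \<phi>)"
  using assms
proof (induction \<phi> arbitrary: v)
  case (FEq s t)
  then show ?case using eval_tm_N[of v s] eval_tm_N[of v t] by (simp add: cls_eq_iff)
next
  case (FRel p ts)
  let ?fs = "map (\<lambda>t \<xi>. eval_tm M (\<lambda>k. v k \<xi>) t) ts"
  have e: "(\<lambda>\<xi>. eval_tm M (\<lambda>k. v k \<xi>) t) \<in> seqs"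
    "eval_tm N (\<lambda>k. cls (v k)) t = cls (\<lambda>\<xi>. eval_tm M (\<lambda>k. v k \<xi>) t)" if "t \<in> set ts" for t
    using eval_tm_N[of v t] FRel that by simp_all
  have fs: "set ?fs \<subseteq> seqs" using e(1) by auto
  have "map (eval_tm N (\<lambda>k. cls (v k))) ts = map cls ?fs" using e(2) by simp
  then have "sat N (\<lambda>k. cls (v k)) (FRel p ts) \<longleftrightarrow> ae (\<lambda>\<xi>. map (\<lambda>f. f \<xi>) ?fs \<in> rel_interp M p)"
    using rel_interp_N[OF fs] by (simp only: sat.simps)
  moreover have "map (\<lambda>f. f \<xi>) ?fs = map (eval_tm M (\<lambda>k. v k \<xi>)) ts" for \<xi> by simp
  ultimately show ?case by (simp only: sat.simps)
next
  case (FNot \<phi>)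
  have "sat N (\<lambda>k. cls (v k)) \<phi> \<longleftrightarrow> ae (\<lambda>\<xi>. sat M (\<lambda>k. v k \<xi>) \<phi>)" by (rule FNot.IH) (use FNot.prems in simp_all)
  then show ?case by (simp add: ae_not)
next
  case (FAnd \<phi> \<psi>)
  have "sat N (\<lambda>k. cls (v k)) \<phi> \<longleftrightarrow> ae (\<lambda>\<xi>. sat M (\<lambda>k. v k \<xi>) \<phi>)" by (rule FAnd.IH) (use FAnd.prems in simp_all)
  moreover have "sat N (\<lambda>k. cls (v k)) \<psi> \<longleftrightarrow> ae (\<lambda>\<xi>. sat M (\<lambda>k. v k \<xi>) \<psi>)" by (rule FAnd.IH) (use FAnd.prems in simp_all)
  ultimately show ?case by (simp add: ae_conj)
next
  case (FEx x \<phi>)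
  have upd: "sat N ((\<lambda>k. cls (v k))(x := cls f)) \<phi> \<longleftrightarrow> ae (\<lambda>\<xi>. sat M ((\<lambda>k. v k \<xi>)(x := f \<xi>)) \<phi>)"
    if "f \<in> seqs" for f
  proof -
    have "sat N (\<lambda>k. cls ((v(x := f)) k)) \<phi> \<longleftrightarrow> ae (\<lambda>\<xi>. sat M (\<lambda>k. (v(x := f)) k \<xi>) \<phi>)"
      by (rule FEx.IH) (use FEx.prems that in simp_all)
    moreover have "(\<lambda>k. cls ((v(x := f)) k)) = (\<lambda>k. cls (v k))(x := cls f)"
      "(\<lambda>k. (v(x := f)) k \<xi>) = (\<lambda>k. v k \<xi>)(x := f \<xi>)" for \<xi> by (simp_all add: fun_eq_iff)
    ultimately show ?thesis by simp
  qed
  have ne: "universe M \<noteq> {}" using struct unfolding is_structure_def by blast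
  have "sat N (\<lambda>k. cls (v k)) (FEx x \<phi>) \<longleftrightarrow> (\<exists>f\<in>seqs. sat N ((\<lambda>k. cls (v k))(x := cls f)) \<phi>)"
    by (simp add: universe_N)
  also have "\<dots> \<longleftrightarrow> (\<exists>f\<in>seqs. ae (\<lambda>\<xi>. sat M ((\<lambda>k. v k \<xi>)(x := f \<xi>)) \<phi>))" using upd by blast
  \<comment> \<open>Witnesses at almost all indices are glued into one sequence.\<close>
  also have "\<dots> \<longleftrightarrow> ae (\<lambda>\<xi>. \<exists>a\<in>universe M. sat M ((\<lambda>k. v k \<xi>)(x := a)) \<phi>)"
    unfolding ae_bex[OF ne] seqs_def by blast
  finally show ?case by simp
qed

lemma extension_N:
  assumes fs: "set fs \<subseteq> seqs" "length fs = m" and \<phi>: "is_formula L m \<phi>"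
  shows "map cls fs \<in> extension N m \<phi> \<longleftrightarrow> ae (\<lambda>\<xi>. map (\<lambda>f. f \<xi>) fs \<in> extension M m \<phi>)"
proof -
  obtain a where a: "a \<in> universe M" using struct unfolding is_structure_def by blast
  \<comment> \<open>\<open>Los\<close> wants sequences for all variables; beyond the arity a
    constant sequence serves as a default.\<close>
  define v where "v k = (if k < m then fs ! k else (\<lambda>\<xi>. a))" for k
  have v: "v k \<in> seqs" for k using fs a unfolding v_def by (auto simp: seqs_iff subset_iff)
  have bound: "k < m" if "k \<in> fv_fm \<phi>" for k using \<phi> that unfolding is_formula_def by blast
  have "sat N (nth (map cls fs)) \<phi> = sat N (\<lambda>k. cls (v k)) \<phi>"
    by (rule sat_cong) (use bound fs in \<open>simp add: v_def\<close>)
  moreover have "sat M (nth (map (\<lambda>f. f \<xi>) fs)) \<phi> = sat M (\<lambda>k. v k \<xi>) \<phi>" for \<xi>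
    by (rule sat_cong) (use bound fs in \<open>simp add: v_def\<close>)
  moreover have "map cls fs \<in> nlists m (universe N)" using fs unfolding universe_N by (intro nlistsI) auto
  moreover have "map (\<lambda>f. f \<xi>) fs \<in> nlists m (universe M)" for \<xi> using map_seqs_nlists[OF fs(1)] fs(2) by blast
  moreover have "wf_fm L \<phi>" using \<phi> unfolding is_formula_def by blast
  ultimately show ?thesis using Los[OF v, of \<phi>] unfolding extension_def by simp
qed

end

section \<open>Coordinate geometries over ultrapowers\<close>

locale ultrapower_of_field = ultrapower_of U L F
  for U :: "'i set set" and L :: "('f field_fun, 'p field_rel) language"
    and F :: "('f field_fun, 'p field_rel, 'a) struct" +
  fixes c :: field_case and d :: nat
  assumes expands: "expands c L F"
begin

abbreviation R :: "'a ring" where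
  "R \<equiv> reduct_ring F"

abbreviation RN :: "('i \<Rightarrow> 'a) set ring" where
  "RN \<equiv> reduct_ring N"

lemma field_R: "field R"
  using expands unfolding expands_def ordered_field_def by (cases c) auto

sublocale R: field R
  by (rule field_R)

lemma carrier_R: "carrier R = universe F"
  and carrier_RN [simp]: "carrier RN = cls ` seqs"
  by (simp_all add: reduct_ring_def universe_N)

lemma seqs_R:
  "f \<in> seqs \<Longrightarrow> g \<in> seqs \<Longrightarrow> (\<lambda>\<xi>. f \<xi> \<otimes>\<^bsub>R\<^esub> g \<xi>) \<in> seqs"
  "f \<in> seqs \<Longrightarrow> g \<in> seqs \<Longrightarrow> (\<lambda>\<xi>. f \<xi> \<oplus>\<^bsub>R\<^esub> g \<xi>) \<in> seqs"
  "f \<in> seqs \<Longrightarrow> g \<in> seqs \<Longrightarrow> (\<lambda>\<xi>. f \<xi> \<ominus>\<^bsub>R\<^esub> g \<xi>) \<in> seqs"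
  "f \<in> seqs \<Longrightarrow> (\<lambda>\<xi>. \<ominus>\<^bsub>R\<^esub> f \<xi>) \<in> seqs"
  "(\<lambda>\<xi>. \<one>\<^bsub>R\<^esub>) \<in> seqs" "(\<lambda>\<xi>. \<zero>\<^bsub>R\<^esub>) \<in> seqs"
  unfolding seqs_iff carrier_R[symmetric] by simp_all

lemma mult_RN:
  assumes "f \<in> seqs" "g \<in> seqs"
  shows "cls f \<otimes>\<^bsub>RN\<^esub> cls g = cls (\<lambda>\<xi>. f \<xi> \<otimes>\<^bsub>R\<^esub> g \<xi>)"
  using fun_interp_N[of "[f, g]" MulSym] assms by (simp add: reduct_ring_def)

lemma add_RN:
  assumes "f \<in> seqs" "g \<in> seqs"
  shows "cls f \<oplus>\<^bsub>RN\<^esub> cls g = cls (\<lambda>\<xi>. f \<xi> \<oplus>\<^bsub>R\<^esub> g \<xi>)"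
  using fun_interp_N[of "[f, g]" AddSym] assms by (simp add: reduct_ring_def)

lemma one_RN: "\<one>\<^bsub>RN\<^esub> = cls (\<lambda>\<xi>. \<one>\<^bsub>R\<^esub>)"
  using fun_interp_N[of "[]" OneSym] by (simp add: reduct_ring_def)

lemma zero_RN: "\<zero>\<^bsub>RN\<^esub> = cls (\<lambda>\<xi>. \<zero>\<^bsub>R\<^esub>)"
  using fun_interp_N[of "[]" ZeroSym] by (simp add: reduct_ring_def)

lemma seqs_in: "f \<in> seqs \<Longrightarrow> f \<xi> \<in> carrier R"
  by (simp add: seqs_iff carrier_R)

text \<open>Finite sums and additive inverses in the ultrapower can be computed on representatives
  once its addition is known to form an abelian group.\<close>

sublocale RN: abelian_group RN
proof (rule abelian_groupI)
  fix x y assume "x \<in> carrier RN" "y \<in> carrier RN"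
  then obtain f g where fg: "f \<in> seqs" "g \<in> seqs" "x = cls f" "y = cls g" by auto
  show "x \<oplus>\<^bsub>RN\<^esub> y \<in> carrier RN" using fg seqs_R(2) by (simp add: add_RN)
  show "x \<oplus>\<^bsub>RN\<^esub> y = y \<oplus>\<^bsub>RN\<^esub> x"
    using fg R.a_comm[OF seqs_in seqs_in] by (simp add: add_RN)
  fix z assume "z \<in> carrier RN"
  then obtain h where h: "h \<in> seqs" "z = cls h" by auto
  show "x \<oplus>\<^bsub>RN\<^esub> y \<oplus>\<^bsub>RN\<^esub> z = x \<oplus>\<^bsub>RN\<^esub> (y \<oplus>\<^bsub>RN\<^esub> z)"
    using fg h R.a_assoc[OF seqs_in seqs_in seqs_in] seqs_R(2) by (simp add: add_RN)
next
  fix x assume "x \<in> carrier RN"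
  then obtain f where f: "f \<in> seqs" "x = cls f" by auto
  show "\<zero>\<^bsub>RN\<^esub> \<oplus>\<^bsub>RN\<^esub> x = x"
    using f R.l_zero[OF seqs_in] seqs_R(6) by (simp add: add_RN zero_RN)
  have "cls (\<lambda>\<xi>. \<ominus>\<^bsub>R\<^esub> f \<xi>) \<oplus>\<^bsub>RN\<^esub> x = \<zero>\<^bsub>RN\<^esub>"
    using f R.l_neg[OF seqs_in] seqs_R(4) by (simp add: add_RN zero_RN)
  then show "\<exists>y\<in>carrier RN. y \<oplus>\<^bsub>RN\<^esub> x = \<zero>\<^bsub>RN\<^esub>"
    using f seqs_R(4) by (intro bexI[of _ "cls (\<lambda>\<xi>. \<ominus>\<^bsub>R\<^esub> f \<xi>)"]) simp_all
qed (simp add: zero_RN seqs_R)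

text \<open>Negation is derived from addition and is no component of the ring record, so its
  representative is found through the uniqueness of additive inverses.\<close>

lemma minus_RN:
  assumes "f \<in> seqs" "g \<in> seqs"
  shows "cls f \<ominus>\<^bsub>RN\<^esub> cls g = cls (\<lambda>\<xi>. f \<xi> \<ominus>\<^bsub>R\<^esub> g \<xi>)"
proof -
  have "cls (\<lambda>\<xi>. \<ominus>\<^bsub>R\<^esub> g \<xi>) \<oplus>\<^bsub>RN\<^esub> cls g = \<zero>\<^bsub>RN\<^esub>"
    using assms R.l_neg[OF seqs_in] seqs_R(4) by (simp add: add_RN zero_RN)
  then have "\<ominus>\<^bsub>RN\<^esub> cls g = cls (\<lambda>\<xi>. \<ominus>\<^bsub>R\<^esub> g \<xi>)"
    using assms seqs_R(4) by (intro RN.minus_equality) simp_all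
  then show ?thesis using assms seqs_R(4) by (simp add: a_minus_def add_RN)
qed

lemma finsum_seqs:
  assumes "\<And>j. j \<in> A \<Longrightarrow> f j \<in> seqs"
  shows "(\<lambda>\<xi>. \<Oplus>\<^bsub>R\<^esub>j\<in>A. f j \<xi>) \<in> seqs"
  unfolding seqs_iff carrier_R[symmetric]
  by (intro allI R.finsum_closed Pi_I) (use assms seqs_in in blast)

lemma finsum_RN:
  assumes "finite A" "\<And>j. j \<in> A \<Longrightarrow> f j \<in> seqs"
  shows "(\<Oplus>\<^bsub>RN\<^esub>j\<in>A. cls (f j)) = cls (\<lambda>\<xi>. \<Oplus>\<^bsub>R\<^esub>j\<in>A. f j \<xi>)"
  using assms
proof (induction A rule: finite_induct)
  case empty
  then show ?case by (simp add: zero_RN)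
next
  case (insert x A)
  have 1: "(\<Oplus>\<^bsub>RN\<^esub>j\<in>insert x A. cls (f j)) = cls (f x) \<oplus>\<^bsub>RN\<^esub> (\<Oplus>\<^bsub>RN\<^esub>j\<in>A. cls (f j))"
    using insert by (intro RN.finsum_insert) auto
  have 2: "(\<Oplus>\<^bsub>R\<^esub>j\<in>insert x A. f j \<xi>) = f x \<xi> \<oplus>\<^bsub>R\<^esub> (\<Oplus>\<^bsub>R\<^esub>j\<in>A. f j \<xi>)" for \<xi>
    using insert seqs_in by (intro R.finsum_insert) auto
  have "cls (f x) \<oplus>\<^bsub>RN\<^esub> cls (\<lambda>\<xi>. \<Oplus>\<^bsub>R\<^esub>j\<in>A. f j \<xi>) = cls (\<lambda>\<xi>. f x \<xi> \<oplus>\<^bsub>R\<^esub> (\<Oplus>\<^bsub>R\<^esub>j\<in>A. f j \<xi>))"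
    using insert.prems finsum_seqs[of A f] by (intro add_RN) auto
  then show ?case unfolding 1 2 using insert by simp
qed

section \<open>Points of the ultrapower as classes of sequences of points\<close>

definition pts :: "('i \<Rightarrow> 'a list) set" where
  "pts = {f. range f \<subseteq> points F d}"

text \<open>On representatives, this is the identification of the ultrapower of F^d with the d-th
  power of the ultrapower of F.\<close>

definition pt :: "('i \<Rightarrow> 'a list) \<Rightarrow> ('i \<Rightarrow> 'a) set list" where
  "pt f = map (\<lambda>j. cls (\<lambda>\<xi>. f \<xi> ! j)) [0..<d]"

lemma pts_iff: "f \<in> pts \<longleftrightarrow> (\<forall>\<xi>. f \<xi> \<in> points F d)"
  unfolding pts_def by auto

lemma pts_length: "f \<in> pts \<Longrightarrow> length (f \<xi>) = d"
  unfolding pts_iff points_def using nlistsE_length by blast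

lemma pts_coord: "f \<in> pts \<Longrightarrow> j < d \<Longrightarrow> (\<lambda>\<xi>. f \<xi> ! j) \<in> seqs"
  unfolding pts_iff points_def seqs_iff using nlistsE_nth_in by blast

lemma pt_nth: "j < d \<Longrightarrow> pt f ! j = cls (\<lambda>\<xi>. f \<xi> ! j)"
  by (simp add: pt_def)

lemma pt_closed: "f \<in> pts \<Longrightarrow> pt f \<in> points N d"
  unfolding points_def universe_N by (intro nlistsI) (auto simp: pt_def pts_coord)

lemma points_N: "points N d = pt ` pts"
proof
  show "points N d \<subseteq> pt ` pts"
  proof
    fix x assume "x \<in> points N d"
    then obtain fs where fs: "set fs \<subseteq> seqs" "length fs = d" "x = map cls fs"
      using nlists_cls unfolding points_def by blast
    let ?f = "\<lambda>\<xi>. map (\<lambda>g. g \<xi>) fs"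
    have "?f \<in> pts" unfolding pts_iff points_def using map_seqs_nlists[OF fs(1)] fs(2) by blast
    moreover have "x = pt ?f" using fs by (intro nth_equalityI) (simp_all add: pt_def)
    ultimately show "x \<in> pt ` pts" by blast
  qed
qed (use pt_closed in blast)

lemma pt_eq_iff:
  assumes "f \<in> pts" "g \<in> pts"
  shows "pt f = pt g \<longleftrightarrow> ae (\<lambda>\<xi>. f \<xi> = g \<xi>)"
proof -
  have "pt f = pt g \<longleftrightarrow> (\<forall>j<d. cls (\<lambda>\<xi>. f \<xi> ! j) = cls (\<lambda>\<xi>. g \<xi> ! j))"
    unfolding pt_def by (auto simp: list_eq_iff_nth_eq)
  also have "\<dots> \<longleftrightarrow> ae (\<lambda>\<xi>. \<forall>j<d. f \<xi> ! j = g \<xi> ! j)"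
    using assms by (simp add: ae_all_less cls_eq_iff pts_coord)
  also have "(\<lambda>\<xi>. \<forall>j<d. f \<xi> ! j = g \<xi> ! j) = (\<lambda>\<xi>. f \<xi> = g \<xi>)"
    using assms by (simp add: list_eq_iff_nth_eq pts_length)
  finally show ?thesis .
qed

text \<open>On m-tuples and under the identification by \<open>pt\<close>, \<open>S'\<close> is the
  ultrapower of the relation S.\<close>

definition transfers :: "nat \<Rightarrow> ('i \<Rightarrow> 'a) set list list set \<Rightarrow> 'a list list set \<Rightarrow> bool" where
  "transfers m S' S \<longleftrightarrow> (\<forall>fs. set fs \<subseteq> pts \<longrightarrow> length fs = m \<longrightarrow>
     (map pt fs \<in> S' \<longleftrightarrow> ae (\<lambda>\<xi>. map (\<lambda>f. f \<xi>) fs \<in> S)))"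

lemma map_pts_nlists: "set fs \<subseteq> pts \<Longrightarrow> map (\<lambda>f. f \<xi>) fs \<in> nlists (length fs) (points F d)"
  by (intro nlistsI) (auto simp: pts_iff)

lemma map_pt_nlists: "set fs \<subseteq> pts \<Longrightarrow> map pt fs \<in> nlists (length fs) (points N d)"
  by (intro nlistsI) (auto simp: points_N)

lemma nlists_pt:
  assumes "xs \<in> nlists m (points N d)"
  shows "\<exists>fs. set fs \<subseteq> pts \<and> length fs = m \<and> xs = map pt fs"
proof -
  have "xs \<in> lists (pt ` pts)" using nlistsE_set[OF assms] unfolding points_N lists_eq_set by simp
  then obtain fs where "fs \<in> lists pts" "xs = map pt fs" unfolding lists_image by blast
  then show ?thesis using nlistsE_length[OF assms] unfolding lists_eq_set by (intro exI[of _ fs]) simp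
qed

lemma transfers_point_extension:
  assumes "is_formula L (d * m) \<phi>"
  shows "transfers m (point_extension N d m \<phi>) (point_extension F d m \<phi>)"
  unfolding transfers_def
proof (intro allI impI)
  fix fs assume fs: "set fs \<subseteq> pts" "length fs = m"
  define gs where "gs = concat (map (\<lambda>f. map (\<lambda>j \<xi>. f \<xi> ! j) [0..<d]) fs)"
  have gs: "set gs \<subseteq> seqs" using fs(1) pts_coord unfolding gs_def by auto
  have len: "length gs = d * m"
    using fs(2) unfolding gs_def by (simp add: length_concat comp_def sum_list_triv)
  have "concat (map pt fs) = map cls gs"
    unfolding gs_def map_concat by (simp add: pt_def[abs_def] comp_def)
  moreover have "map (\<lambda>g. g \<xi>) gs = concat (map (\<lambda>f. f \<xi>) fs)" for \<xi>
  proof -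
    have "map (\<lambda>j. f \<xi> ! j) [0..<d] = f \<xi>" if "f \<in> set fs" for f
      using that fs(1) pts_length[of f \<xi>] map_nth[of "f \<xi>"] by auto
    then show ?thesis unfolding gs_def map_concat by (simp add: comp_def cong: map_cong)
  qed
  ultimately show "map pt fs \<in> point_extension N d m \<phi> \<longleftrightarrow> ae (\<lambda>\<xi>. map (\<lambda>f. f \<xi>) fs \<in> point_extension F d m \<phi>)"
    using extension_N[OF gs len assms] map_pts_nlists[OF fs(1)] map_pt_nlists[OF fs(1)] fs(2)
    unfolding point_extension_def by simp
qed

lemma on_line_N:
  assumes "t \<in> seqs" "f \<in> pts" "g \<in> pts" "h \<in> pts"
  shows "on_line RN d (cls t) (pt f) (pt g) (pt h) \<longleftrightarrow> ae (\<lambda>\<xi>. on_line R d (t \<xi>) (f \<xi>) (g \<xi>) (h \<xi>))"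
  unfolding on_line_def ae_all_less
proof (intro all_cong)
  fix i assume i: "i < d"
  let ?l = "\<lambda>\<xi>. (\<one>\<^bsub>R\<^esub> \<ominus>\<^bsub>R\<^esub> t \<xi>) \<otimes>\<^bsub>R\<^esub> f \<xi> ! i \<oplus>\<^bsub>R\<^esub> t \<xi> \<otimes>\<^bsub>R\<^esub> h \<xi> ! i"
  have f: "(\<lambda>\<xi>. f \<xi> ! i) \<in> seqs" and h: "(\<lambda>\<xi>. h \<xi> ! i) \<in> seqs" and g: "(\<lambda>\<xi>. g \<xi> ! i) \<in> seqs"
    using assms i pts_coord by blast+
  have s: "(\<lambda>\<xi>. \<one>\<^bsub>R\<^esub> \<ominus>\<^bsub>R\<^esub> t \<xi>) \<in> seqs" by (rule seqs_R(3)[OF seqs_R(5) assms(1)])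
  have "(\<one>\<^bsub>RN\<^esub> \<ominus>\<^bsub>RN\<^esub> cls t) \<otimes>\<^bsub>RN\<^esub> pt f ! i \<oplus>\<^bsub>RN\<^esub> cls t \<otimes>\<^bsub>RN\<^esub> pt h ! i = cls ?l"
    unfolding one_RN minus_RN[OF seqs_R(5) assms(1)] pt_nth[OF i] mult_RN[OF s f] mult_RN[OF assms(1) h]
    by (rule add_RN[OF seqs_R(1)[OF s f] seqs_R(1)[OF assms(1) h]])
  moreover have "?l \<in> seqs" by (rule seqs_R(2)[OF seqs_R(1)[OF s f] seqs_R(1)[OF assms(1) h]])
  ultimately show "(pt g ! i = (\<one>\<^bsub>RN\<^esub> \<ominus>\<^bsub>RN\<^esub> cls t) \<otimes>\<^bsub>RN\<^esub> pt f ! i \<oplus>\<^bsub>RN\<^esub> cls t \<otimes>\<^bsub>RN\<^esub> pt h ! i) \<longleftrightarrow>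
    ae (\<lambda>\<xi>. g \<xi> ! i = ?l \<xi>)"
    using g by (simp add: pt_nth[OF i] cls_eq_iff)
qed

lemma struct_less_N:
  assumes "f \<in> seqs" "g \<in> seqs"
  shows "struct_less N (cls f) (cls g) \<longleftrightarrow> ae (\<lambda>\<xi>. struct_less F (f \<xi>) (g \<xi>))"
  using rel_interp_N[of "[f, g]" LessSym] assms unfolding struct_less_def by simp

lemma bex_N:
  assumes "\<And>t. t \<in> seqs \<Longrightarrow> P (cls t) \<longleftrightarrow> ae (\<lambda>\<xi>. Q (t \<xi>) \<xi>)"
  shows "(\<exists>t\<in>universe N. P t) \<longleftrightarrow> ae (\<lambda>\<xi>. \<exists>t\<in>universe F. Q t \<xi>)"
proof -
  have ne: "universe F \<noteq> {}" using struct unfolding is_structure_def by blast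
  have "(\<exists>t\<in>universe N. P t) \<longleftrightarrow> (\<exists>t\<in>seqs. ae (\<lambda>\<xi>. Q (t \<xi>) \<xi>))"
    using assms unfolding universe_N by simp
  then show ?thesis unfolding ae_bex[OF ne] seqs_def by simp
qed

text \<open>The key relation is given directly and not by a formula, so it is transferred through
  the rules for \<open>ae\<close>; its only quantifier, over the ratio t, is handled by
  \<open>bex_N\<close>.\<close>

lemma transfers_key_rel: "transfers 3 (key_rel c N d) (key_rel c F d)"
  unfolding transfers_def
proof (intro allI impI)
  fix fs assume fs: "set fs \<subseteq> pts" "length fs = 3"
  then obtain f g h where fgh: "fs = [f, g, h]" by (auto simp: length_Suc_conv numeral_3_eq_3)
  have p: "f \<in> pts" "g \<in> pts" "h \<in> pts" using fs(1) fgh by auto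
  have points: "f \<xi> \<in> points F d" "g \<xi> \<in> points F d" "h \<xi> \<in> points F d" for \<xi> using p pts_iff by blast+
  show "map pt fs \<in> key_rel c N d \<longleftrightarrow> ae (\<lambda>\<xi>. map (\<lambda>f. f \<xi>) fs \<in> key_rel c F d)"
  proof (cases c)
    case Ordered_Field_Case
    have "(\<exists>t\<in>universe N. (struct_less N \<zero>\<^bsub>RN\<^esub> t \<or> \<zero>\<^bsub>RN\<^esub> = t) \<and> (struct_less N t \<one>\<^bsub>RN\<^esub> \<or> t = \<one>\<^bsub>RN\<^esub>) \<and>
        on_line RN d t (pt f) (pt g) (pt h)) \<longleftrightarrow>
      ae (\<lambda>\<xi>. \<exists>t\<in>universe F. (struct_less F \<zero>\<^bsub>R\<^esub> t \<or> \<zero>\<^bsub>R\<^esub> = t) \<and> (struct_less F t \<one>\<^bsub>R\<^esub> \<or> t = \<one>\<^bsub>R\<^esub>) \<and>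
        on_line R d t (f \<xi>) (g \<xi>) (h \<xi>))"
      by (rule bex_N)
        (use p seqs_R(5,6) in \<open>simp add: zero_RN one_RN struct_less_N cls_eq_iff on_line_N ae_conj ae_disj\<close>)
    then show ?thesis
      unfolding Ordered_Field_Case fgh by (simp add: Bw_def points pt_closed p)
  next
    case Field_Case
    have "(\<exists>t\<in>universe N. on_line RN d t (pt f) (pt g) (pt h)) \<longleftrightarrow>
      ae (\<lambda>\<xi>. \<exists>t\<in>universe F. on_line R d t (f \<xi>) (g \<xi>) (h \<xi>))"
      by (rule bex_N) (use p on_line_N in simp)
    then show ?thesis
      unfolding Field_Case fgh by (simp add: Col_def points pt_closed p pt_eq_iff ae_disj)
  qed
qed

section \<open>Affine maps and affine automorphisms over the ultrapower\<close>

lemma affine_map_pts: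
  assumes "\<And>i j. i < d \<Longrightarrow> j < d \<Longrightarrow> A i j \<in> seqs" "b \<in> pts" "f \<in> pts"
  shows "(\<lambda>\<xi>. affine_map R d (\<lambda>i j. A i j \<xi>) (b \<xi>) (f \<xi>)) \<in> pts"
    and "affine_map RN d (\<lambda>i j. cls (A i j)) (pt b) (pt f) = pt (\<lambda>\<xi>. affine_map R d (\<lambda>i j. A i j \<xi>) (b \<xi>) (f \<xi>))"
proof -
  have prod: "(\<lambda>\<xi>. A i j \<xi> \<otimes>\<^bsub>R\<^esub> f \<xi> ! j) \<in> seqs" if "i < d" "j < d" for i j
    by (rule seqs_R(1)[OF assms(1)[OF that] pts_coord[OF assms(3) that(2)]])
  define row where "row i \<xi> = (\<Oplus>\<^bsub>R\<^esub>j\<in>{..<d}. A i j \<xi> \<otimes>\<^bsub>R\<^esub> f \<xi> ! j) \<oplus>\<^bsub>R\<^esub> b \<xi> ! i" for i \<xi>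
  have sum: "(\<lambda>\<xi>. \<Oplus>\<^bsub>R\<^esub>j\<in>{..<d}. A i j \<xi> \<otimes>\<^bsub>R\<^esub> f \<xi> ! j) \<in> seqs" if "i < d" for i
    by (rule finsum_seqs) (use prod that in simp)
  have row: "row i \<in> seqs" if "i < d" for i
    unfolding row_def by (rule seqs_R(2)[OF sum[OF that] pts_coord[OF assms(2) that]])
  have eval: "affine_map R d (\<lambda>i j. A i j \<xi>) (b \<xi>) (f \<xi>) = map (\<lambda>i. row i \<xi>) [0..<d]" for \<xi>
    using assms(3) unfolding affine_map_def row_def by (simp add: pts_iff points_def carrier_R)
  show "(\<lambda>\<xi>. affine_map R d (\<lambda>i j. A i j \<xi>) (b \<xi>) (f \<xi>)) \<in> pts"
    unfolding eval pts_iff points_def using row by (intro allI nlistsI) (auto simp: seqs_iff)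
  have "(\<Oplus>\<^bsub>RN\<^esub>j\<in>{..<d}. cls (A i j) \<otimes>\<^bsub>RN\<^esub> pt f ! j) \<oplus>\<^bsub>RN\<^esub> pt b ! i = cls (row i)" if i: "i < d" for i
  proof -
    have "(\<Oplus>\<^bsub>RN\<^esub>j\<in>{..<d}. cls (A i j) \<otimes>\<^bsub>RN\<^esub> pt f ! j) =
      (\<Oplus>\<^bsub>RN\<^esub>j\<in>{..<d}. cls (\<lambda>\<xi>. A i j \<xi> \<otimes>\<^bsub>R\<^esub> f \<xi> ! j))"
      by (rule RN.finsum_cong') (use prod i assms(1,3) in \<open>auto simp: pt_nth mult_RN pts_coord\<close>)
    also have "\<dots> = cls (\<lambda>\<xi>. \<Oplus>\<^bsub>R\<^esub>j\<in>{..<d}. A i j \<xi> \<otimes>\<^bsub>R\<^esub> f \<xi> ! j)"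
      by (rule finsum_RN) (use prod i in simp_all)
    finally show ?thesis
      unfolding row_def using add_RN[OF sum[OF i] pts_coord[OF assms(2) i]] by (simp add: pt_nth[OF i])
  qed
  moreover have "pt f \<in> nlists d (carrier RN)"
    using pt_closed[OF assms(3)] unfolding points_def universe_N by simp
  ultimately have "affine_map RN d (\<lambda>i j. cls (A i j)) (pt b) (pt f) = map (\<lambda>i. cls (row i)) [0..<d]"
    unfolding affine_map_def by simp
  also have "\<dots> = pt (\<lambda>\<xi>. map (\<lambda>i. row i \<xi>) [0..<d])" by (simp add: pt_def)
  finally show "affine_map RN d (\<lambda>i j. cls (A i j)) (pt b) (pt f) =
      pt (\<lambda>\<xi>. affine_map R d (\<lambda>i j. A i j \<xi>) (b \<xi>) (f \<xi>))"
    unfolding eval .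
qed

lemma inverse_matrices_RN:
  assumes A: "\<And>i j. i < d \<Longrightarrow> j < d \<Longrightarrow> A i j \<in> seqs" "\<And>i j. i < d \<Longrightarrow> j < d \<Longrightarrow> A' i j = cls (A i j)"
    and B: "\<And>i j. i < d \<Longrightarrow> j < d \<Longrightarrow> B i j \<in> seqs" "\<And>i j. i < d \<Longrightarrow> j < d \<Longrightarrow> B' i j = cls (B i j)"
  shows "inverse_matrices RN d A' B' \<longleftrightarrow> ae (\<lambda>\<xi>. inverse_matrices R d (\<lambda>i j. A i j \<xi>) (\<lambda>i j. B i j \<xi>))"
proof -
  have entry: "((\<Oplus>\<^bsub>RN\<^esub>l\<in>{..<d}. X' i l \<otimes>\<^bsub>RN\<^esub> Y' l j) = (if i = j then \<one>\<^bsub>RN\<^esub> else \<zero>\<^bsub>RN\<^esub>)) \<longleftrightarrow>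
      ae (\<lambda>\<xi>. (\<Oplus>\<^bsub>R\<^esub>l\<in>{..<d}. X i l \<xi> \<otimes>\<^bsub>R\<^esub> Y l j \<xi>) = (if i = j then \<one>\<^bsub>R\<^esub> else \<zero>\<^bsub>R\<^esub>))"
    if X: "\<And>i j. i < d \<Longrightarrow> j < d \<Longrightarrow> X i j \<in> seqs" "\<And>i j. i < d \<Longrightarrow> j < d \<Longrightarrow> X' i j = cls (X i j)"
    and Y: "\<And>i j. i < d \<Longrightarrow> j < d \<Longrightarrow> Y i j \<in> seqs" "\<And>i j. i < d \<Longrightarrow> j < d \<Longrightarrow> Y' i j = cls (Y i j)"
    and ij: "i < d" "j < d" for X X' Y Y' i j
  proof -
    have prod: "(\<lambda>\<xi>. X i l \<xi> \<otimes>\<^bsub>R\<^esub> Y l j \<xi>) \<in> seqs" if "l < d" for l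
      by (rule seqs_R(1)[OF X(1)[OF ij(1) that] Y(1)[OF that ij(2)]])
    have "(\<Oplus>\<^bsub>RN\<^esub>l\<in>{..<d}. X' i l \<otimes>\<^bsub>RN\<^esub> Y' l j) = (\<Oplus>\<^bsub>RN\<^esub>l\<in>{..<d}. cls (\<lambda>\<xi>. X i l \<xi> \<otimes>\<^bsub>R\<^esub> Y l j \<xi>))"
      by (rule RN.finsum_cong') (use prod X Y ij in \<open>auto simp: mult_RN\<close>)
    also have "\<dots> = cls (\<lambda>\<xi>. \<Oplus>\<^bsub>R\<^esub>l\<in>{..<d}. X i l \<xi> \<otimes>\<^bsub>R\<^esub> Y l j \<xi>)"
      by (rule finsum_RN) (use prod in simp_all)
    finally have "(\<Oplus>\<^bsub>RN\<^esub>l\<in>{..<d}. X' i l \<otimes>\<^bsub>RN\<^esub> Y' l j) = cls (\<lambda>\<xi>. \<Oplus>\<^bsub>R\<^esub>l\<in>{..<d}. X i l \<xi> \<otimes>\<^bsub>R\<^esub> Y l j \<xi>)" .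
    moreover have "(\<lambda>\<xi>. \<Oplus>\<^bsub>R\<^esub>l\<in>{..<d}. X i l \<xi> \<otimes>\<^bsub>R\<^esub> Y l j \<xi>) \<in> seqs"
      by (rule finsum_seqs) (use prod in simp)
    ultimately show ?thesis using seqs_R(5,6) by (cases "i = j") (simp_all add: one_RN zero_RN cls_eq_iff)
  qed
  show ?thesis
    unfolding inverse_matrices_def ae_all_less ae_conj
    by (intro all_cong arg_cong2[where f = "(\<and>)"] entry A B)
qed

text \<open>Matrix entries with an index of d or more are arbitrary and may have no representatives,
  so \<open>A'\<close> agrees with the classes of A only below d.\<close>

lemma affine_map_RN_cong:
  assumes A: "\<And>i j. i < d \<Longrightarrow> j < d \<Longrightarrow> A i j \<in> seqs" "\<And>i j. i < d \<Longrightarrow> j < d \<Longrightarrow> A' i j = cls (A i j)"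
    and f: "f \<in> pts"
  shows "affine_map RN d A' b (pt f) = affine_map RN d (\<lambda>i j. cls (A i j)) b (pt f)"
proof -
  have "(\<Oplus>\<^bsub>RN\<^esub>j\<in>{..<d}. A' i j \<otimes>\<^bsub>RN\<^esub> pt f ! j) = (\<Oplus>\<^bsub>RN\<^esub>j\<in>{..<d}. cls (A i j) \<otimes>\<^bsub>RN\<^esub> pt f ! j)"
    if "i < d" for i
    by (rule RN.finsum_cong') (use A that f seqs_R(1) pts_coord in \<open>auto simp: pt_nth mult_RN\<close>)
  then show ?thesis unfolding affine_map_def by simp
qed

lemma points_nonempty: "points F d \<noteq> {}"
  using nlists_not_empty[of "universe F" d] struct unfolding points_def is_structure_def by blast

text \<open>Representatives of the matrix and of the translation vector give an affine map at every
  index. Injectivity, surjectivity, preservation of each of the finitely many relations and the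
  equations for the inverse matrix are finitely many statements, each of which carries over to
  almost all indices. It is here that the finiteness of the relational language enters.\<close>

lemma AffAut_pointwise:
  assumes transfers: "\<And>p. p \<in> rel_syms (geo_language k ar) \<Longrightarrow>
      transfers (rel_arity (geo_language k ar) p) (rel_interp (geometry c N d P') p) (rel_interp (geometry c F d P) p)"
    and \<alpha>: "\<alpha> \<in> AffAut c N d k ar P'"
  shows "\<exists>\<beta>. ae (\<lambda>\<xi>. \<beta> \<xi> \<in> AffAut c F d k ar P) \<and>
    (\<forall>f\<in>pts. (\<lambda>\<xi>. \<beta> \<xi> (f \<xi>)) \<in> pts \<and> \<alpha> (pt f) = pt (\<lambda>\<xi>. \<beta> \<xi> (f \<xi>)))"
proof -
  let ?L = "geo_language k ar"
  let ?G = "geometry c F d P" and ?G' = "geometry c N d P'"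
  have uG: "universe ?G = points F d" "universe ?G' = points N d" by (simp_all add: geometry_def)
  obtain A' b' where A': "A' \<in> GL RN d" "b' \<in> nlists d (carrier RN)" "\<alpha> = affine_map RN d A' b'"
    and Aut: "\<alpha> \<in> Aut ?L ?G'"
    using \<alpha> unfolding AffAut_def Aff_def by blast
  obtain B' where B': "\<forall>i<d. \<forall>j<d. B' i j \<in> carrier RN" "inverse_matrices RN d A' B'"
    using A'(1) unfolding GL_def by blast
  have "\<exists>X. (\<forall>i j. i < d \<longrightarrow> j < d \<longrightarrow> X i j \<in> seqs \<and> X' i j = cls (X i j))"
    if "\<forall>i<d. \<forall>j<d. X' i j \<in> carrier RN" for X'
  proof -
    have "\<exists>x. i < d \<longrightarrow> j < d \<longrightarrow> x \<in> seqs \<and> X' i j = cls x" for i j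
    proof (cases "i < d \<and> j < d")
      case True
      then have "X' i j \<in> cls ` seqs" using that by simp
      then show ?thesis by blast
    qed blast
    then show ?thesis by metis
  qed
  note reps = this
  have cA: "\<forall>i<d. \<forall>j<d. A' i j \<in> carrier RN" using A'(1) unfolding GL_def by simp
  obtain A where "\<forall>i j. i < d \<longrightarrow> j < d \<longrightarrow> A i j \<in> seqs \<and> A' i j = cls (A i j)"
    using reps[OF cA] by (elim exE)
  then have A: "A i j \<in> seqs" "A' i j = cls (A i j)" if "i < d" "j < d" for i j using that by simp_all
  obtain B where "\<forall>i j. i < d \<longrightarrow> j < d \<longrightarrow> B i j \<in> seqs \<and> B' i j = cls (B i j)"
    using reps[OF B'(1)] by (elim exE)
  then have B: "B i j \<in> seqs" "B' i j = cls (B i j)" if "i < d" "j < d" for i j using that by simp_all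
  have "b' \<in> points N d" using A'(2) unfolding points_def universe_N by simp
  then obtain b where b: "b \<in> pts" "b' = pt b" unfolding points_N by blast
  define \<beta> where "\<beta> \<xi> = affine_map R d (\<lambda>i j. A i j \<xi>) (b \<xi>)" for \<xi>
  have \<beta>: "(\<lambda>\<xi>. \<beta> \<xi> (f \<xi>)) \<in> pts" "\<alpha> (pt f) = pt (\<lambda>\<xi>. \<beta> \<xi> (f \<xi>))" if "f \<in> pts" for f
    using affine_map_pts[OF A(1) b(1) that] affine_map_RN_cong[OF A that] unfolding \<beta>_def A'(3) b(2) by simp_all
  \<comment> \<open>Tested on a constant sequence, since \<open>\<beta>(1)\<close> speaks of
    sequences of points.\<close>
  have \<beta>_closed: "\<beta> \<xi> x \<in> points F d" if "x \<in> points F d" for \<xi> x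
    using \<beta>(1)[of "\<lambda>_. x"] that unfolding pts_iff by blast
  have pts_all: "(\<forall>f. range f \<subseteq> points F d \<longrightarrow> Q f) \<longleftrightarrow> (\<forall>f\<in>pts. Q f)" for Q unfolding pts_def by blast
  have pts_ex: "(\<exists>f. range f \<subseteq> points F d \<and> Q f) \<longleftrightarrow> (\<exists>f\<in>pts. Q f)" for Q unfolding pts_def by blast
  have bij: "bij_betw \<alpha> (points N d) (points N d)" using Aut unfolding Aut_def Bij_def uG by blast
  have "ae (\<lambda>\<xi>. \<forall>x\<in>points F d. \<forall>y\<in>points F d. \<beta> \<xi> x = \<beta> \<xi> y \<longrightarrow> x = y)"
    unfolding ae_ball[OF points_nonempty] pts_all ae_imp
  proof (intro ballI impI)
    fix f g assume fg: "f \<in> pts" "g \<in> pts" and eq: "ae (\<lambda>\<xi>. \<beta> \<xi> (f \<xi>) = \<beta> \<xi> (g \<xi>))"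
    have "\<alpha> (pt f) = \<alpha> (pt g)" using eq fg \<beta> pt_eq_iff by simp
    then have "pt f = pt g" using bij pt_closed fg unfolding bij_betw_def by (blast dest: inj_onD)
    then show "ae (\<lambda>\<xi>. f \<xi> = g \<xi>)" using pt_eq_iff fg by simp
  qed
  moreover have "ae (\<lambda>\<xi>. \<forall>y\<in>points F d. \<exists>x\<in>points F d. y = \<beta> \<xi> x)"
    unfolding ae_ball[OF points_nonempty] ae_bex[OF points_nonempty] pts_all pts_ex
  proof
    fix g assume g: "g \<in> pts"
    then have "pt g \<in> \<alpha> ` pt ` pts" using bij pt_closed unfolding bij_betw_def points_N by blast
    then obtain f where "f \<in> pts" "pt g = \<alpha> (pt f)" by blast
    then show "\<exists>f\<in>pts. ae (\<lambda>\<xi>. g \<xi> = \<beta> \<xi> (f \<xi>))" using g \<beta> pt_eq_iff by auto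
  qed
  moreover have "ae (\<lambda>\<xi>. \<forall>p\<in>rel_syms ?L. \<forall>xs\<in>nlists (rel_arity ?L p) (points F d).
      xs \<in> rel_interp ?G p \<longleftrightarrow> map (\<beta> \<xi>) xs \<in> rel_interp ?G p)"
  proof -
    have fin: "finite (rel_syms ?L)" by (simp add: geo_language_def)
    have ne: "nlists m (points F d) \<noteq> {}" for m using nlists_not_empty[OF points_nonempty] by blast
    show ?thesis
      unfolding ae_ball_finite[OF fin] ae_ball[OF ne] ae_iff
    proof (intro ballI allI impI)
      fix p and X :: "'i \<Rightarrow> 'a list list"
      assume p: "p \<in> rel_syms ?L" and X: "range X \<subseteq> nlists (rel_arity ?L p) (points F d)"
      let ?m = "rel_arity ?L p"
      have len: "length (X \<xi>) = ?m" for \<xi> using X nlistsE_length by blast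
      \<comment> \<open>A sequence of tuples is turned into a tuple of sequences, the form required
        by \<open>transfers\<close>.\<close>
      define fs where "fs = map (\<lambda>i \<xi>. X \<xi> ! i) [0..<?m]"
      have "X \<xi> ! i \<in> points F d" if "i < ?m" for i \<xi> using X that nlistsE_nth_in by blast
      then have fs: "set fs \<subseteq> pts" "length fs = ?m" unfolding fs_def by (auto simp: pts_iff)
      have X_fs: "X \<xi> = map (\<lambda>f. f \<xi>) fs" for \<xi>
        unfolding fs_def using len[of \<xi>] map_nth[of "X \<xi>"] by (simp add: comp_def)
      define gs where "gs = map (\<lambda>f \<xi>. \<beta> \<xi> (f \<xi>)) fs"
      have gs: "set gs \<subseteq> pts" "length gs = ?m" using fs \<beta>(1) unfolding gs_def by auto
      have "map \<alpha> (map pt fs) = map pt gs" using fs(1) \<beta>(2) unfolding gs_def by auto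
      moreover have "map pt fs \<in> nlists ?m (points N d)" using map_pt_nlists[OF fs(1)] fs(2) by simp
      ultimately have "map pt fs \<in> rel_interp ?G' p \<longleftrightarrow> map pt gs \<in> rel_interp ?G' p"
        using Aut p unfolding Aut_def uG by auto
      moreover have "map (\<beta> \<xi>) (X \<xi>) = map (\<lambda>f. f \<xi>) gs" for \<xi> unfolding X_fs gs_def by simp
      ultimately show "ae (\<lambda>\<xi>. X \<xi> \<in> rel_interp ?G p) \<longleftrightarrow> ae (\<lambda>\<xi>. map (\<beta> \<xi>) (X \<xi>) \<in> rel_interp ?G p)"
        using transfers[OF p] fs gs unfolding transfers_def X_fs by simp
    qed
  qed
  moreover have "ae (\<lambda>\<xi>. inverse_matrices R d (\<lambda>i j. A i j \<xi>) (\<lambda>i j. B i j \<xi>))"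
    using inverse_matrices_RN[OF A B] B'(2) by simp
  ultimately have "ae (\<lambda>\<xi>. ((\<forall>x\<in>points F d. \<forall>y\<in>points F d. \<beta> \<xi> x = \<beta> \<xi> y \<longrightarrow> x = y) \<and>
      (\<forall>y\<in>points F d. \<exists>x\<in>points F d. y = \<beta> \<xi> x)) \<and>
      (\<forall>p\<in>rel_syms ?L. \<forall>xs\<in>nlists (rel_arity ?L p) (points F d).
        xs \<in> rel_interp ?G p \<longleftrightarrow> map (\<beta> \<xi>) xs \<in> rel_interp ?G p) \<and>
      inverse_matrices R d (\<lambda>i j. A i j \<xi>) (\<lambda>i j. B i j \<xi>))"
    unfolding ae_conj by simp
  then have "ae (\<lambda>\<xi>. \<beta> \<xi> \<in> AffAut c F d k ar P)"
  proof (rule ae_mono)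
    fix \<xi>
    assume *: "((\<forall>x\<in>points F d. \<forall>y\<in>points F d. \<beta> \<xi> x = \<beta> \<xi> y \<longrightarrow> x = y) \<and>
      (\<forall>y\<in>points F d. \<exists>x\<in>points F d. y = \<beta> \<xi> x)) \<and>
      (\<forall>p\<in>rel_syms ?L. \<forall>xs\<in>nlists (rel_arity ?L p) (points F d).
        xs \<in> rel_interp ?G p \<longleftrightarrow> map (\<beta> \<xi>) xs \<in> rel_interp ?G p) \<and>
      inverse_matrices R d (\<lambda>i j. A i j \<xi>) (\<lambda>i j. B i j \<xi>)"
    have "bij_betw (\<beta> \<xi>) (points F d) (points F d)"
      unfolding bij_betw_def inj_on_def using * \<beta>_closed by blast
    moreover have "\<beta> \<xi> \<in> extensional (points F d)"
      unfolding \<beta>_def affine_map_def points_def carrier_R by simp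
    ultimately have "\<beta> \<xi> \<in> Aut ?L ?G"
      using * unfolding Aut_def Bij_def uG by (simp add: geo_language_def)
    moreover have "(\<lambda>i j. A i j \<xi>) \<in> GL R d"
    proof -
      have "\<forall>i<d. \<forall>j<d. A i j \<xi> \<in> carrier R" "\<forall>i<d. \<forall>j<d. B i j \<xi> \<in> carrier R"
        using A(1) B(1) seqs_in by simp_all
      moreover have "inverse_matrices R d (\<lambda>i j. A i j \<xi>) (\<lambda>i j. B i j \<xi>)" using * by (elim conjE)
      ultimately show ?thesis unfolding GL_def by (intro CollectI conjI exI[of _ "\<lambda>i j. B i j \<xi>"])
    qed
    moreover have "b \<xi> \<in> nlists d (carrier R)" using b(1) unfolding pts_iff points_def carrier_R by blast
    ultimately show "\<beta> \<xi> \<in> AffAut c F d k ar P" unfolding AffAut_def Aff_def \<beta>_def by blast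
  qed
  then show ?thesis using \<beta> by (intro exI[of _ \<beta>] conjI ballI)
qed

lemma preserved_by_AffAut_transfer:
  assumes transfers: "\<And>p. p \<in> rel_syms (geo_language k ar) \<Longrightarrow>
      transfers (rel_arity (geo_language k ar) p) (rel_interp (geometry c N d P') p) (rel_interp (geometry c F d P) p)"
    and \<alpha>: "\<alpha> \<in> AffAut c N d k ar P'"
    and S: "transfers n S' S" "preserved_by S (AffAut c F d k ar P)"
    and xs: "xs \<in> nlists n (points N d)" "xs \<in> S'"
  shows "map \<alpha> xs \<in> S'"
proof -
  obtain \<beta> where \<beta>: "ae (\<lambda>\<xi>. \<beta> \<xi> \<in> AffAut c F d k ar P)"
    "\<And>f. f \<in> pts \<Longrightarrow> (\<lambda>\<xi>. \<beta> \<xi> (f \<xi>)) \<in> pts" "\<And>f. f \<in> pts \<Longrightarrow> \<alpha> (pt f) = pt (\<lambda>\<xi>. \<beta> \<xi> (f \<xi>))"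
    using AffAut_pointwise[OF transfers \<alpha>] by blast
  obtain fs where fs: "set fs \<subseteq> pts" "length fs = n" "xs = map pt fs" using nlists_pt[OF xs(1)] by blast
  define gs where "gs = map (\<lambda>f \<xi>. \<beta> \<xi> (f \<xi>)) fs"
  have gs: "set gs \<subseteq> pts" "length gs = n" using fs \<beta>(2) unfolding gs_def by auto
  have "ae (\<lambda>\<xi>. map (\<lambda>f. f \<xi>) fs \<in> S)" using S(1) fs xs(2) unfolding transfers_def by simp
  with \<beta>(1) have "ae (\<lambda>\<xi>. \<beta> \<xi> \<in> AffAut c F d k ar P \<and> map (\<lambda>f. f \<xi>) fs \<in> S)" unfolding ae_conj by blast
  then have "ae (\<lambda>\<xi>. map (\<lambda>f. f \<xi>) gs \<in> S)"
  proof (rule ae_mono)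
    fix \<xi> assume "\<beta> \<xi> \<in> AffAut c F d k ar P \<and> map (\<lambda>f. f \<xi>) fs \<in> S"
    then have "map (\<beta> \<xi>) (map (\<lambda>f. f \<xi>) fs) \<in> S" using S(2) unfolding preserved_by_def by blast
    then show "map (\<lambda>f. f \<xi>) gs \<in> S" unfolding gs_def by (simp add: comp_def)
  qed
  then have "map pt gs \<in> S'" using S(1) gs unfolding transfers_def by simp
  moreover have "map \<alpha> xs = map pt gs" using fs \<beta>(3) unfolding gs_def by auto
  ultimately show ?thesis by simp
qed

text \<open>Preservation of equality makes the correspondence well-defined and injective on classes,
  totality on both sides makes it a bijection, and preservation of the atomic formulas makes it an
  automorphism.\<close>

lemma correspondence_automorphism:
  assumes transfers: "\<And>p. p \<in> rel_syms (geo_language k ar) \<Longrightarrow>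
      transfers (rel_arity (geo_language k ar) p) (rel_interp (geometry c N d P') p) (rel_interp (geometry c F d P) p)"
    and H: "H \<subseteq> pts \<times> pts" "\<And>f. f \<in> pts \<Longrightarrow> \<exists>g. (f, g) \<in> H" "\<And>f. f \<in> pts \<Longrightarrow> \<exists>g. (g, f) \<in> H"
    and elementary: "\<And>Q v. Q \<in> definable_preds (geo_language k ar) (geometry c F d P) \<Longrightarrow> range v \<subseteq> H \<Longrightarrow>
      ae (\<lambda>\<xi>. Q (\<lambda>i. fst (v i) \<xi>)) \<longleftrightarrow> ae (\<lambda>\<xi>. Q (\<lambda>i. snd (v i) \<xi>))"
  shows "\<exists>\<alpha>\<in>Aut (geo_language k ar) (geometry c N d P'). \<forall>(f, g)\<in>H. \<alpha> (pt f) = pt g"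
proof -
  let ?L = "geo_language k ar"
  let ?G = "geometry c F d P" and ?G' = "geometry c N d P'"
  have uG: "universe ?G' = points N d" by (simp add: geometry_def)
  have eq: "pt f = pt f' \<longleftrightarrow> pt g = pt g'" if "(f, g) \<in> H" "(f', g') \<in> H" for f g f' g'
  proof -
    let ?v = "\<lambda>i :: nat. if i = 0 then (f, g) else (f', g')"
    have "range ?v \<subseteq> H" using that by auto
    from elementary[OF definable_preds_closed(1) this]
    have "ae (\<lambda>\<xi>. f \<xi> = f' \<xi>) \<longleftrightarrow> ae (\<lambda>\<xi>. g \<xi> = g' \<xi>)" by simp
    moreover have "f \<in> pts" "f' \<in> pts" "g \<in> pts" "g' \<in> pts" using that H(1) by auto
    ultimately show ?thesis by (simp add: pt_eq_iff)
  qed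
  define \<alpha> where "\<alpha> = (\<lambda>x\<in>points N d. THE y. \<exists>f g. (f, g) \<in> H \<and> pt f = x \<and> pt g = y)"
  have \<alpha>: "\<alpha> (pt f) = pt g" if "(f, g) \<in> H" for f g
  proof -
    have "(THE y. \<exists>f' g'. (f', g') \<in> H \<and> pt f' = pt f \<and> pt g' = y) = pt g"
    proof (rule the_equality)
      fix y assume "\<exists>f' g'. (f', g') \<in> H \<and> pt f' = pt f \<and> pt g' = y"
      then show "y = pt g" using eq[OF _ that] by blast
    qed (use that in blast)
    moreover have "pt f \<in> points N d" using that H(1) pt_closed by blast
    ultimately show ?thesis unfolding \<alpha>_def by simp
  qed
  have "bij_betw \<alpha> (points N d) (points N d)"
    unfolding bij_betw_def
  proof
    show "inj_on \<alpha> (points N d)"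
    proof (rule inj_onI)
      fix x y assume "x \<in> points N d" "y \<in> points N d" and *: "\<alpha> x = \<alpha> y"
      then obtain f f' where f: "f \<in> pts" "f' \<in> pts" "x = pt f" "y = pt f'" unfolding points_N by blast
      obtain g g' where "(f, g) \<in> H" "(f', g') \<in> H" using H(2) f(1,2) by blast
      then show "x = y" using * eq[of f g f' g'] \<alpha>[of f g] \<alpha>[of f' g'] unfolding f(3,4) by simp
    qed
    show "\<alpha> ` points N d = points N d"
    proof
      show "\<alpha> ` points N d \<subseteq> points N d"
      proof
        fix y assume "y \<in> \<alpha> ` points N d"
        then obtain f where f: "f \<in> pts" "y = \<alpha> (pt f)" unfolding points_N by blast
        obtain g where g: "(f, g) \<in> H" using H(2)[OF f(1)] by blast
        then show "y \<in> points N d" using H(1) pt_closed \<alpha>[OF g] f(2) by auto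
      qed
      show "points N d \<subseteq> \<alpha> ` points N d"
      proof
        fix y assume "y \<in> points N d"
        then obtain g where g: "g \<in> pts" "y = pt g" unfolding points_N by blast
        obtain f where f: "(f, g) \<in> H" using H(3)[OF g(1)] by blast
        then have "pt f \<in> points N d" using H(1) pt_closed by blast
        then show "y \<in> \<alpha> ` points N d" using \<alpha>[OF f] g(2) by (metis imageI)
      qed
    qed
  qed
  moreover have "\<alpha> \<in> extensional (points N d)" unfolding \<alpha>_def by simp
  moreover have "xs \<in> rel_interp ?G' p \<longleftrightarrow> map \<alpha> xs \<in> rel_interp ?G' p"
    if p: "p \<in> rel_syms ?L" and xs: "xs \<in> nlists (rel_arity ?L p) (points N d)" for p xs
  proof -
    let ?m = "rel_arity ?L p"
    obtain fs where fs: "set fs \<subseteq> pts" "length fs = ?m" "xs = map pt fs" using nlists_pt[OF xs] by blast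
    define partner where "partner f = (SOME g. (f, g) \<in> H)" for f
    have partner: "(f, partner f) \<in> H" if "f \<in> pts" for f
      unfolding partner_def using H(2)[OF that] by (rule someI_ex)
    define gs where "gs = map partner fs"
    have gs: "set gs \<subseteq> pts" "length gs = ?m" using fs(1,2) partner H(1) unfolding gs_def by auto
    have xs': "map \<alpha> xs = map pt gs" using fs(1) partner \<alpha> unfolding fs(3) gs_def by auto
    obtain x0 where "x0 \<in> points F d" using points_nonempty by blast
    then have a: "(\<lambda>_. x0) \<in> pts" unfolding pts_iff by simp
    \<comment> \<open>The assignment has to be total with all values in H; beyond the arity it
      repeats a constant sequence with its partner.\<close>
    define v where "v i = (if i < ?m then (fs ! i, gs ! i) else (\<lambda>_. x0, partner (\<lambda>_. x0)))" for i
    have "fs ! i \<in> pts" if "i < ?m" for i using fs(1,2) that nth_mem by (metis subsetD)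
    then have "v i \<in> H" for i using partner a fs(2) unfolding v_def gs_def by auto
    then have v: "range v \<subseteq> H" by blast
    let ?\<phi> = "FRel p (map Var [0..<?m]) :: (unit, geo_rel) fm"
    have "(\<lambda>w. sat ?G w ?\<phi>) \<in> definable_preds ?L ?G"
      by (rule definable_predsI[of _ ?\<phi>]) (use p in auto)
    from elementary[OF this v]
    have "ae (\<lambda>\<xi>. map (\<lambda>i. fst (v i) \<xi>) [0..<?m] \<in> rel_interp ?G p) \<longleftrightarrow>
      ae (\<lambda>\<xi>. map (\<lambda>i. snd (v i) \<xi>) [0..<?m] \<in> rel_interp ?G p)" by (simp add: comp_def)
    moreover have "map (\<lambda>i. fst (v i) \<xi>) [0..<?m] = map (\<lambda>f. f \<xi>) fs"
      "map (\<lambda>i. snd (v i) \<xi>) [0..<?m] = map (\<lambda>f. f \<xi>) gs" for \<xi>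
      using fs(2) gs(2) by (auto intro!: nth_equalityI simp: v_def)
    ultimately show ?thesis
      using transfers[OF p] fs(1,2) gs unfolding transfers_def xs' by (simp add: fs(3))
  qed
  ultimately have "\<alpha> \<in> Aut ?L ?G'" unfolding Aut_def Bij_def uG by (simp add: geo_language_def)
  then show ?thesis using \<alpha> by blast
qed

lemma Aut_N_point_extension:
  assumes \<sigma>: "\<sigma> \<in> Aut L N" and \<psi>: "is_formula L (d * n) \<psi>" and xs: "xs \<in> point_extension N d n \<psi>"
  shows "map (map \<sigma>) xs \<in> point_extension N d n \<psi>"
proof -
  have xs': "xs \<in> nlists n (points N d)" "concat xs \<in> extension N (d * n) \<psi>"
    using xs unfolding point_extension_def by blast+
  then have cs: "concat xs \<in> nlists (d * n) (universe N)" unfolding extension_def by blast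
  have \<sigma>_in: "\<sigma> x \<in> universe N" if "x \<in> universe N" for x
    using \<sigma> that unfolding Aut_def Bij_def bij_betw_def by blast
  have bound: "i < d * n" if "i \<in> fv_fm \<psi>" for i using \<psi> that unfolding is_formula_def by blast
  have "sat N (nth (map \<sigma> (concat xs))) \<psi> = sat N (\<lambda>i. \<sigma> (concat xs ! i)) \<psi>"
    by (rule sat_cong) (use bound cs in simp)
  also have "\<dots> = sat N (nth (concat xs)) \<psi>"
    by (rule Aut_sat[OF \<sigma> fun_interp_N_closed])
      (use \<psi> bound nlistsE_nth_in[OF cs] in \<open>auto simp: is_formula_def\<close>)
  finally have "sat N (nth (map \<sigma> (concat xs))) \<psi>" using xs'(2) unfolding extension_def by blast
  moreover have "map \<sigma> (concat xs) \<in> nlists (d * n) (universe N)"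
    using nlistsE_set[OF cs] nlistsE_length[OF cs] \<sigma>_in by (intro nlistsI) auto
  moreover have "map \<sigma> x \<in> points N d" if "x \<in> points N d" for x
  proof -
    have "set x \<subseteq> universe N" "length x = d" using that unfolding points_def by simp_all
    then show ?thesis using \<sigma>_in unfolding points_def by (intro nlistsI) auto
  qed
  then have "map (map \<sigma>) xs \<in> nlists n (points N d)"
    using nlistsE_set[OF xs'(1)] nlistsE_length[OF xs'(1)] by (intro nlistsI) auto
  ultimately show ?thesis unfolding point_extension_def extension_def by (simp add: map_concat)
qed

lemma transfers_geometry:
  assumes "\<forall>i\<in>{1..k}. is_formula L (d * ar i) (\<phi> i) \<and> P i = point_extension F d (ar i) (\<phi> i)"
    and "p \<in> rel_syms (geo_language k ar)"
  shows "transfers (rel_arity (geo_language k ar) p)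
    (rel_interp (geometry c N d (\<lambda>i. point_extension N d (ar i) (\<phi> i))) p) (rel_interp (geometry c F d P) p)"
  using assms transfers_key_rel transfers_point_extension
  by (cases p) (auto simp: geo_language_def geometry_def)

end

section \<open>Definability and invariance under affine automorphisms\<close>

theorem theorem6p1:
  fixes c :: field_case
    and L :: "('f field_fun, 'p field_rel) language"
    and F :: "('f field_fun, 'p field_rel, 'a) struct"
    and d k n :: nat
    and ar :: "nat \<Rightarrow> nat"
    and P :: "nat \<Rightarrow> 'a list list set"
    and \<phi> :: "nat \<Rightarrow> ('f field_fun, 'p field_rel) fm"
    and R :: "'a list list set"
  assumes "d \<ge> 2"
    and "expands c L F"
    and "\<forall>i\<in>{1..k}. is_formula L (d * ar i) (\<phi> i) \<and> P i = point_extension F d (ar i) (\<phi> i)"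
    and "semilinearly_faithful TYPE((nat \<Rightarrow> 'a) set) c L F d k ar \<phi>"
    and "n \<ge> 1"
    and "point_definable L F d n R"
  shows "R \<in> Conc (geo_language k ar) (geometry c F d P)
     \<longleftrightarrow> preserved_by R (AffAut c F d k ar P)"
proof
  assume "R \<in> Conc (geo_language k ar) (geometry c F d P)"
  then show "preserved_by R (AffAut c F d k ar P)"
    using Conc_preserved unfolding preserved_by_def AffAut_def by blast
next
  let ?L = "geo_language k ar" and ?G = "geometry c F d P"
  assume preserved: "preserved_by R (AffAut c F d k ar P)"
  show "R \<in> Conc ?L ?G"
  proof (rule ccontr)
    assume nondef: "R \<notin> Conc ?L ?G"
    have uG: "universe ?G = points F d" by (simp add: geometry_def)
    have Rsub: "R \<subseteq> nlists n (points F d)" using assms(6) unfolding point_definable_def by blast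
    obtain \<psi> where \<psi>: "is_formula L (d * n) \<psi>" "R = point_extension F d n \<psi>"
      using point_definable_extension[OF assms(6)] by blast
    have struct: "is_structure L F" using assms(2) unfolding expands_def by blast
    have two: "\<exists>x y :: 'a. x \<noteq> y"
    proof -
      have "field (reduct_ring F)"
        using assms(2) unfolding expands_def ordered_field_def by (cases c) auto
      then have "\<zero>\<^bsub>reduct_ring F\<^esub> \<noteq> \<one>\<^bsub>reduct_ring F\<^esub>"
        using domain.one_not_zero field.axioms(1) by metis
      then show ?thesis by blast
    qed
    \<comment> \<open>For a finite field it is the passage to functions on \<open>nat\<close> that
      gives an infinite type: as 0 and 1 differ, there are infinitely many functions with a single
      exceptional value.\<close>
    have inf: "infinite (UNIV :: (nat \<Rightarrow> 'a) set)"
    proof -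
      obtain x y :: 'a where xy: "x \<noteq> y" using two by blast
      have "inj (\<lambda>m i :: nat. if i = m then x else y)"
        by (rule injI) (metis xy)
      then show ?thesis using finite_imageD[of "\<lambda>m i :: nat. if i = m then x else y" UNIV]
        by (meson finite_subset infinite_UNIV_nat subset_UNIV)
    qed
    have ne: "universe ?G \<noteq> {}"
      using nlists_not_empty[of "universe F" d] struct unfolding uG points_def is_structure_def by blast
    have card: "|universe ?G| \<le>o |UNIV :: (nat \<Rightarrow> 'a) set|"
    proof -
      have "inj_on (\<lambda>xs i. if i < d then xs ! i else undefined) (points F d)"
      proof (rule inj_onI)
        fix xs ys assume xs: "xs \<in> points F d" "ys \<in> points F d"
          and eq: "(\<lambda>i. if i < d then xs ! i else undefined) = (\<lambda>i. if i < d then ys ! i else undefined)"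
        have "xs ! i = ys ! i" if "i < d" for i using fun_cong[OF eq, of i] that by simp
        then show "xs = ys" using xs nlistsE_length unfolding points_def by (metis nth_equalityI)
      qed
      then show ?thesis unfolding uG using card_of_ordLeq[of "points F d" "UNIV :: (nat \<Rightarrow> 'a) set"] by blast
    qed
    \<comment> \<open>The formulas of the geometry are built over a countable type of symbols,
      however large the language of F is.\<close>
    have count: "countable (definable_preds ?L ?G)"
      unfolding definable_preds_def by (intro countable_image countableI_type)
    have Rsub': "R \<subseteq> nlists n (universe ?G)" using Rsub unfolding uG .
    have "\<exists>(U :: (nat \<Rightarrow> 'a) set set set) H a b. ultrafilter_on UNIV U \<and>
      H \<subseteq> {f. range f \<subseteq> universe ?G} \<times> {f. range f \<subseteq> universe ?G} \<and>
      (\<forall>f. range f \<subseteq> universe ?G \<longrightarrow> (\<exists>g. (f, g) \<in> H) \<and> (\<exists>g. (g, f) \<in> H)) \<and>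
      (\<forall>Q\<in>definable_preds ?L ?G. \<forall>v. range v \<subseteq> H \<longrightarrow>
        ({\<xi>. Q (\<lambda>k. fst (v k) \<xi>)} \<in> U \<longleftrightarrow> {\<xi>. Q (\<lambda>k. snd (v k) \<xi>)} \<in> U)) \<and>
      (\<forall>i<n. (a i, b i) \<in> H) \<and>
      {\<xi>. map (\<lambda>i. a i \<xi>) [0..<n] \<in> R} \<in> U \<and> {\<xi>. map (\<lambda>i. b i \<xi>) [0..<n] \<notin> R} \<in> U"
      by (rule separating_ultrafilter[OF inf ne card count definable_preds_support])
        (assumption | rule definable_preds_closed Rsub' assms(5) not_Conc_not_definable[OF nondef assms(5)])+
    then obtain U :: "(nat \<Rightarrow> 'a) set set set" and H a b where U: "ultrafilter_on UNIV U"
      and H: "H \<subseteq> {f. range f \<subseteq> points F d} \<times> {f. range f \<subseteq> points F d}"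
        "\<forall>f. range f \<subseteq> points F d \<longrightarrow> (\<exists>g. (f, g) \<in> H) \<and> (\<exists>g. (g, f) \<in> H)"
        "\<forall>Q\<in>definable_preds ?L ?G. \<forall>v. range v \<subseteq> H \<longrightarrow>
          ({\<xi>. Q (\<lambda>k. fst (v k) \<xi>)} \<in> U \<longleftrightarrow> {\<xi>. Q (\<lambda>k. snd (v k) \<xi>)} \<in> U)"
        "\<forall>i<n. (a i, b i) \<in> H"
      and aR: "{\<xi>. map (\<lambda>i. a i \<xi>) [0..<n] \<in> R} \<in> U" and bR: "{\<xi>. map (\<lambda>i. b i \<xi>) [0..<n] \<notin> R} \<in> U"
      unfolding uG by (elim exE conjE)
    interpret ultrapower_of_field U L F c d
      using U struct assms(2) by unfold_locales
    let ?P' = "\<lambda>i. point_extension N d (ar i) (\<phi> i)"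
    note geo = transfers_geometry[OF assms(3)]
    have Rt: "transfers n (point_extension N d n \<psi>) R"
      unfolding \<psi>(2) by (rule transfers_point_extension[OF \<psi>(1)])
    have Hp: "H \<subseteq> pts \<times> pts" "\<And>f. f \<in> pts \<Longrightarrow> \<exists>g. (f, g) \<in> H" "\<And>f. f \<in> pts \<Longrightarrow> \<exists>g. (g, f) \<in> H"
      using H(1,2) unfolding pts_def by blast+
    have elementary: "ae (\<lambda>\<xi>. Q (\<lambda>i. fst (v i) \<xi>)) \<longleftrightarrow> ae (\<lambda>\<xi>. Q (\<lambda>i. snd (v i) \<xi>))"
      if "Q \<in> definable_preds ?L ?G" "range v \<subseteq> H" for Q v
      using H(3) that unfolding ae_def by blast
    obtain \<alpha> where \<alpha>: "\<alpha> \<in> Aut ?L (geometry c N d ?P')" "\<forall>(f, g)\<in>H. \<alpha> (pt f) = pt g"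
      using correspondence_automorphism[OF geo Hp elementary] by blast
    \<comment> \<open>The index type of U, the sets of functions from \<open>nat\<close> to
      \<open>'a\<close>, is the one for which faithfulness is assumed.\<close>
    obtain A \<sigma> where A: "A \<in> AffAut c N d k ar ?P'" and \<sigma>: "\<sigma> \<in> Aut L N"
      and \<alpha>_eq: "\<alpha> = compose (points N d) A (map \<sigma>)"
      using assms(4) U \<alpha>(1) unfolding semilinearly_faithful_def Let_def by blast
    define as where "as = map (\<lambda>i. pt (a i)) [0..<n]"
    define bs where "bs = map (\<lambda>i. pt (b i)) [0..<n]"
    have ab: "a i \<in> pts" "b i \<in> pts" if "i < n" for i using H(4) Hp(1) that by auto
    have as: "as \<in> point_extension N d n \<psi>" and bs: "bs \<notin> point_extension N d n \<psi>"
    proof -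
      have "set (map a [0..<n]) \<subseteq> pts" "set (map b [0..<n]) \<subseteq> pts" using ab by auto
      then have "map pt (map a [0..<n]) \<in> point_extension N d n \<psi> \<longleftrightarrow> ae (\<lambda>\<xi>. map (\<lambda>f. f \<xi>) (map a [0..<n]) \<in> R)"
        "map pt (map b [0..<n]) \<in> point_extension N d n \<psi> \<longleftrightarrow> ae (\<lambda>\<xi>. map (\<lambda>f. f \<xi>) (map b [0..<n]) \<in> R)"
        using Rt unfolding transfers_def by (simp_all del: map_map set_map)
      moreover have "ae (\<lambda>\<xi>. map (\<lambda>i. a i \<xi>) [0..<n] \<in> R)" using aR unfolding ae_def .
      moreover have "\<not> ae (\<lambda>\<xi>. map (\<lambda>i. b i \<xi>) [0..<n] \<in> R)" 
        using bR ae_not[of "\<lambda>\<xi>. map (\<lambda>i. b i \<xi>) [0..<n] \<in> R"] unfolding ae_def by simp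
      ultimately show "as \<in> point_extension N d n \<psi>" "bs \<notin> point_extension N d n \<psi>"
        unfolding as_def bs_def by (simp_all add: comp_def)
    qed
    have \<sigma>as: "map (map \<sigma>) as \<in> point_extension N d n \<psi>" by (rule Aut_N_point_extension[OF \<sigma> \<psi>(1) as])
    then have "map (map \<sigma>) as \<in> nlists n (points N d)" unfolding point_extension_def by blast
    from preserved_by_AffAut_transfer[OF geo A Rt preserved this \<sigma>as]
    have "map A (map (map \<sigma>) as) \<in> point_extension N d n \<psi>" .
    moreover have "map A (map (map \<sigma>) as) = bs"
    proof -
      have "A (map \<sigma> (pt (a i))) = pt (b i)" if "i < n" for i
      proof -
        have "\<alpha> (pt (a i)) = pt (b i)" using \<alpha>(2) H(4) that by blast
        then show ?thesis using pt_closed[OF ab(1)[OF that]] unfolding \<alpha>_eq compose_def by simp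
      qed
      then show ?thesis unfolding as_def bs_def by simp
    qed
    ultimately show False using bs by simp
  qed
qed

end
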